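(* Let $n\in\mathbb{N}$ and $\alpha>-1$. Then $\mathcal{R}_n^{(\alpha)}$ consists of all operators belonging to $\mathcal{B}(\mathcal{A}_n^2(\mathbb{D},\mu_\alpha))$ that act invariantly on each subspace $\mathcal{W}^{(\alpha)}_{\xi,\min\{n,n+\xi\}}$, for $\xi\ge -n+1$. Furthermore, $$\mathcal{R}_n^{(\alpha)}\cong\bigoplus_{\xi=-n+1}^{\infty}\mathcal{B}\bigl(\mathcal{W}^{(\alpha)}_{\xi,\min\{n,n+\xi\}}\bigr),$$ and $\mathcal{R}_n^{(\alpha)}$ is spatially isomorphic to $\mathfrak{M}_n$: $$U_n^{(\alpha)}\,\mathcal{R}_n^{(\alpha)}\,(U_n^{(\alpha)})^{*}=\mathfrak{M}_n.$$
   Context: $\mathbb{N}=\{1,2,\dots\}$, $\mathbb{N}_0=\{0,1,2,\dots\}$, $\mathbb{D}$ is the open unit disk, $\mathbb{T}$ the unit circle, and $\mathrm{d}\mu_\alpha(z)=\frac{\alpha+1}{\pi}(1-|z|^2)^\alpha\,\mathrm{d}\mu(z)$ on $\mathbb{D}$, where $\mu$ is Lebesgue plane measure. $\mathcal{B}(H)$ is the algebra of bounded linear operators on a Hilbert space $H$. An operator $S$ acts invariantly on a subspace $W$ if $S(W)\subseteq W$. A function $f$ is $n$-analytic if it is smooth and $(\partial/\partial\overline{z})^n f=0$. $\mathcal{A}_n^2(\mathbb{D},\mu_\alpha)$ is the Hilbert space of $n$-analytic functions on $\mathbb{D}$ square-integrable with respect to $\mu_\alpha$, with the inner product $\langle\cdot,\cdot\rangle$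 of $L^2(\mathbb{D},\mu_\alpha)$. It is invariant under the rotations; for $\tau\in\mathbb{T}$ let $(\rho_n^{(\alpha)}(\tau)f)(z)=f(\tau^{-1}z)$ on $\mathcal{A}_n^2(\mathbb{D},\mu_\alpha)$. $\mathcal{R}_n^{(\alpha)}$ is the von Neumann algebra of radial operators, i.e. of all $S\in\mathcal{B}(\mathcal{A}_n^2(\mathbb{D},\mu_\alpha))$ commuting with $\rho_n^{(\alpha)}(\tau)$ for every $\tau\in\mathbb{T}$. Put $m_{p,q}(z)=z^p\overline{z}^q$. For $\xi\in\mathbb{Z}$ and $s\in\mathbb{N}$, $\mathcal{W}^{(\alpha)}_{\xi,s}=\operatorname{span}\{m_{p,q}:\ p,q\in\mathbb{N}_0,\ p-q=\xi,\ \min\{p,q\}<s\}$ with the inner product of $L^2(\mathbb{D},\mu_\alpha)$. For $p,q\in\mathbb{N}_0$ the normalized disk polynomial is $$b^{(\alpha)}_{p,q}(z)=(-1)^{p+q}\,\widetilde{c}^{(\alpha)}_{p,q}\,(1-z\overline{z})^{-\alpha}\,\frac{\partial^q}{\partial z^q}\frac{\partial^p}{\partial\overline{z}^p}\Bigl((1-z\overline{z})^{p+q+\alpha}\Bigr),\qquad \widetilde{c}^{(\alpha)}_{p,q}=\sqrt{\frac{(\alpha+p+q+1)\Gamma(\alpha+p+1)\Gamma(\alpha+q+1)}{(\alpha+1)\,p!\,q!\,\Gamma(\alpha+p+q+1)^2}}.$$ $U_n^{(\alpha)}:\mathcal{A}_n^2(\mathbb{D},\mu_\alpha)\to\bigoplus_{\xi=-n+1}^\infty\mathbb{C}^{\min\{n,n+\xi\}}$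 (Hilbert space direct sum) is the unitary operator $(U_n^{(\alpha)}f)_{\xi,q}=\langle f,b^{(\alpha)}_{q+\xi,q}\rangle$ for $\xi\ge-n+1$, $\max\{0,-\xi\}\le q\le n-1$ (for $\xi<0$ the components of vectors in $\mathbb{C}^{n+\xi}$ are enumerated from $-\xi$ to $n-1$). $\mathcal{M}_k$ is the algebra of complex $k\times k$ matrices, and $\mathfrak{M}_n=\bigoplus_{\xi=-n+1}^\infty\mathcal{M}_{\min\{n,n+\xi\}}$ is the W*-algebra of all matrix sequences $(A_\xi)_{\xi=-n+1}^\infty$, $A_\xi\in\mathcal{M}_{\min\{n,n+\xi\}}$, with $\sup_\xi\|A_\xi\|<\infty$; its elements are identified with the (block diagonal) bounded operators on $\bigoplus_{\xi=-n+1}^\infty\mathbb{C}^{\min\{n,n+\xi\}}$. Likewise direct sums of algebras $\mathcal{B}(W)$ consist of bounded families with the supremum norm, and $\cong$ denotes isometric isomorphism of W*-algebras. *)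

theory Defs
  imports "HOL-Analysis.Analysis" "HOL-Library.Function_Algebras"
begin

section \<open>Hilbert spaces of complex-valued functions and their operators\<close>

definition fscale :: "complex \<Rightarrow> ('x \<Rightarrow> complex) \<Rightarrow> 'x \<Rightarrow> complex" where
  "fscale c f = (\<lambda>x. c * f x)"

interpretation cfun: vector_space "fscale :: complex \<Rightarrow> ('x \<Rightarrow> complex) \<Rightarrow> 'x \<Rightarrow> complex"
  by unfold_locales (auto simp: fscale_def plus_fun_def algebra_simps)

text \<open>
  All Hilbert spaces below are spaces of functions with the pointwise vector operations; such a
  space is given by its set of vectors and its inner product (linear in the first argument).
\<close>

record 'x fspace =
  vecs :: "('x \<Rightarrow> complex) set"
  ip :: "('x \<Rightarrow> complex) \<Rightarrow> ('x \<Rightarrow> complex) \<Rightarrow> complex"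

definition vnorm :: "'x fspace \<Rightarrow> ('x \<Rightarrow> complex) \<Rightarrow> real" where
  "vnorm H f = sqrt (Re (ip H f f))"

definition linear_map :: "'x fspace \<Rightarrow> 'y fspace \<Rightarrow> (('x \<Rightarrow> complex) \<Rightarrow> 'y \<Rightarrow> complex) \<Rightarrow> bool" where
  "linear_map H K T \<longleftrightarrow> T \<in> vecs H \<rightarrow>\<^sub>E vecs K \<and>
     (\<forall>f\<in>vecs H. \<forall>g\<in>vecs H. T (f + g) = T f + T g) \<and>
     (\<forall>c. \<forall>f\<in>vecs H. T (fscale c f) = fscale c (T f))"

definition bounded_ops :: "'x fspace \<Rightarrow> (('x \<Rightarrow> complex) \<Rightarrow> 'x \<Rightarrow> complex) set" where
  "bounded_ops H = {T. linear_map H H T \<and> (\<exists>C. \<forall>f\<in>vecs H. vnorm H (T f) \<le> C * vnorm H f)}"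

definition op_norm :: "'x fspace \<Rightarrow> (('x \<Rightarrow> complex) \<Rightarrow> 'x \<Rightarrow> complex) \<Rightarrow> real" where
  "op_norm H T = (SUP f\<in>{f \<in> vecs H. vnorm H f \<le> 1}. vnorm H (T f))"

definition adj :: "'x fspace \<Rightarrow> 'y fspace \<Rightarrow> (('x \<Rightarrow> complex) \<Rightarrow> 'y \<Rightarrow> complex) \<Rightarrow>
    ('y \<Rightarrow> complex) \<Rightarrow> 'x \<Rightarrow> complex" where
  "adj H K T = (\<lambda>g\<in>vecs K. THE h. h \<in> vecs H \<and> (\<forall>f\<in>vecs H. ip K (T f) g = ip H f h))"

definition unitary_map :: "'x fspace \<Rightarrow> 'y fspace \<Rightarrow> (('x \<Rightarrow> complex) \<Rightarrow> 'y \<Rightarrow> complex) \<Rightarrow> bool" where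
  "unitary_map H K U \<longleftrightarrow> linear_map H K U \<and> bij_betw U (vecs H) (vecs K) \<and>
     (\<forall>f\<in>vecs H. \<forall>g\<in>vecs H. ip K (U f) (U g) = ip H f g)"

text \<open>
  Hilbert space direct sum over an index set \<open>I\<close>: the \<open>i\<close>-th component of \<open>x\<close> is
  \<open>\<lambda>a. x (i, a)\<close>, and components with \<open>i \<notin> I\<close> are zero.
\<close>

definition hilbert_sum :: "'i set \<Rightarrow> ('i \<Rightarrow> 'x fspace) \<Rightarrow> ('i \<times> 'x) fspace" where
  "hilbert_sum I H =
     \<lparr> vecs = {x. (\<forall>i a. i \<notin> I \<longrightarrow> x (i, a) = 0) \<and> (\<forall>i\<in>I. (\<lambda>a. x (i, a)) \<in> vecs (H i)) \<and>
                  (\<lambda>i. (vnorm (H i) (\<lambda>a. x (i, a)))\<^sup>2) summable_on I},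
       ip = (\<lambda>x y. \<Sum>\<^sub>\<infinity>i\<in>I. ip (H i) (\<lambda>a. x (i, a)) (\<lambda>a. y (i, a))) \<rparr>"

definition block_diag :: "'i set \<Rightarrow> ('i \<Rightarrow> 'x fspace) \<Rightarrow> ('i \<Rightarrow> ('x \<Rightarrow> complex) \<Rightarrow> 'x \<Rightarrow> complex) \<Rightarrow>
    ('i \<times> 'x \<Rightarrow> complex) \<Rightarrow> 'i \<times> 'x \<Rightarrow> complex" where
  "block_diag I H T = (\<lambda>x\<in>vecs (hilbert_sum I H).
     \<lambda>(i, a). if i \<in> I then T i (\<lambda>b. x (i, b)) a else 0)"

text \<open>The Euclidean space \<open>\<complex>\<^sup>k\<close> with coordinates enumerated by a finite set \<open>Q\<close> with \<open>k\<close> elements.\<close>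

definition coord_space :: "nat set \<Rightarrow> nat fspace" where
  "coord_space Q = \<lparr> vecs = {v. \<forall>q. q \<notin> Q \<longrightarrow> v q = 0}, ip = (\<lambda>v w. \<Sum>q\<in>Q. v q * cnj (w q)) \<rparr>"

definition matrix_op :: "nat set \<Rightarrow> (nat \<Rightarrow> nat \<Rightarrow> complex) \<Rightarrow> (nat \<Rightarrow> complex) \<Rightarrow> nat \<Rightarrow> complex" where
  "matrix_op Q A = (\<lambda>v\<in>vecs (coord_space Q). \<lambda>q. if q \<in> Q then \<Sum>r\<in>Q. A q r * v r else 0)"


section \<open>Normed *-algebras\<close>

record 'a nstar_alg =
  elems :: "'a set"
  aplus :: "'a \<Rightarrow> 'a \<Rightarrow> 'a"
  ascale :: "complex \<Rightarrow> 'a \<Rightarrow> 'a"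
  amult :: "'a \<Rightarrow> 'a \<Rightarrow> 'a"
  astar :: "'a \<Rightarrow> 'a"
  anorm :: "'a \<Rightarrow> real"

definition alg_closed :: "'a nstar_alg \<Rightarrow> bool" where
  "alg_closed A \<longleftrightarrow>
     (\<forall>x\<in>elems A. \<forall>y\<in>elems A. aplus A x y \<in> elems A \<and> amult A x y \<in> elems A) \<and>
     (\<forall>x\<in>elems A. astar A x \<in> elems A \<and> (\<forall>c. ascale A c x \<in> elems A))"

text \<open>
  Isometric isomorphism of W*-algebras. Normality need not be demanded: a *-isomorphism preserves
  the order, whose positive cone consists of the elements \<open>x\<^sup>* x\<close>, hence all suprema.
\<close>

definition wstar_isomorphic :: "'a nstar_alg \<Rightarrow> 'b nstar_alg \<Rightarrow> bool" where
  "wstar_isomorphic A B \<longleftrightarrow> alg_closed A \<and> alg_closed B \<and>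
     (\<exists>\<phi>. bij_betw \<phi> (elems A) (elems B) \<and>
       (\<forall>x\<in>elems A. \<forall>y\<in>elems A. \<phi> (aplus A x y) = aplus B (\<phi> x) (\<phi> y) \<and>
                                  \<phi> (amult A x y) = amult B (\<phi> x) (\<phi> y)) \<and>
       (\<forall>c. \<forall>x\<in>elems A. \<phi> (ascale A c x) = ascale B c (\<phi> x)) \<and>
       (\<forall>x\<in>elems A. \<phi> (astar A x) = astar B (\<phi> x) \<and> anorm B (\<phi> x) = anorm A x))"

definition op_alg :: "'x fspace \<Rightarrow> (('x \<Rightarrow> complex) \<Rightarrow> 'x \<Rightarrow> complex) nstar_alg" where
  "op_alg H =
     \<lparr> elems = bounded_ops H,
       aplus = (\<lambda>S T. \<lambda>f\<in>vecs H. S f + T f),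
       ascale = (\<lambda>c S. \<lambda>f\<in>vecs H. fscale c (S f)),
       amult = compose (vecs H),
       astar = adj H H,
       anorm = op_norm H \<rparr>"

definition alg_sum :: "'i set \<Rightarrow> ('i \<Rightarrow> 'a nstar_alg) \<Rightarrow> ('i \<Rightarrow> 'a) nstar_alg" where
  "alg_sum I A =
     \<lparr> elems = {x \<in> (\<Pi>\<^sub>E i\<in>I. elems (A i)). bdd_above ((\<lambda>i. anorm (A i) (x i)) ` I)},
       aplus = (\<lambda>x y. \<lambda>i\<in>I. aplus (A i) (x i) (y i)),
       ascale = (\<lambda>c x. \<lambda>i\<in>I. ascale (A i) c (x i)),
       amult = (\<lambda>x y. \<lambda>i\<in>I. amult (A i) (x i) (y i)),
       astar = (\<lambda>x. \<lambda>i\<in>I. astar (A i) (x i)),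
       anorm = (\<lambda>x. SUP i\<in>I. anorm (A i) (x i)) \<rparr>"


section \<open>Polyanalytic functions on the unit disk\<close>

definition d_z :: "(complex \<Rightarrow> complex) \<Rightarrow> complex \<Rightarrow> complex" where
  "d_z f z = (frechet_derivative f (at z) 1 - \<i> * frechet_derivative f (at z) \<i>) / 2"

definition d_zbar :: "(complex \<Rightarrow> complex) \<Rightarrow> complex \<Rightarrow> complex" where
  "d_zbar f z = (frechet_derivative f (at z) 1 + \<i> * frechet_derivative f (at z) \<i>) / 2"

fun Ck_on :: "nat \<Rightarrow> complex set \<Rightarrow> (complex \<Rightarrow> complex) \<Rightarrow> bool" where
  "Ck_on 0 S f \<longleftrightarrow> continuous_on S f"
| "Ck_on (Suc k) S f \<longleftrightarrow> (\<forall>z\<in>S. f differentiable (at z)) \<and>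
     (\<forall>v. Ck_on k S (\<lambda>z. frechet_derivative f (at z) v))"

definition n_analytic_on :: "nat \<Rightarrow> complex set \<Rightarrow> (complex \<Rightarrow> complex) \<Rightarrow> bool" where
  "n_analytic_on n S f \<longleftrightarrow> (\<forall>k. Ck_on k S f) \<and> (\<forall>z\<in>S. (d_zbar ^^ n) f z = 0)"

definition mu :: "real \<Rightarrow> complex measure" where
  "mu \<alpha> = density lborel
     (\<lambda>z. ennreal (indicator (ball 0 1) z * ((\<alpha> + 1) / pi * (1 - (cmod z)\<^sup>2) powr \<alpha>)))"

definition l2_ip :: "real \<Rightarrow> (complex \<Rightarrow> complex) \<Rightarrow> (complex \<Rightarrow> complex) \<Rightarrow> complex" where
  "l2_ip \<alpha> f g = (LINT z|mu \<alpha>. f z * cnj (g z))"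

text \<open>
  Functions on the unit disk are represented by functions on \<open>\<complex>\<close> that vanish outside of it.
\<close>

definition on_disk :: "(complex \<Rightarrow> complex) \<Rightarrow> complex \<Rightarrow> complex" where
  "on_disk f = (\<lambda>z. if z \<in> ball 0 1 then f z else 0)"

definition polyanalytic_space :: "nat \<Rightarrow> real \<Rightarrow> complex fspace" where
  "polyanalytic_space n \<alpha> =
     \<lparr> vecs = {f. n_analytic_on n (ball 0 1) f \<and> (\<forall>z. z \<notin> ball 0 1 \<longrightarrow> f z = 0) \<and>
                  integrable (mu \<alpha>) (\<lambda>z. (cmod (f z))\<^sup>2)},
       ip = l2_ip \<alpha> \<rparr>"

definition rotation :: "nat \<Rightarrow> real \<Rightarrow> complex \<Rightarrow> (complex \<Rightarrow> complex) \<Rightarrow> complex \<Rightarrow> complex" where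
  "rotation n \<alpha> \<tau> = (\<lambda>f\<in>vecs (polyanalytic_space n \<alpha>). \<lambda>z. f (inverse \<tau> * z))"

definition radial_ops :: "nat \<Rightarrow> real \<Rightarrow> ((complex \<Rightarrow> complex) \<Rightarrow> complex \<Rightarrow> complex) set" where
  "radial_ops n \<alpha> = {S \<in> bounded_ops (polyanalytic_space n \<alpha>). \<forall>\<tau>. cmod \<tau> = 1 \<longrightarrow>
     compose (vecs (polyanalytic_space n \<alpha>)) S (rotation n \<alpha> \<tau>) =
     compose (vecs (polyanalytic_space n \<alpha>)) (rotation n \<alpha> \<tau>) S}"

definition radial_alg :: "nat \<Rightarrow> real \<Rightarrow> ((complex \<Rightarrow> complex) \<Rightarrow> complex \<Rightarrow> complex) nstar_alg" where
  "radial_alg n \<alpha> = (op_alg (polyanalytic_space n \<alpha>)) \<lparr> elems := radial_ops n \<alpha> \<rparr>"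

definition monomial :: "nat \<Rightarrow> nat \<Rightarrow> complex \<Rightarrow> complex" where
  "monomial p q = on_disk (\<lambda>z. z ^ p * cnj z ^ q)"

definition W_space :: "real \<Rightarrow> int \<Rightarrow> nat \<Rightarrow> complex fspace" where
  "W_space \<alpha> \<xi> s =
     \<lparr> vecs = cfun.span {monomial p q | p q. int p - int q = \<xi> \<and> min p q < s},
       ip = l2_ip \<alpha> \<rparr>"

definition disk_poly :: "real \<Rightarrow> nat \<Rightarrow> nat \<Rightarrow> complex \<Rightarrow> complex" where
  "disk_poly \<alpha> p q = on_disk (\<lambda>z.
     (-1) ^ (p + q) *
     of_real (sqrt ((\<alpha> + real p + real q + 1) * Gamma (\<alpha> + real p + 1) * Gamma (\<alpha> + real q + 1) /
                    ((\<alpha> + 1) * fact p * fact q * (Gamma (\<alpha> + real p + real q + 1))\<^sup>2))) *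
     (1 - z * cnj z) powr of_real (- \<alpha>) *
     (d_z ^^ q) ((d_zbar ^^ p)
       (\<lambda>w. (1 - w * cnj w) powr of_real (real p + real q + \<alpha>))) z)"


section \<open>The sequence space and the algebra of matrix sequences\<close>

definition freqs :: "nat \<Rightarrow> int set" where
  "freqs n = {- int n + 1..}"

text \<open>For \<open>\<xi> \<in> freqs n\<close>, this set has \<open>min n (n + \<xi>)\<close> elements.\<close>

definition coords :: "nat \<Rightarrow> int \<Rightarrow> nat set" where
  "coords n \<xi> = {q. max 0 (- \<xi>) \<le> int q \<and> int q \<le> int n - 1}"

definition seq_space :: "nat \<Rightarrow> (int \<times> nat) fspace" where
  "seq_space n = hilbert_sum (freqs n) (\<lambda>\<xi>. coord_space (coords n \<xi>))"

definition U_op :: "nat \<Rightarrow> real \<Rightarrow> (complex \<Rightarrow> complex) \<Rightarrow> int \<times> nat \<Rightarrow> complex" where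
  "U_op n \<alpha> = (\<lambda>f\<in>vecs (polyanalytic_space n \<alpha>). \<lambda>(\<xi>, q).
     if \<xi> \<in> freqs n \<and> q \<in> coords n \<xi>
     then l2_ip \<alpha> f (disk_poly \<alpha> (nat (int q + \<xi>)) q) else 0)"

text \<open>
  Bounded matrix sequences, as block diagonal operators on \<open>seq_space n\<close>; the rows and columns of
  the \<open>\<xi>\<close>-th matrix are enumerated by \<open>coords n \<xi>\<close>, and \<open>A \<xi> q r\<close> is irrelevant for other \<open>q\<close>, \<open>r\<close>.
\<close>

definition matrix_seqs :: "nat \<Rightarrow> ((int \<times> nat \<Rightarrow> complex) \<Rightarrow> int \<times> nat \<Rightarrow> complex) set" where
  "matrix_seqs n =
     {block_diag (freqs n) (\<lambda>\<xi>. coord_space (coords n \<xi>)) (\<lambda>\<xi>. matrix_op (coords n \<xi>) (A \<xi>)) | A.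
        bdd_above ((\<lambda>\<xi>. op_norm (coord_space (coords n \<xi>)) (matrix_op (coords n \<xi>) (A \<xi>))) ` freqs n)}"

end

theory Submission
  imports Defs "HOL-Complex_Analysis.Complex_Analysis"
begin

text \<open>
  An \<open>n\<close>-analytic function on the disk is \<open>\<Sum>q<n. cnj z ^ q * g q z\<close> with holomorphic \<open>g q\<close>;
  sorting the monomials of its power series by the frequency \<open>\<xi> = p - q\<close> gives an expansion into
  elements of the spaces \<open>W\<^sub>\<xi>\<close>, which converges uniformly on smaller disks. Rotation invariance makes
  the pieces orthogonal there, and letting the radius tend to \<open>1\<close> yields Parseval's identity.
  Conversely, the monomial coefficients of the disk polynomials \<open>b\<^sub>p\<^sub>,\<^sub>q\<close> with \<open>q < n\<close> grow only polynomially in \<open>p\<close>,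
  so every square summable family of coordinates is attained. Hence the disk polynomials are an
  orthonormal basis and \<open>U\<close> is unitary. As \<open>\<rho>(\<tau>)\<close> acts on \<open>W\<^sub>\<xi>\<close> as the scalar \<open>\<tau>\<^sup>-\<^sup>\<xi>\<close>, an operator is
  radial iff it preserves every \<open>W\<^sub>\<xi>\<close>, that is, iff it is block diagonal in this basis.
\<close>

section \<open>Inner products on spaces of functions\<close>

text \<open>The locale \<open>orthonormal_blocks\<close> separates the operator theory from the
  analysis. In it the Hilbert space enters only through Parseval's identity and through
  \<open>synthesis\<close>, the existence of a vector with prescribed square summable coefficients.
  The latter takes the place of completeness: operators with given blocks, adjoints among them, are
  obtained by prescribing the coefficients of their values.

  On the analytic side the obstacle is that the expansion of an n-analytic function comes with
  uniform convergence on smaller disks only, so its inner products with other functions cannot be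
  computed term by term. The norm identity is therefore proved first with values in
  [0, \<infinity>], as a supremum over radii, before anything is known about square integrability.
  This single identity gives Parseval for a member of the space and square integrability for a
  synthesized function; applied to perturbations by one block, it also determines the inner
  products.\<close>

lemma linear_mapD:
  assumes "linear_map H K T"
  shows "f \<in> vecs H \<Longrightarrow> T f \<in> vecs K"
    and "f \<in> vecs H \<Longrightarrow> g \<in> vecs H \<Longrightarrow> T (f + g) = T f + T g"
    and "f \<in> vecs H \<Longrightarrow> T (fscale c f) = fscale c (T f)"
    and "f \<notin> vecs H \<Longrightarrow> T f = undefined"
  using assms by (auto simp: linear_map_def PiE_def extensional_def)

lemma linear_mapI:
  assumes "\<And>f. f \<in> vecs H \<Longrightarrow> T f \<in> vecs K" "\<And>f. f \<notin> vecs H \<Longrightarrow> T f = undefined"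
    and "\<And>f g. f \<in> vecs H \<Longrightarrow> g \<in> vecs H \<Longrightarrow> T (f + g) = T f + T g"
    and "\<And>c f. f \<in> vecs H \<Longrightarrow> T (fscale c f) = fscale c (T f)"
  shows "linear_map H K T"
  using assms by (auto simp: linear_map_def PiE_def extensional_def)

lemma fscale_zero [simp]: "fscale 0 f = 0" "fscale c 0 = 0"
  by (auto simp: fscale_def zero_fun_def)

lemma fscale_one [simp]: "fscale 1 f = f"
  by (simp add: fscale_def)

lemma linear_map_zero:
  assumes "linear_map H K T" "0 \<in> vecs H"
  shows "T 0 = 0"
  using linear_mapD(3)[OF assms, of 0] by simp

lemma linear_map_sum:
  assumes T: "linear_map H K T" and H: "cfun.subspace (vecs H)" and "\<And>i. i \<in> A \<Longrightarrow> f i \<in> vecs H"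
  shows "T (\<Sum>i\<in>A. fscale (c i) (f i)) = (\<Sum>i\<in>A. fscale (c i) (T (f i)))"
  using assms(3)
proof (induction A rule: infinite_finite_induct)
  case (insert a A)
  have "fscale (c a) (f a) \<in> vecs H" "(\<Sum>i\<in>A. fscale (c i) (f i)) \<in> vecs H"
    using insert.prems by (auto intro: cfun.subspace_scale[OF H] cfun.subspace_sum[OF H])
  then show ?case
    unfolding sum.insert[OF insert.hyps(1,2)]
    using insert by (simp only: linear_mapD(2,3)[OF T] insertI1 insertI2)
qed (simp_all add: linear_map_zero[OF T cfun.subspace_0[OF H]])

text \<open>The axioms speak of members only: \<open>l2_ip\<close> is a Bochner integral, which is
  additive only where the products involved are integrable.\<close>

locale inner_product_fspace =
  fixes H :: "'x fspace"
  assumes subspace: "cfun.subspace (vecs H)"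
    and ip_add_left: "f \<in> vecs H \<Longrightarrow> g \<in> vecs H \<Longrightarrow> h \<in> vecs H \<Longrightarrow> ip H (f + g) h = ip H f h + ip H g h"
    and ip_scale_left: "f \<in> vecs H \<Longrightarrow> h \<in> vecs H \<Longrightarrow> ip H (fscale c f) h = c * ip H f h"
    and ip_commute: "f \<in> vecs H \<Longrightarrow> g \<in> vecs H \<Longrightarrow> ip H g f = cnj (ip H f g)"
    and ip_nonneg: "f \<in> vecs H \<Longrightarrow> Re (ip H f f) \<ge> 0"
    and ip_definite: "f \<in> vecs H \<Longrightarrow> Re (ip H f f) = 0 \<Longrightarrow> f = 0"
begin

lemma zero_mem [simp]: "0 \<in> vecs H"
  and add_mem: "f \<in> vecs H \<Longrightarrow> g \<in> vecs H \<Longrightarrow> f + g \<in> vecs H"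
  and scale_mem: "f \<in> vecs H \<Longrightarrow> fscale c f \<in> vecs H"
  and diff_mem: "f \<in> vecs H \<Longrightarrow> g \<in> vecs H \<Longrightarrow> f - g \<in> vecs H"
  and sum_mem: "(\<And>i. i \<in> A \<Longrightarrow> F i \<in> vecs H) \<Longrightarrow> (\<Sum>i\<in>A. F i) \<in> vecs H"
  using subspace by (auto intro: cfun.subspace_0 cfun.subspace_add cfun.subspace_scale cfun.subspace_diff cfun.subspace_sum)

lemma ip_add_right:
  assumes "f \<in> vecs H" "g \<in> vecs H" "h \<in> vecs H"
  shows "ip H h (f + g) = ip H h f + ip H h g"
  using assms ip_commute[of "f + g" h] ip_commute[of f h] ip_commute[of g h] by (simp add: ip_add_left add_mem)

lemma ip_scale_right:
  assumes "f \<in> vecs H" "h \<in> vecs H"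
  shows "ip H h (fscale c f) = cnj c * ip H h f"
  using assms ip_commute[of "fscale c f" h] ip_commute[of f h] by (simp add: ip_scale_left scale_mem)

lemma ip_zero [simp]: "h \<in> vecs H \<Longrightarrow> ip H 0 h = 0" "h \<in> vecs H \<Longrightarrow> ip H h 0 = 0"
  using ip_scale_left[of 0 h 0] ip_scale_right[of 0 h 0] by auto

lemma ip_sum_left:
  "(\<And>i. i \<in> A \<Longrightarrow> F i \<in> vecs H) \<Longrightarrow> h \<in> vecs H \<Longrightarrow> ip H (\<Sum>i\<in>A. F i) h = (\<Sum>i\<in>A. ip H (F i) h)"
  by (induction A rule: infinite_finite_induct) (auto simp: ip_add_left sum_mem)

lemma ip_sum_right:
  "(\<And>i. i \<in> A \<Longrightarrow> F i \<in> vecs H) \<Longrightarrow> h \<in> vecs H \<Longrightarrow> ip H h (\<Sum>i\<in>A. F i) = (\<Sum>i\<in>A. ip H h (F i))"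
  by (induction A rule: infinite_finite_induct) (auto simp: ip_add_right sum_mem)

lemma ip_diff_left: "f \<in> vecs H \<Longrightarrow> g \<in> vecs H \<Longrightarrow> h \<in> vecs H \<Longrightarrow> ip H (f - g) h = ip H f h - ip H g h"
  using ip_add_left[of "f - g" g h] by (simp add: diff_mem)

lemma ip_diff_right: "f \<in> vecs H \<Longrightarrow> g \<in> vecs H \<Longrightarrow> h \<in> vecs H \<Longrightarrow> ip H h (f - g) = ip H h f - ip H h g"
  using ip_add_right[of "f - g" g h] by (simp add: diff_mem)

lemma vnorm_nonneg [simp]: "f \<in> vecs H \<Longrightarrow> vnorm H f \<ge> 0"
  by (simp add: vnorm_def ip_nonneg)

lemma vnorm_sq: "f \<in> vecs H \<Longrightarrow> (vnorm H f)\<^sup>2 = Re (ip H f f)"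
  by (simp add: vnorm_def ip_nonneg)

lemma ip_self: "f \<in> vecs H \<Longrightarrow> ip H f f = of_real ((vnorm H f)\<^sup>2)"
  using ip_commute[of f f] by (simp add: vnorm_sq complex_eq_iff)

text \<open>The single expansion from which Cauchy-Schwarz, the triangle inequality and polarization
  are read off.\<close>

lemma ip_add_scale_self:
  assumes "f \<in> vecs H" "g \<in> vecs H"
  shows "Re (ip H (f + fscale c g) (f + fscale c g)) =
    (vnorm H f)\<^sup>2 + 2 * Re (cnj c * ip H f g) + (cmod c)\<^sup>2 * (vnorm H g)\<^sup>2"
proof -
  have "ip H (f + fscale c g) (f + fscale c g) = ip H f f + cnj c * ip H f g + cnj (cnj c * ip H f g) + c * cnj c * ip H g g"
    using assms ip_commute[of f g]
    by (simp add: ip_add_left ip_add_right ip_scale_left ip_scale_right add_mem scale_mem) (simp add: algebra_simps)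
  then show ?thesis
    unfolding ip_self[OF assms(1)] ip_self[OF assms(2)] complex_norm_square[symmetric]
    by (simp only: plus_complex.sel of_real_mult[symmetric] Re_complex_of_real cnj.sel)
qed

lemma vnorm_scale: "f \<in> vecs H \<Longrightarrow> vnorm H (fscale c f) = cmod c * vnorm H f"
  using ip_add_scale_self[of 0 f c] by (simp add: vnorm_def real_sqrt_mult ip_nonneg)

lemma vnorm_zero [simp]: "vnorm H 0 = 0"
  by (simp add: vnorm_def)

lemma vnorm_eq_0: "f \<in> vecs H \<Longrightarrow> vnorm H f = 0 \<Longrightarrow> f = 0"
  using ip_definite[of f] vnorm_sq[of f] by simp

lemma cauchy_schwarz:
  assumes "f \<in> vecs H" "g \<in> vecs H"
  shows "cmod (ip H f g) \<le> vnorm H f * vnorm H g"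
proof (cases "g = 0")
  case False
  then have "vnorm H g \<noteq> 0" using assms vnorm_eq_0[of g] by blast
  then have g: "vnorm H g > 0" using vnorm_nonneg[OF assms(2)] by linarith
  \<comment> \<open>With this scalar, \<open>f + fscale ?c g\<close> is the component of
    \<open>f\<close> orthogonal to \<open>g\<close>; its squared norm is nonnegative.\<close>
  let ?c = "- ip H f g / of_real ((vnorm H g)\<^sup>2)"
  have "cnj (ip H f g) * ip H f g = of_real ((cmod (ip H f g))\<^sup>2)"
    by (subst mult.commute) (rule complex_norm_square[symmetric])
  then have c1: "cnj ?c * ip H f g = - of_real ((cmod (ip H f g))\<^sup>2 / (vnorm H g)\<^sup>2)"
    by simp
  have c2: "cmod ?c = cmod (ip H f g) / (vnorm H g)\<^sup>2"
    by (simp add: norm_divide norm_power)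
  have "0 \<le> Re (ip H (f + fscale ?c g) (f + fscale ?c g))"
    using assms by (intro ip_nonneg add_mem scale_mem)
  then have "0 \<le> (vnorm H f)\<^sup>2 - 2 * ((cmod (ip H f g))\<^sup>2 / (vnorm H g)\<^sup>2) + (cmod (ip H f g) / (vnorm H g)\<^sup>2)\<^sup>2 * (vnorm H g)\<^sup>2"
    unfolding ip_add_scale_self[OF assms] c1 c2 uminus_complex.sel Re_complex_of_real by simp
  also have "\<dots> = (vnorm H f)\<^sup>2 - (cmod (ip H f g))\<^sup>2 / (vnorm H g)\<^sup>2"
    using g by (simp add: power2_eq_square field_simps)
  finally have "(cmod (ip H f g))\<^sup>2 \<le> (vnorm H f * vnorm H g)\<^sup>2"
    using g by (simp add: field_simps power_mult_distrib)
  moreover have "0 \<le> vnorm H f * vnorm H g" using assms by (intro mult_nonneg_nonneg vnorm_nonneg)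
  ultimately show ?thesis by (rule power2_le_imp_le)
next
  case True
  then show ?thesis using assms by simp
qed

lemma vnorm_triangle:
  assumes "f \<in> vecs H" "g \<in> vecs H"
  shows "vnorm H (f + g) \<le> vnorm H f + vnorm H g"
proof (rule power2_le_imp_le)
  have "(vnorm H (f + g))\<^sup>2 = (vnorm H f)\<^sup>2 + 2 * Re (ip H f g) + (vnorm H g)\<^sup>2"
    unfolding vnorm_sq[OF add_mem[OF assms]]
    using ip_add_scale_self[OF assms, of 1] by (simp only: fscale_one) simp
  also have "\<dots> \<le> (vnorm H f + vnorm H g)\<^sup>2"
    using cauchy_schwarz[OF assms] complex_Re_le_cmod[of "ip H f g"] by (simp add: power2_sum)
  finally show "(vnorm H (f + g))\<^sup>2 \<le> (vnorm H f + vnorm H g)\<^sup>2" .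
qed (use assms in simp)

lemma ip_ext:
  assumes "g \<in> vecs H" "h \<in> vecs H" "\<And>f. f \<in> vecs H \<Longrightarrow> ip H f g = ip H f h"
  shows "g = h"
proof -
  have "ip H (g - h) (g - h) = ip H (g - h) g - ip H (g - h) h"
    using assms(1,2) by (simp add: ip_diff_right diff_mem)
  also have "\<dots> = 0" using assms diff_mem by simp
  finally have "g - h = 0" using assms by (intro ip_definite diff_mem) auto
  then show ?thesis by simp
qed

text \<open>By \<open>ip_ext\<close> at most one vector fits the description in \<open>adj\<close>.
  An adjoint can thus be exhibited directly instead of being drawn from a representation
  theorem.\<close>

lemma adj_apply:
  assumes "g \<in> vecs K" "h \<in> vecs H" "\<And>f. f \<in> vecs H \<Longrightarrow> ip K (T f) g = ip H f h"
  shows "adj H K T g = h"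
proof -
  have "(THE h. h \<in> vecs H \<and> (\<forall>f\<in>vecs H. ip K (T f) g = ip H f h)) = h"
  proof (rule the_equality)
    fix h' assume "h' \<in> vecs H \<and> (\<forall>f\<in>vecs H. ip K (T f) g = ip H f h')"
    then show "h' = h" using assms by (intro ip_ext) auto
  qed (use assms in auto)
  then show ?thesis using assms(1) by (simp add: adj_def)
qed

lemma bounded_opsE:
  assumes "T \<in> bounded_ops H"
  obtains C where "C \<ge> 0" "\<And>f. f \<in> vecs H \<Longrightarrow> vnorm H (T f) \<le> C * vnorm H f"
proof -
  from assms obtain C where C: "\<And>f. f \<in> vecs H \<Longrightarrow> vnorm H (T f) \<le> C * vnorm H f"
    by (auto simp: bounded_ops_def)
  \<comment> \<open>The constant in \<open>bounded_ops\<close> may be negative when every vector has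
    norm zero.\<close>
  have "vnorm H (T f) \<le> max 0 C * vnorm H f" if "f \<in> vecs H" for f
    using C[OF that] mult_right_mono[of C "max 0 C" "vnorm H f"] vnorm_nonneg[OF that] by linarith
  then show ?thesis by (intro that[of "max 0 C"]) auto
qed

lemma op_norm_least:
  assumes "T \<in> vecs H \<rightarrow> vecs H" "M \<ge> 0" "\<And>f. f \<in> vecs H \<Longrightarrow> vnorm H (T f) \<le> M * vnorm H f"
  shows "op_norm H T \<le> M"
  unfolding op_norm_def
proof (rule cSUP_least)
  show "{f \<in> vecs H. vnorm H f \<le> 1} \<noteq> {}" using zero_mem by fastforce
  fix f assume f: "f \<in> {f \<in> vecs H. vnorm H f \<le> 1}"
  then have "vnorm H (T f) \<le> M * vnorm H f" using assms by auto
  also have "\<dots> \<le> M * 1" using f assms(2) by (intro mult_left_mono) auto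
  finally show "vnorm H (T f) \<le> M" by simp
qed

lemma op_norm_bdd_above:
  assumes "T \<in> bounded_ops H"
  shows "bdd_above ((\<lambda>f. vnorm H (T f)) ` {f \<in> vecs H. vnorm H f \<le> 1})"
proof -
  obtain C where C: "C \<ge> 0" "\<And>f. f \<in> vecs H \<Longrightarrow> vnorm H (T f) \<le> C * vnorm H f"
    using bounded_opsE[OF assms] by blast
  show ?thesis
  proof (rule bdd_aboveI2)
    fix f assume f: "f \<in> {f \<in> vecs H. vnorm H f \<le> 1}"
    then have "vnorm H (T f) \<le> C * vnorm H f" using C by auto
    also have "\<dots> \<le> C * 1" using f C(1) by (intro mult_left_mono) auto
    finally show "vnorm H (T f) \<le> C" by simp
  qed
qed

lemma op_norm_upper:
  assumes T: "T \<in> bounded_ops H" and f: "f \<in> vecs H"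
  shows "vnorm H (T f) \<le> op_norm H T * vnorm H f"
proof (cases "vnorm H f = 0")
  case True
  then show ?thesis using bounded_opsE[OF T] f by (metis mult_zero_right)
next
  case False
  then have pos: "vnorm H f > 0" using vnorm_nonneg[OF f] by simp
  have lin: "linear_map H H T" using T by (simp add: bounded_ops_def)
  let ?g = "fscale (of_real (1 / vnorm H f)) f"
  have g: "?g \<in> vecs H" "vnorm H ?g \<le> 1"
    using f pos by (auto simp: scale_mem vnorm_scale norm_divide)
  have "vnorm H (T ?g) = 1 / vnorm H f * vnorm H (T f)"
    using f pos linear_mapD[OF lin] by (simp add: vnorm_scale norm_divide)
  then have "vnorm H (T f) = vnorm H (T ?g) * vnorm H f" using pos by simp
  also have "vnorm H (T ?g) \<le> op_norm H T"
    unfolding op_norm_def using g by (intro cSUP_upper op_norm_bdd_above[OF T]) auto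
  finally show ?thesis using pos by (simp add: mult_right_mono)
qed

lemma op_norm_nonneg:
  assumes T: "T \<in> bounded_ops H"
  shows "op_norm H T \<ge> 0"
proof -
  have "T 0 = 0" using T by (intro linear_map_zero) (auto simp: bounded_ops_def)
  with op_norm_bdd_above[OF T] show ?thesis
    unfolding op_norm_def by (intro cSUP_upper2[of _ _ 0]) auto
qed

lemma bounded_ops_add:
  assumes "S \<in> bounded_ops H" "T \<in> bounded_ops H"
  shows "(\<lambda>f\<in>vecs H. S f + T f) \<in> bounded_ops H"
proof -
  obtain C where C: "C \<ge> 0" "\<And>f. f \<in> vecs H \<Longrightarrow> vnorm H (S f) \<le> C * vnorm H f"
    using bounded_opsE[OF assms(1)] by blast
  obtain D where D: "D \<ge> 0" "\<And>f. f \<in> vecs H \<Longrightarrow> vnorm H (T f) \<le> D * vnorm H f"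
    using bounded_opsE[OF assms(2)] by blast
  have S: "linear_map H H S" and T: "linear_map H H T" using assms by (auto simp: bounded_ops_def)
  have "vnorm H (S f + T f) \<le> (C + D) * vnorm H f" if "f \<in> vecs H" for f
    using vnorm_triangle[of "S f" "T f"] C(2)[OF that] D(2)[OF that] linear_mapD(1)[OF S that] linear_mapD(1)[OF T that]
    by (simp add: algebra_simps)
  moreover have "linear_map H H (\<lambda>f\<in>vecs H. S f + T f)"
    using linear_mapD[OF S] linear_mapD[OF T]
    by (intro linear_mapI) (auto simp: add_mem scale_mem cfun.scale_right_distrib add_ac)
  ultimately show ?thesis by (auto simp: bounded_ops_def)
qed

lemma bounded_ops_scale:
  assumes "S \<in> bounded_ops H"
  shows "(\<lambda>f\<in>vecs H. fscale c (S f)) \<in> bounded_ops H"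
proof -
  obtain C where C: "C \<ge> 0" "\<And>f. f \<in> vecs H \<Longrightarrow> vnorm H (S f) \<le> C * vnorm H f"
    using bounded_opsE[OF assms(1)] by blast
  have S: "linear_map H H S" using assms by (auto simp: bounded_ops_def)
  have "vnorm H (fscale c (S f)) \<le> (cmod c * C) * vnorm H f" if "f \<in> vecs H" for f
    using C(2)[OF that] linear_mapD(1)[OF S that] by (simp add: vnorm_scale mult.assoc mult_left_mono)
  moreover have "linear_map H H (\<lambda>f\<in>vecs H. fscale c (S f))"
    using linear_mapD[OF S]
    by (intro linear_mapI) (auto simp: add_mem scale_mem cfun.scale_right_distrib cfun.scale_scale mult.commute)
  ultimately show ?thesis by (auto simp: bounded_ops_def)
qed

lemma bounded_ops_compose:
  assumes "S \<in> bounded_ops H" "T \<in> bounded_ops H"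
  shows "compose (vecs H) S T \<in> bounded_ops H"
proof -
  obtain C where C: "C \<ge> 0" "\<And>f. f \<in> vecs H \<Longrightarrow> vnorm H (S f) \<le> C * vnorm H f"
    using bounded_opsE[OF assms(1)] by blast
  obtain D where D: "D \<ge> 0" "\<And>f. f \<in> vecs H \<Longrightarrow> vnorm H (T f) \<le> D * vnorm H f"
    using bounded_opsE[OF assms(2)] by blast
  have S: "linear_map H H S" and T: "linear_map H H T" using assms by (auto simp: bounded_ops_def)
  have "vnorm H (S (T f)) \<le> (C * D) * vnorm H f" if "f \<in> vecs H" for f
  proof -
    have "vnorm H (S (T f)) \<le> C * vnorm H (T f)" using C(2) linear_mapD(1)[OF T that] by blast
    also have "\<dots> \<le> C * (D * vnorm H f)" using C(1) D(2)[OF that] by (intro mult_left_mono)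
    finally show ?thesis by (simp add: mult.assoc)
  qed
  moreover have "linear_map H H (compose (vecs H) S T)"
    using linear_mapD[OF S] linear_mapD[OF T]
    by (intro linear_mapI) (auto simp: compose_def add_mem scale_mem)
  ultimately show ?thesis by (auto simp: bounded_ops_def compose_def)
qed

end

section \<open>Block diagonal operators with respect to an orthonormal basis\<close>

lemma span_image_finite:
  assumes "finite A" "g \<in> cfun.span (v ` A)"
  shows "\<exists>c. g = (\<Sum>q\<in>A. fscale (c q) (v q))"
  using assms(2)
proof (induction rule: cfun.span_induct_alt)
  case base
  show ?case by (rule exI[of _ "\<lambda>_. 0"]) simp
next
  case (step a x y)
  then obtain q0 c where q0: "q0 \<in> A" "x = v q0" and y: "y = (\<Sum>q\<in>A. fscale (c q) (v q))" by auto
  have "fscale a x + y = (\<Sum>q\<in>A. fscale (if q = q0 then a else 0) (v q)) + (\<Sum>q\<in>A. fscale (c q) (v q))"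
    using q0 assms(1) by (subst sum.remove[of _ q0]) (auto simp: y sum.remove[of _ q0])
  also have "\<dots> = (\<Sum>q\<in>A. fscale ((if q = q0 then a else 0) + c q) (v q))"
    by (simp only: sum.distrib[symmetric] cfun.scale_left_distrib)
  finally show ?case by (rule exI[of _ "\<lambda>q. (if q = q0 then a else 0) + c q"])
qed

lemma (in inner_product_fspace) polarization:
  assumes "f \<in> vecs H" "g \<in> vecs H"
  shows "ip H f g = of_real (((vnorm H (f + fscale 1 g))\<^sup>2 - (vnorm H (f + fscale (- 1) g))\<^sup>2) / 4) +
    \<i> * of_real (((vnorm H (f + fscale \<i> g))\<^sup>2 - (vnorm H (f + fscale (- \<i>) g))\<^sup>2) / 4)"
proof -
  have v: "(vnorm H (f + fscale c g))\<^sup>2 = (vnorm H f)\<^sup>2 + 2 * Re (cnj c * ip H f g) + (cmod c)\<^sup>2 * (vnorm H g)\<^sup>2" for c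
    using ip_add_scale_self[OF assms, of c] assms by (simp add: vnorm_sq add_mem scale_mem)
  show ?thesis unfolding v by (simp add: complex_eq_iff)
qed

text \<open>In the application \<open>i\<close> is the frequency and \<open>e i q\<close> a disk
  polynomial. \<open>parseval\<close> says that the system is complete, \<open>synthesis\<close> is
  the Riesz-Fischer property. Each block is also given as a space \<open>W i\<close> of its own,
  with the inner product of \<open>H\<close>, so that \<open>bounded_ops (W i)\<close> and
  \<open>op_norm (W i)\<close> make sense.\<close>

locale orthonormal_blocks = inner_product_fspace H for H :: "'x fspace" +
  fixes I :: "'i set" and Q :: "'i \<Rightarrow> nat set" and e :: "'i \<Rightarrow> nat \<Rightarrow> 'x \<Rightarrow> complex" and W :: "'i \<Rightarrow> 'x fspace"
  assumes I_nonempty: "I \<noteq> {}"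
    and finite_Q: "i \<in> I \<Longrightarrow> finite (Q i)"
    and e_mem: "i \<in> I \<Longrightarrow> q \<in> Q i \<Longrightarrow> e i q \<in> vecs H"
    and orthonormal: "i \<in> I \<Longrightarrow> q \<in> Q i \<Longrightarrow> j \<in> I \<Longrightarrow> r \<in> Q j \<Longrightarrow> ip H (e i q) (e j r) = (if i = j \<and> q = r then 1 else 0)"
    and vecs_W: "i \<in> I \<Longrightarrow> vecs (W i) = cfun.span (e i ` Q i)"
    and ip_W: "i \<in> I \<Longrightarrow> ip (W i) = ip H"
    and parseval: "f \<in> vecs H \<Longrightarrow> ((\<lambda>i. \<Sum>q\<in>Q i. (cmod (ip H f (e i q)))\<^sup>2) has_sum Re (ip H f f)) I"
    and synthesis: "\<And>x. (\<lambda>i. \<Sum>q\<in>Q i. (cmod (x i q))\<^sup>2) summable_on I \<Longrightarrow>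
      \<exists>f\<in>vecs H. \<forall>i\<in>I. \<forall>q\<in>Q i. ip H f (e i q) = x i q"
begin

definition proj :: "'i \<Rightarrow> ('x \<Rightarrow> complex) \<Rightarrow> 'x \<Rightarrow> complex" where
  "proj i f = (\<Sum>q\<in>Q i. fscale (ip H f (e i q)) (e i q))"

lemma W_subset: "i \<in> I \<Longrightarrow> vecs (W i) \<subseteq> vecs H"
  unfolding vecs_W by (rule cfun.span_minimal[OF _ subspace]) (auto intro: e_mem)

lemma W_mem: "i \<in> I \<Longrightarrow> g \<in> vecs (W i) \<Longrightarrow> g \<in> vecs H"
  using W_subset by auto

lemma e_in_W: "i \<in> I \<Longrightarrow> q \<in> Q i \<Longrightarrow> e i q \<in> vecs (W i)"
  unfolding vecs_W by (auto intro: cfun.span_base)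

lemma comb_in_W: "i \<in> I \<Longrightarrow> (\<Sum>q\<in>Q i. fscale (c q) (e i q)) \<in> vecs (W i)"
  unfolding vecs_W by (intro cfun.span_sum cfun.span_scale cfun.span_base imageI)

lemma proj_in_W: "i \<in> I \<Longrightarrow> proj i f \<in> vecs (W i)"
  unfolding proj_def by (rule comb_in_W)

lemma proj_mem: "i \<in> I \<Longrightarrow> proj i f \<in> vecs H"
  using proj_in_W W_mem by blast

lemma ip_comb:
  assumes "i \<in> I" "j \<in> I" "q \<in> Q j"
  shows "ip H (\<Sum>r\<in>Q i. fscale (c r) (e i r)) (e j q) = (if i = j then c q else 0)"
proof -
  have "ip H (\<Sum>r\<in>Q i. fscale (c r) (e i r)) (e j q) = (\<Sum>r\<in>Q i. c r * (if i = j \<and> r = q then 1 else 0))"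
    using assms by (subst ip_sum_left) (auto simp: ip_scale_left e_mem scale_mem orthonormal)
  also have "\<dots> = (if i = j then c q else 0)"
    using assms finite_Q by (auto simp: if_distrib cong: if_cong)
  finally show ?thesis .
qed

lemma ip_proj:
  "i \<in> I \<Longrightarrow> j \<in> I \<Longrightarrow> q \<in> Q j \<Longrightarrow> ip H (proj i f) (e j q) = (if i = j then ip H f (e j q) else 0)"
  unfolding proj_def by (subst ip_comb) auto

lemma proj_W:
  assumes "i \<in> I" "g \<in> vecs (W i)"
  shows "proj i g = g"
proof -
  obtain c where c: "g = (\<Sum>q\<in>Q i. fscale (c q) (e i q))"
    using span_image_finite[OF finite_Q[OF assms(1)]] assms vecs_W by blast
  show ?thesis unfolding proj_def
    by (subst (2) c, rule sum.cong[OF refl]) (simp add: c ip_comb assms(1))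
qed

lemma ip_W_other: "i \<in> I \<Longrightarrow> j \<in> I \<Longrightarrow> i \<noteq> j \<Longrightarrow> g \<in> vecs (W i) \<Longrightarrow> q \<in> Q j \<Longrightarrow> ip H g (e j q) = 0"
  using ip_proj[of i j q g] proj_W[of i g] by simp

lemma proj_other: "i \<in> I \<Longrightarrow> j \<in> I \<Longrightarrow> i \<noteq> j \<Longrightarrow> g \<in> vecs (W i) \<Longrightarrow> proj j g = 0"
  unfolding proj_def by (simp add: ip_W_other)

lemma proj_cong: "(\<And>q. q \<in> Q i \<Longrightarrow> ip H f (e i q) = ip H g (e i q)) \<Longrightarrow> proj i f = proj i g"
  unfolding proj_def by (intro sum.cong) auto

text \<open>Parseval turns vanishing coefficients of \<open>f - g\<close> into vanishing
  norm.\<close>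

lemma coeff_ext:
  assumes "f \<in> vecs H" "g \<in> vecs H" "\<And>i q. i \<in> I \<Longrightarrow> q \<in> Q i \<Longrightarrow> ip H f (e i q) = ip H g (e i q)"
  shows "f = g"
proof -
  have "((\<lambda>i. \<Sum>q\<in>Q i. (cmod (ip H (f - g) (e i q)))\<^sup>2) has_sum Re (ip H (f - g) (f - g))) I"
    using assms by (intro parseval diff_mem)
  moreover have "((\<lambda>i. \<Sum>q\<in>Q i. (cmod (ip H (f - g) (e i q)))\<^sup>2) has_sum 0) I"
    using assms by (intro has_sum_0) (simp add: ip_diff_left e_mem)
  ultimately have "Re (ip H (f - g) (f - g)) = 0" by (rule has_sum_unique)
  then have "f - g = 0" using assms by (intro ip_definite diff_mem)
  then show ?thesis by simp
qed

lemma proj_ext: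
  assumes "f \<in> vecs H" "g \<in> vecs H" "\<And>i. i \<in> I \<Longrightarrow> proj i f = proj i g"
  shows "f = g"
proof (rule coeff_ext[OF assms(1,2)])
  fix i q assume "i \<in> I" "q \<in> Q i"
  then show "ip H f (e i q) = ip H g (e i q)"
    using ip_proj[of i i q f] ip_proj[of i i q g] assms(3)[of i] by simp
qed

lemma vnorm_comb:
  assumes "i \<in> I"
  shows "(vnorm H (\<Sum>q\<in>Q i. fscale (c q) (e i q)))\<^sup>2 = (\<Sum>q\<in>Q i. (cmod (c q))\<^sup>2)"
proof -
  let ?g = "\<Sum>q\<in>Q i. fscale (c q) (e i q)"
  have g: "?g \<in> vecs H" using comb_in_W W_mem assms by blast
  have "ip H ?g ?g = (\<Sum>q\<in>Q i. c q * ip H (e i q) ?g)"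
    using assms g by (subst ip_sum_left) (auto simp: scale_mem e_mem ip_scale_left)
  also have "\<dots> = (\<Sum>q\<in>Q i. of_real ((cmod (c q))\<^sup>2))"
  proof (rule sum.cong[OF refl])
    fix q assume q: "q \<in> Q i"
    have "ip H (e i q) ?g = cnj (c q)"
      using ip_commute[OF g e_mem[OF assms q]] ip_comb[OF assms assms q, of c] by simp
    then show "c q * ip H (e i q) ?g = of_real ((cmod (c q))\<^sup>2)" using complex_norm_square by simp
  qed
  finally show ?thesis by (simp add: vnorm_sq[OF g])
qed

lemma vnorm_proj: "i \<in> I \<Longrightarrow> (vnorm H (proj i f))\<^sup>2 = (\<Sum>q\<in>Q i. (cmod (ip H f (e i q)))\<^sup>2)"
  unfolding proj_def by (rule vnorm_comb)

lemma vnorm_has_sum: "f \<in> vecs H \<Longrightarrow> ((\<lambda>i. (vnorm H (proj i f))\<^sup>2) has_sum (vnorm H f)\<^sup>2) I"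
  by (subst vnorm_sq, simp) (use parseval[of f] in \<open>simp add: vnorm_proj cong: has_sum_cong\<close>)

lemma proj_add_scale:
  assumes "f \<in> vecs H" "g \<in> vecs H" "i \<in> I"
  shows "proj i (f + fscale c g) = proj i f + fscale c (proj i g)"
proof -
  have "proj i (f + fscale c g) = (\<Sum>q\<in>Q i. fscale (ip H f (e i q) + c * ip H g (e i q)) (e i q))"
    unfolding proj_def using assms
    by (intro sum.cong refl arg_cong2[where f=fscale]) (simp add: ip_add_left ip_scale_left e_mem scale_mem)
  also have "\<dots> = (\<Sum>q\<in>Q i. fscale (ip H f (e i q)) (e i q) + fscale c (fscale (ip H g (e i q)) (e i q)))"
    by (simp only: cfun.scale_left_distrib cfun.scale_scale)
  finally show ?thesis by (simp only: sum.distrib cfun.scale_sum_right proj_def)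
qed

text \<open>Parseval for the combinations \<open>f + fscale c g\<close> with c = 1, -1, \<i>, -\<i>,
  put together by polarization in \<open>H\<close> and in every block at once.\<close>

lemma ip_has_sum:
  assumes "f \<in> vecs H" "g \<in> vecs H"
  shows "((\<lambda>i. ip H (proj i f) (proj i g)) has_sum ip H f g) I"
proof -
  have h: "((\<lambda>i. (vnorm H (proj i f + fscale c (proj i g)))\<^sup>2) has_sum (vnorm H (f + fscale c g))\<^sup>2) I" for c
    using vnorm_has_sum[of "f + fscale c g"] assms by (simp add: add_mem scale_mem proj_add_scale cong: has_sum_cong)
  have d: "((\<lambda>i. ((vnorm H (proj i f + fscale c (proj i g)))\<^sup>2 - (vnorm H (proj i f + fscale (- c) (proj i g)))\<^sup>2) / 4)
    has_sum ((vnorm H (f + fscale c g))\<^sup>2 - (vnorm H (f + fscale (- c) g))\<^sup>2) / 4) I" for c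
    using has_sum_cmult_right[OF has_sum_add[OF h[of c] has_sum_uminusI[OF h[of "- c"]]], of "1/4"] by simp
  show ?thesis
    using has_sum_add[OF has_sum_of_real[OF d[of 1]] has_sum_cmult_right[OF has_sum_of_real[OF d[of \<i>]], of \<i>]]
    unfolding polarization[OF assms]
    by (simp only: polarization[OF proj_mem proj_mem] cong: has_sum_cong)
qed

lemma synthesis_W:
  assumes "\<And>i. i \<in> I \<Longrightarrow> g i \<in> vecs (W i)" "(\<lambda>i. (vnorm H (g i))\<^sup>2) summable_on I"
  obtains f where "f \<in> vecs H" "\<And>i. i \<in> I \<Longrightarrow> proj i f = g i"
proof -
  have "(vnorm H (g i))\<^sup>2 = (\<Sum>q\<in>Q i. (cmod (ip H (g i) (e i q)))\<^sup>2)" if "i \<in> I" for i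
    using vnorm_proj[OF that, of "g i"] proj_W[OF that assms(1)[OF that]] by simp
  then have "(\<lambda>i. \<Sum>q\<in>Q i. (cmod (ip H (g i) (e i q)))\<^sup>2) summable_on I"
    using assms(2) by (simp cong: summable_on_cong)
  from synthesis[OF this] obtain f where f: "f \<in> vecs H" "\<forall>i\<in>I. \<forall>q\<in>Q i. ip H f (e i q) = ip H (g i) (e i q)" by blast
  have "proj i f = g i" if "i \<in> I" for i
    using f(2) that proj_cong[of i f "g i"] proj_W[OF that assms(1)[OF that]] by simp
  with f(1) show ?thesis by (rule that)
qed

lemma vnorm_W: "i \<in> I \<Longrightarrow> vnorm (W i) = vnorm H"
  by (simp add: vnorm_def[abs_def] ip_W)

lemma inner_W: "i \<in> I \<Longrightarrow> inner_product_fspace (W i)"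
  using W_subset[of i]
  by unfold_locales (auto simp: ip_W vecs_W cfun.subspace_span intro: ip_add_left ip_scale_left ip_commute ip_nonneg ip_definite)

section \<open>Bounded operators that preserve every block\<close>

definition diag_ops :: "(('x \<Rightarrow> complex) \<Rightarrow> 'x \<Rightarrow> complex) set" where
  "diag_ops = {S \<in> bounded_ops H. \<forall>i\<in>I. S ` vecs (W i) \<subseteq> vecs (W i)}"

lemma diag_ops_bounded: "S \<in> diag_ops \<Longrightarrow> S \<in> bounded_ops H"
  and diag_ops_W: "S \<in> diag_ops \<Longrightarrow> i \<in> I \<Longrightarrow> g \<in> vecs (W i) \<Longrightarrow> S g \<in> vecs (W i)"
  and diag_ops_linear: "S \<in> diag_ops \<Longrightarrow> linear_map H H S"
  by (auto simp: diag_ops_def bounded_ops_def)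

lemma diag_ops_mem: "S \<in> diag_ops \<Longrightarrow> f \<in> vecs H \<Longrightarrow> S f \<in> vecs H"
  using linear_mapD(1)[OF diag_ops_linear] .

lemma vnorm_e: "i \<in> I \<Longrightarrow> q \<in> Q i \<Longrightarrow> vnorm H (e i q) = 1"
  by (simp add: vnorm_def orthonormal)

text \<open>The remainder has the coefficients of \<open>f\<close> outside \<open>F\<close> and none
  inside, so Parseval makes its squared norm the tail of the series. This is the density of finite
  block sums in quantitative form.\<close>

lemma vnorm_remainder:
  assumes f: "f \<in> vecs H" and F: "finite F" "F \<subseteq> I"
  shows "(vnorm H (f - (\<Sum>j\<in>F. proj j f)))\<^sup>2 = (vnorm H f)\<^sup>2 - (\<Sum>j\<in>F. (vnorm H (proj j f))\<^sup>2)"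
proof -
  let ?r = "f - (\<Sum>j\<in>F. proj j f)"
  have pm: "proj j f \<in> vecs H" if "j \<in> F" for j using that F proj_mem by auto
  have r: "?r \<in> vecs H" using f F proj_mem by (intro diff_mem sum_mem) auto
  have "ip H ?r (e k q) = (if k \<in> F then 0 else ip H f (e k q))" if k: "k \<in> I" "q \<in> Q k" for k q
  proof -
    have "(\<Sum>j\<in>F. ip H (proj j f) (e k q)) = (\<Sum>j\<in>F. if j = k then ip H f (e k q) else 0)"
      using k F by (intro sum.cong refl) (auto simp: ip_proj subset_iff)
    then have "ip H ?r (e k q) = ip H f (e k q) - (\<Sum>j\<in>F. if j = k then ip H f (e k q) else 0)"
      using k by (simp add: ip_diff_left f pm sum_mem e_mem ip_sum_left)
    then show ?thesis using F by simp
  qed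
  then have "(vnorm H (proj k ?r))\<^sup>2 = (vnorm H (proj k f))\<^sup>2 + - (if k \<in> F then (vnorm H (proj k f))\<^sup>2 else 0)" if "k \<in> I" for k
    using that by (simp add: vnorm_proj)
  then have "((\<lambda>k. (vnorm H (proj k f))\<^sup>2 + - (if k \<in> F then (vnorm H (proj k f))\<^sup>2 else 0)) has_sum (vnorm H ?r)\<^sup>2) I"
    using vnorm_has_sum[OF r] by (simp cong: has_sum_cong)
  moreover have "((\<lambda>k. if k \<in> F then (vnorm H (proj k f))\<^sup>2 else 0) has_sum (\<Sum>j\<in>F. (vnorm H (proj j f))\<^sup>2)) I"
    using F by (intro has_sum_finite_neutralI[of F]) auto
  then have "((\<lambda>k. (vnorm H (proj k f))\<^sup>2 + - (if k \<in> F then (vnorm H (proj k f))\<^sup>2 else 0)) has_sum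
    ((vnorm H f)\<^sup>2 + - (\<Sum>j\<in>F. (vnorm H (proj j f))\<^sup>2))) I"
    by (intro has_sum_add vnorm_has_sum[OF f] has_sum_uminusI)
  ultimately show ?thesis using has_sum_unique by fastforce
qed

text \<open>Finite block sums are dense, so boundedness extends the block structure to all of \<open>H\<close>.\<close>

lemma proj_commute:
  assumes S: "S \<in> diag_ops" and f: "f \<in> vecs H" and i: "i \<in> I"
  shows "proj i (S f) = S (proj i f)"
proof -
  obtain C where C: "C \<ge> 0" "\<And>f. f \<in> vecs H \<Longrightarrow> vnorm H (S f) \<le> C * vnorm H f"
    using bounded_opsE[OF diag_ops_bounded[OF S]] by blast
  note lin = diag_ops_linear[OF S]
  have "ip H (S f) (e i q) = ip H (S (proj i f)) (e i q)" if q: "q \<in> Q i" for q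
  proof -
    let ?d = "cmod (ip H (S f) (e i q) - ip H (S (proj i f)) (e i q))"
    have "?d\<^sup>2 \<le> 0"
    proof (rule field_le_epsilon)
      fix \<epsilon> :: real assume \<epsilon>: "\<epsilon> > 0"
      \<comment> \<open>Chosen so that C^2 times \<delta> is at most \<epsilon>; the summand 1
        covers the case C = 0.\<close>
      define \<delta> where "\<delta> = \<epsilon> / (C\<^sup>2 + 1)"
      have "\<delta> > 0" using \<epsilon> by (simp add: \<delta>_def add_nonneg_pos)
      from has_sum_finite_approximation[OF vnorm_has_sum[OF f] this]
      obtain F where F: "finite F" "F \<subseteq> I" "dist (\<Sum>j\<in>F. (vnorm H (proj j f))\<^sup>2) ((vnorm H f)\<^sup>2) \<le> \<delta>" by blast
      \<comment> \<open>The block \<open>i\<close> must occur in the finite sum: then the sum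
        contributes exactly the coefficient of \<open>S (proj i f)\<close>, and the difference to be
        estimated comes from the remainder alone.\<close>
      let ?F = "insert i F" and ?r = "f - (\<Sum>j\<in>insert i F. proj j f)"
      have r: "?r \<in> vecs H" using f F i proj_mem by (intro diff_mem sum_mem) auto
      have "(\<Sum>j\<in>F. (vnorm H (proj j f))\<^sup>2) \<le> (\<Sum>j\<in>?F. (vnorm H (proj j f))\<^sup>2)"
        using F by (intro sum_mono2) auto
      then have rn: "(vnorm H ?r)\<^sup>2 \<le> \<delta>"
        using F i by (subst vnorm_remainder[OF f]) (auto simp: dist_real_def)
      have "S (\<Sum>j\<in>?F. fscale 1 (proj j f)) = (\<Sum>j\<in>?F. fscale 1 (S (proj j f)))"
        using F i proj_mem by (intro linear_map_sum[OF lin subspace]) auto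
      then have sumS: "S (\<Sum>j\<in>?F. proj j f) = (\<Sum>j\<in>?F. S (proj j f))" by simp
      have pm: "(\<Sum>j\<in>?F. proj j f) \<in> vecs H" using F i proj_mem by (intro sum_mem) auto
      have "S f = S (?r + (\<Sum>j\<in>?F. proj j f))" by (simp only: diff_add_cancel)
      then have "S f = S ?r + (\<Sum>j\<in>?F. S (proj j f))"
        unfolding linear_mapD(2)[OF lin r pm] sumS .
      moreover have Sp: "S (proj j f) \<in> vecs H" if "j \<in> ?F" for j
        using that F i by (intro diag_ops_mem[OF S] proj_mem) auto
      ultimately have "ip H (S f) (e i q) = ip H (S ?r) (e i q) + (\<Sum>j\<in>?F. ip H (S (proj j f)) (e i q))"
        using diag_ops_mem[OF S r] e_mem[OF i q] by (simp only: ip_add_left sum_mem ip_sum_left)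
      also have "(\<Sum>j\<in>?F. ip H (S (proj j f)) (e i q)) = (\<Sum>j\<in>?F. if j = i then ip H (S (proj i f)) (e i q) else 0)"
      proof (intro sum.cong refl)
        fix j assume "j \<in> ?F"
        then have "j \<in> I" using F i by auto
        then have "S (proj j f) \<in> vecs (W j)" by (intro diag_ops_W[OF S] proj_in_W)
        then show "ip H (S (proj j f)) (e i q) = (if j = i then ip H (S (proj i f)) (e i q) else 0)"
          using ip_W_other[OF \<open>j \<in> I\<close> i _ _ q] by auto
      qed
      also have "\<dots> = ip H (S (proj i f)) (e i q)" using F by simp
      finally have "?d = cmod (ip H (S ?r) (e i q))" by (simp only: add_diff_cancel_right')
      also have "\<dots> \<le> vnorm H (S ?r) * vnorm H (e i q)"
        by (intro cauchy_schwarz diag_ops_mem[OF S r] e_mem[OF i q])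
      also have "\<dots> \<le> C * vnorm H ?r" using C(2)[OF r] by (simp add: vnorm_e[OF i q])
      finally have "?d\<^sup>2 \<le> (C * vnorm H ?r)\<^sup>2" by (intro power_mono) auto
      also have "\<dots> \<le> C\<^sup>2 * \<delta>" using rn by (simp add: power_mult_distrib mult_left_mono)
      also have "\<dots> \<le> \<epsilon>"
      proof -
        have "C\<^sup>2 + 1 > 0" by (simp add: add_nonneg_pos)
        then show ?thesis using \<epsilon> unfolding \<delta>_def by (simp add: pos_divide_le_eq algebra_simps)
      qed
      finally show "?d\<^sup>2 \<le> 0 + \<epsilon>" by simp
    qed
    then show ?thesis by simp
  qed
  then have "proj i (S f) = proj i (S (proj i f))" by (rule proj_cong)
  also have "\<dots> = S (proj i f)" by (intro proj_W i diag_ops_W[OF S] proj_in_W)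
  finally show ?thesis .
qed

text \<open>By \<open>proj_commute\<close> the values on the blocks determine every projection of
  \<open>S f\<close>; off \<open>vecs H\<close> both operators are \<open>undefined\<close>.\<close>

lemma diag_ops_ext:
  assumes "S \<in> diag_ops" "T \<in> diag_ops" "\<And>i g. i \<in> I \<Longrightarrow> g \<in> vecs (W i) \<Longrightarrow> S g = T g"
  shows "S = T"
proof
  fix f
  show "S f = T f"
  proof (cases "f \<in> vecs H")
    case True
    show ?thesis
    proof (rule proj_ext)
      fix i assume i: "i \<in> I"
      show "proj i (S f) = proj i (T f)"
        unfolding proj_commute[OF assms(1) True i] proj_commute[OF assms(2) True i]
        by (rule assms(3)[OF i proj_in_W[OF i]])
    qed (use diag_ops_mem assms(1,2) True in blast)+
  next
    case False
    then show ?thesis using assms linear_mapD(4)[OF diag_ops_linear] by metis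
  qed
qed

text \<open>The uniform bound \<open>M\<close> makes the prescribed projections
  \<open>T i (proj i f)\<close> square summable, so \<open>synthesis_W\<close> supplies a vector
  having them. As projections determine a vector, linearity can be checked block by block; the bound
  is a comparison of the two Parseval series.\<close>

lemma diag_ops_of_blocks:
  assumes T: "\<And>i. i \<in> I \<Longrightarrow> T i \<in> bounded_ops (W i)" and "M \<ge> 0"
    and M: "\<And>i g. i \<in> I \<Longrightarrow> g \<in> vecs (W i) \<Longrightarrow> vnorm H (T i g) \<le> M * vnorm H g"
  obtains S where "S \<in> diag_ops" "\<And>i g. i \<in> I \<Longrightarrow> g \<in> vecs (W i) \<Longrightarrow> S g = T i g"
    "\<And>f. f \<in> vecs H \<Longrightarrow> vnorm H (S f) \<le> M * vnorm H f"
proof -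
  have lin: "linear_map (W i) (W i) (T i)" if "i \<in> I" for i using T[OF that] by (simp add: bounded_ops_def)
  have bound: "(vnorm H (T i (proj i f)))\<^sup>2 \<le> M\<^sup>2 * (vnorm H (proj i f))\<^sup>2" if "i \<in> I" for i f
    using power_mono[OF M[OF that proj_in_W[OF that, of f]], of 2]
      vnorm_nonneg[OF W_mem[OF that linear_mapD(1)[OF lin[OF that] proj_in_W[OF that, of f]]]]
    by (simp add: power_mult_distrib)
  have ex: "\<exists>h\<in>vecs H. \<forall>i\<in>I. proj i h = T i (proj i f)" if "f \<in> vecs H" for f
  proof -
    have "(\<lambda>i. M\<^sup>2 * (vnorm H (proj i f))\<^sup>2) summable_on I"
      using vnorm_has_sum[OF that] by (intro summable_on_cmult_right) (auto simp: summable_on_def)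
    then have "(\<lambda>i. (vnorm H (T i (proj i f)))\<^sup>2) summable_on I"
      by (rule summable_on_comparison_test) (auto intro: bound)
    from synthesis_W[OF _ this] show ?thesis using linear_mapD(1)[OF lin proj_in_W] by metis
  qed
  define S where "S = (\<lambda>f\<in>vecs H. SOME h. h \<in> vecs H \<and> (\<forall>i\<in>I. proj i h = T i (proj i f)))"
  have S: "S f \<in> vecs H" "\<And>i. i \<in> I \<Longrightarrow> proj i (S f) = T i (proj i f)" if "f \<in> vecs H" for f
    using someI_ex[of "\<lambda>h. h \<in> vecs H \<and> (\<forall>i\<in>I. proj i h = T i (proj i f))"] ex[OF that] that
    by (auto simp: S_def)
  have proj_lin: "proj i (fscale c g) = fscale c (proj i g)" "proj i (f + g) = proj i f + proj i g"
    if "f \<in> vecs H" "g \<in> vecs H" "i \<in> I" for i c f g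
    using proj_add_scale[of 0 g i c] proj_add_scale[of f g i 1] that by (simp_all add: proj_def e_mem cong: sum.cong)
  have linS: "linear_map H H S"
  proof (rule linear_mapI)
    fix f g assume fg: "f \<in> vecs H" "g \<in> vecs H"
    show "S (f + g) = S f + S g"
    proof (rule proj_ext)
      fix i assume i: "i \<in> I"
      have "proj i (S (f + g)) = T i (proj i f + proj i g)"
        unfolding S(2)[OF add_mem[OF fg] i] proj_lin(2)[OF fg i] ..
      also have "\<dots> = T i (proj i f) + T i (proj i g)"
        by (rule linear_mapD(2)[OF lin[OF i] proj_in_W[OF i] proj_in_W[OF i]])
      also have "\<dots> = proj i (S f + S g)"
        unfolding proj_lin(2)[OF S(1)[OF fg(1)] S(1)[OF fg(2)] i] S(2)[OF fg(1) i] S(2)[OF fg(2) i] ..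
      finally show "proj i (S (f + g)) = proj i (S f + S g)" .
    qed (intro S(1) add_mem fg)+
  next
    fix c f assume f: "f \<in> vecs H"
    show "S (fscale c f) = fscale c (S f)"
    proof (rule proj_ext)
      fix i assume i: "i \<in> I"
      have "proj i (S (fscale c f)) = T i (fscale c (proj i f))"
        unfolding S(2)[OF scale_mem[OF f] i] proj_lin(1)[OF f f i] ..
      also have "\<dots> = fscale c (T i (proj i f))"
        by (rule linear_mapD(3)[OF lin[OF i] proj_in_W[OF i]])
      also have "\<dots> = proj i (fscale c (S f))"
        unfolding proj_lin(1)[OF f S(1)[OF f] i] S(2)[OF f i] ..
      finally show "proj i (S (fscale c f)) = proj i (fscale c (S f))" .
    qed (intro S(1) scale_mem f)+
  qed (use S in \<open>auto simp: S_def\<close>)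
  have SW: "S g = T i g" if "i \<in> I" "g \<in> vecs (W i)" for i g
  proof (rule proj_ext)
    have Tg: "T i g \<in> vecs (W i)" using that linear_mapD(1)[OF lin] by blast
    show "S g \<in> vecs H" "T i g \<in> vecs H" using S W_mem that Tg by auto
    fix j assume j: "j \<in> I"
    show "proj j (S g) = proj j (T i g)"
    proof (cases "j = i")
      case True
      then show ?thesis using that Tg W_mem S(2)[of g i] proj_W by simp
    next
      case False
      have "0 \<in> vecs (W j)" using inner_product_fspace.zero_mem[OF inner_W[OF j]] .
      then have "T j 0 = 0" by (rule linear_map_zero[OF lin[OF j]])
      then show ?thesis using False that j Tg W_mem S(2)[of g j] proj_other[of i j] by simp
    qed
  qed
  have bS: "vnorm H (S f) \<le> M * vnorm H f" if f: "f \<in> vecs H" for f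
  proof (rule power2_le_imp_le)
    have "((\<lambda>i. (vnorm H (T i (proj i f)))\<^sup>2) has_sum (vnorm H (S f))\<^sup>2) I"
      using vnorm_has_sum[OF S(1)[OF f]] S(2)[OF f] by (simp cong: has_sum_cong)
    moreover have "((\<lambda>i. M\<^sup>2 * (vnorm H (proj i f))\<^sup>2) has_sum (M\<^sup>2 * (vnorm H f)\<^sup>2)) I"
      by (intro has_sum_cmult_right vnorm_has_sum f)
    ultimately have "(vnorm H (S f))\<^sup>2 \<le> M\<^sup>2 * (vnorm H f)\<^sup>2"
      by (rule has_sum_mono) (rule bound)
    then show "(vnorm H (S f))\<^sup>2 \<le> (M * vnorm H f)\<^sup>2" by (simp add: power_mult_distrib)
  qed (use \<open>M \<ge> 0\<close> f in simp)
  have "S \<in> diag_ops"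
    using linS bS SW linear_mapD(1)[OF lin] by (auto simp: diag_ops_def bounded_ops_def)
  then show ?thesis using SW bS by (rule that)
qed

end

section \<open>The coefficient map onto the sequence space\<close>

context orthonormal_blocks
begin

abbreviation seqs :: "('i \<times> nat) fspace" where
  "seqs \<equiv> hilbert_sum I (\<lambda>i. coord_space (Q i))"

text \<open>For the disk polynomials this is \<open>U_op\<close>; the explicit zeros outside the
  index range place its values in \<open>seqs\<close>.\<close>

definition coeff_map :: "('x \<Rightarrow> complex) \<Rightarrow> 'i \<times> nat \<Rightarrow> complex" where
  "coeff_map = (\<lambda>f\<in>vecs H. \<lambda>(i, q). if i \<in> I \<and> q \<in> Q i then ip H f (e i q) else 0)"

lemma coeff_map_apply: "f \<in> vecs H \<Longrightarrow> coeff_map f (i, q) = (if i \<in> I \<and> q \<in> Q i then ip H f (e i q) else 0)"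
  by (simp add: coeff_map_def)

lemma vnorm_coord_space: "(vnorm (coord_space R) v)\<^sup>2 = (\<Sum>q\<in>R. (cmod (v q))\<^sup>2)"
proof -
  have "ip (coord_space R) v v = of_real (\<Sum>q\<in>R. (cmod (v q))\<^sup>2)"
    unfolding coord_space_def fspace.simps of_real_sum complex_norm_square ..
  then show ?thesis by (simp add: vnorm_def sum_nonneg)
qed

lemma vecs_seqs:
  "x \<in> vecs seqs \<longleftrightarrow> (\<forall>i q. i \<notin> I \<or> q \<notin> Q i \<longrightarrow> x (i, q) = 0) \<and>
     (\<lambda>i. \<Sum>q\<in>Q i. (cmod (x (i, q)))\<^sup>2) summable_on I"
  unfolding hilbert_sum_def fspace.simps mem_Collect_eq vnorm_coord_space
  by (auto simp: coord_space_def)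

lemma ip_seqs: "ip seqs x y = (\<Sum>\<^sub>\<infinity>i\<in>I. \<Sum>q\<in>Q i. x (i, q) * cnj (y (i, q)))"
  by (simp add: hilbert_sum_def coord_space_def)

lemma ip_proj_proj:
  assumes "i \<in> I" "f \<in> vecs H" "g \<in> vecs H"
  shows "ip H (proj i f) (proj i g) = (\<Sum>q\<in>Q i. ip H f (e i q) * cnj (ip H g (e i q)))"
proof -
  have "ip H (proj i f) (proj i g) = (\<Sum>q\<in>Q i. cnj (ip H g (e i q)) * ip H (proj i f) (e i q))"
    using assms unfolding proj_def[of i g]
    by (subst ip_sum_right) (auto simp: scale_mem e_mem ip_scale_right proj_mem)
  also have "\<dots> = (\<Sum>q\<in>Q i. ip H f (e i q) * cnj (ip H g (e i q)))"
    using assms by (intro sum.cong refl) (simp add: ip_proj)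
  finally show ?thesis .
qed

lemma coeff_map_in_seqs:
  assumes "f \<in> vecs H"
  shows "coeff_map f \<in> vecs seqs"
proof -
  have "(\<lambda>i. \<Sum>q\<in>Q i. (cmod (coeff_map f (i, q)))\<^sup>2) summable_on I"
    using parseval[OF assms] by (simp add: coeff_map_apply[OF assms] summable_on_def cong: has_sum_cong) blast
  then show ?thesis unfolding vecs_seqs by (simp add: coeff_map_apply[OF assms])
qed

lemma coeff_map_surj:
  assumes "x \<in> vecs seqs"
  obtains f where "f \<in> vecs H" "coeff_map f = x"
proof -
  from assms have "(\<lambda>i. \<Sum>q\<in>Q i. (cmod (x (i, q)))\<^sup>2) summable_on I" by (simp add: vecs_seqs)
  from synthesis[OF this] obtain f where f: "f \<in> vecs H" "\<forall>i\<in>I. \<forall>q\<in>Q i. ip H f (e i q) = x (i, q)" by blast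
  have "coeff_map f p = x p" for p
    using f assms unfolding vecs_seqs by (cases p) (auto simp: coeff_map_apply)
  then have "coeff_map f = x" by (rule ext)
  with f(1) show ?thesis by (rule that)
qed

lemma coeff_map_inj:
  assumes "f \<in> vecs H" "g \<in> vecs H" "coeff_map f = coeff_map g"
  shows "f = g"
proof (rule coeff_ext[OF assms(1,2)])
  fix i q assume "i \<in> I" "q \<in> Q i"
  then show "ip H f (e i q) = ip H g (e i q)"
    using coeff_map_apply[OF assms(1), of i q] coeff_map_apply[OF assms(2), of i q] assms(3) by simp
qed

lemma ip_coeff_map:
  assumes "f \<in> vecs H" "g \<in> vecs H"
  shows "ip seqs (coeff_map f) (coeff_map g) = ip H f g"
  unfolding ip_seqs
  using ip_has_sum[OF assms]
  by (intro infsumI) (simp add: ip_proj_proj assms coeff_map_apply cong: has_sum_cong)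

lemma unitary_coeff_map: "unitary_map H seqs coeff_map"
  unfolding unitary_map_def
proof (intro conjI ballI ip_coeff_map)
  show "linear_map H seqs coeff_map"
  proof (rule linear_mapI)
    fix f g assume fg: "f \<in> vecs H" "g \<in> vecs H"
    show "coeff_map (f + g) = coeff_map f + coeff_map g"
      by (rule ext) (use fg in \<open>auto simp: coeff_map_apply add_mem ip_add_left e_mem\<close>)
  next
    fix c f assume f: "f \<in> vecs H"
    have "fscale c x p = c * x p" for x and p :: "'i \<times> nat" by (simp add: fscale_def)
    then show "coeff_map (fscale c f) = fscale c (coeff_map f)"
      by (intro ext) (use f in \<open>auto simp: coeff_map_apply scale_mem ip_scale_left e_mem\<close>)
  qed (auto simp: coeff_map_in_seqs, simp add: coeff_map_def)
  show "bij_betw coeff_map (vecs H) (vecs seqs)"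
    unfolding bij_betw_def inj_on_def
    using coeff_map_inj coeff_map_in_seqs coeff_map_surj by (auto simp: image_iff) metis
qed

text \<open>The isometry makes the adjoint a left inverse. In this form the conjugation by the
  unitary operator is evaluated later.\<close>

lemma adj_coeff_map:
  assumes "f \<in> vecs H"
  shows "adj H seqs coeff_map (coeff_map f) = f"
  by (rule adj_apply[OF coeff_map_in_seqs]) (simp_all add: assms ip_coeff_map)

section \<open>Restriction to the blocks as an isomorphism of algebras\<close>

abbreviation restr :: "'i \<Rightarrow> (('x \<Rightarrow> complex) \<Rightarrow> 'x \<Rightarrow> complex) \<Rightarrow> ('x \<Rightarrow> complex) \<Rightarrow> 'x \<Rightarrow> complex" where
  "restr i S \<equiv> restrict S (vecs (W i))"

lemma W_scale_add:
  assumes "i \<in> I"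
  shows "f \<in> vecs (W i) \<Longrightarrow> g \<in> vecs (W i) \<Longrightarrow> f + g \<in> vecs (W i)"
    and "f \<in> vecs (W i) \<Longrightarrow> fscale c f \<in> vecs (W i)"
  using inner_product_fspace.add_mem[OF inner_W[OF assms]] inner_product_fspace.scale_mem[OF inner_W[OF assms]] by auto

lemma restr_bounded:
  assumes S: "S \<in> diag_ops" and i: "i \<in> I"
  shows "restr i S \<in> bounded_ops (W i)"
proof -
  note lin = linear_mapD[OF diag_ops_linear[OF S]]
  have "linear_map (W i) (W i) (restr i S)"
    by (rule linear_mapI) (simp_all add: diag_ops_W[OF S i] W_scale_add[OF i] lin W_mem[OF i])
  moreover obtain C where C: "\<And>f. f \<in> vecs H \<Longrightarrow> vnorm H (S f) \<le> C * vnorm H f"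
    using bounded_opsE[OF diag_ops_bounded[OF S]] by blast
  then have "\<exists>C. \<forall>f\<in>vecs (W i). vnorm (W i) (restr i S f) \<le> C * vnorm (W i) f"
    using W_mem[OF i] by (auto simp: vnorm_W[OF i])
  ultimately show ?thesis by (simp add: bounded_ops_def)
qed

lemma op_norm_restr_le:
  assumes S: "S \<in> diag_ops" and i: "i \<in> I"
  shows "op_norm (W i) (restr i S) \<le> op_norm H S"
proof (rule inner_product_fspace.op_norm_least[OF inner_W[OF i]])
  show "restr i S \<in> vecs (W i) \<rightarrow> vecs (W i)" using diag_ops_W[OF S i] by auto
  show "0 \<le> op_norm H S" by (rule op_norm_nonneg[OF diag_ops_bounded[OF S]])
  fix f assume "f \<in> vecs (W i)"
  then show "vnorm (W i) (restr i S f) \<le> op_norm H S * vnorm (W i) f"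
    using op_norm_upper[OF diag_ops_bounded[OF S] W_mem[OF i]] by (simp add: vnorm_W[OF i])
qed

lemma diag_ops_of_family:
  assumes T: "\<And>i. i \<in> I \<Longrightarrow> T i \<in> bounded_ops (W i)" and bdd: "bdd_above ((\<lambda>i. op_norm (W i) (T i)) ` I)"
  obtains S where "S \<in> diag_ops" "\<And>i g. i \<in> I \<Longrightarrow> g \<in> vecs (W i) \<Longrightarrow> S g = T i g"
    "\<And>f. f \<in> vecs H \<Longrightarrow> vnorm H (S f) \<le> (SUP i\<in>I. op_norm (W i) (T i)) * vnorm H f"
    "(SUP i\<in>I. op_norm (W i) (T i)) \<ge> 0"
proof -
  let ?M = "SUP i\<in>I. op_norm (W i) (T i)"
  have upper: "op_norm (W i) (T i) \<le> ?M" if "i \<in> I" for i using bdd that by (rule cSUP_upper2) simp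
  \<comment> \<open>A supremum over an empty set of reals would carry no information; an actual
    index shows that it is nonnegative.\<close>
  obtain i0 where i0: "i0 \<in> I" using I_nonempty by blast
  have nonneg: "op_norm (W i) (T i) \<ge> 0" if "i \<in> I" for i
    by (rule inner_product_fspace.op_norm_nonneg[OF inner_W[OF that] T[OF that]])
  have M: "?M \<ge> 0" using nonneg[OF i0] upper[OF i0] by linarith
  have "vnorm H (T i g) \<le> ?M * vnorm H g" if "i \<in> I" "g \<in> vecs (W i)" for i g
  proof -
    have "vnorm H (T i g) \<le> op_norm (W i) (T i) * vnorm H g"
      using inner_product_fspace.op_norm_upper[OF inner_W[OF that(1)] T[OF that(1)] that(2)] by (simp add: vnorm_W[OF that(1)])
    also have "\<dots> \<le> ?M * vnorm H g" using that by (intro mult_right_mono upper vnorm_nonneg W_mem)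
    finally show ?thesis .
  qed
  then obtain S where "S \<in> diag_ops" "\<And>i g. i \<in> I \<Longrightarrow> g \<in> vecs (W i) \<Longrightarrow> S g = T i g"
    "\<And>f. f \<in> vecs H \<Longrightarrow> vnorm H (S f) \<le> ?M * vnorm H f"
    using diag_ops_of_blocks[OF T M] by blast
  then show ?thesis using M by (rule that)
qed

text \<open>The restrictions clearly have norm at most that of \<open>S\<close>. For the converse,
  the operator reassembled from the restrictions obeys the bound given by their supremum, and by
  \<open>diag_ops_ext\<close> it is \<open>S\<close>.\<close>

lemma op_norm_diag:
  assumes S: "S \<in> diag_ops"
  shows "bdd_above ((\<lambda>i. op_norm (W i) (restr i S)) ` I)"
    and "(SUP i\<in>I. op_norm (W i) (restr i S)) = op_norm H S"
proof -
  show bdd: "bdd_above ((\<lambda>i. op_norm (W i) (restr i S)) ` I)"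
    by (rule bdd_aboveI2) (rule op_norm_restr_le[OF S])
  let ?M = "SUP i\<in>I. op_norm (W i) (restr i S)"
  obtain S' where S': "S' \<in> diag_ops" "\<And>i g. i \<in> I \<Longrightarrow> g \<in> vecs (W i) \<Longrightarrow> S' g = restr i S g"
    "\<And>f. f \<in> vecs H \<Longrightarrow> vnorm H (S' f) \<le> ?M * vnorm H f" "?M \<ge> 0"
    using diag_ops_of_family[OF restr_bounded[OF S] bdd] by blast
  have "S' = S" by (rule diag_ops_ext[OF S'(1) S]) (simp add: S'(2))
  then have "op_norm H S \<le> ?M"
    using S' diag_ops_mem[OF S] by (intro op_norm_least) auto
  moreover have "?M \<le> op_norm H S"
    by (rule cSUP_least[OF I_nonempty]) (rule op_norm_restr_le[OF S])
  ultimately show "?M = op_norm H S" by simp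
qed

text \<open>The shape shared by the blocks of an adjoint and by those of a matrix: coordinate
  functionals \<open>L q\<close> followed by the basis vectors.\<close>

lemma linear_map_comb:
  assumes i: "i \<in> I"
    and add: "\<And>q f g. q \<in> Q i \<Longrightarrow> f \<in> vecs (W i) \<Longrightarrow> g \<in> vecs (W i) \<Longrightarrow> L q (f + g) = L q f + L q g"
    and scale: "\<And>q c f. q \<in> Q i \<Longrightarrow> f \<in> vecs (W i) \<Longrightarrow> L q (fscale c f) = c * L q f"
  shows "linear_map (W i) (W i) (\<lambda>g\<in>vecs (W i). \<Sum>q\<in>Q i. fscale (L q g) (e i q))"
proof (rule linear_mapI)
  fix f g assume "f \<in> vecs (W i)" "g \<in> vecs (W i)"
  then show "(\<lambda>g\<in>vecs (W i). \<Sum>q\<in>Q i. fscale (L q g) (e i q)) (f + g) =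
    (\<lambda>g\<in>vecs (W i). \<Sum>q\<in>Q i. fscale (L q g) (e i q)) f + (\<lambda>g\<in>vecs (W i). \<Sum>q\<in>Q i. fscale (L q g) (e i q)) g"
    by (simp only: restrict_apply' W_scale_add[OF i] add cfun.scale_left_distrib sum.distrib cong: sum.cong)
next
  fix c f assume "f \<in> vecs (W i)"
  then show "(\<lambda>g\<in>vecs (W i). \<Sum>q\<in>Q i. fscale (L q g) (e i q)) (fscale c f) =
    fscale c ((\<lambda>g\<in>vecs (W i). \<Sum>q\<in>Q i. fscale (L q g) (e i q)) f)"
    by (simp only: restrict_apply' W_scale_add[OF i] scale cfun.scale_sum_right cfun.scale_scale cong: sum.cong)
qed (simp_all add: comb_in_W[OF i])

text \<open>In a block the adjoint is explicit: the coefficients of \<open>T i g\<close> are the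
  numbers \<open>ip H g (S (e i q))\<close>. It inherits the bound \<open>C\<close> of
  \<open>S\<close>, because the squared norm of \<open>T i g\<close> is the inner product of
  \<open>S (T i g)\<close> with \<open>g\<close>. The assembled operator satisfies the adjoint
  identity on all of \<open>H\<close> by \<open>ip_has_sum\<close>.\<close>

lemma diag_ops_adjoint:
  assumes S: "S \<in> diag_ops"
  obtains S' where "S' \<in> diag_ops" "\<And>f g. f \<in> vecs H \<Longrightarrow> g \<in> vecs H \<Longrightarrow> ip H (S f) g = ip H f (S' g)"
proof -
  note lin = diag_ops_linear[OF S]
  obtain C where C: "C \<ge> 0" "\<And>f. f \<in> vecs H \<Longrightarrow> vnorm H (S f) \<le> C * vnorm H f"
    using bounded_opsE[OF diag_ops_bounded[OF S]] by blast
  define T where "T i = (\<lambda>g\<in>vecs (W i). \<Sum>q\<in>Q i. fscale (ip H g (S (e i q))) (e i q))" for i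
  have TW: "T i g \<in> vecs (W i)" if "i \<in> I" "g \<in> vecs (W i)" for i g
    using that by (simp add: T_def comb_in_W)
  have Se: "S (e i q) \<in> vecs H" if "i \<in> I" "q \<in> Q i" for i q
    using that by (intro diag_ops_mem[OF S] e_mem)
  have adjT: "ip H (S f) g = ip H f (T i g)" if i: "i \<in> I" and f: "f \<in> vecs (W i)" and g: "g \<in> vecs (W i)" for i f g
  proof -
    let ?c = "\<lambda>q. ip H f (e i q)"
    have gH: "g \<in> vecs H" and TH: "T i g \<in> vecs H" using g TW[OF i g] W_mem[OF i] by auto
    have fe: "f = (\<Sum>q\<in>Q i. fscale (?c q) (e i q))" using proj_W[OF i f] unfolding proj_def by (rule sym)
    have "S f = (\<Sum>q\<in>Q i. fscale (?c q) (S (e i q)))"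
      by (subst fe) (rule linear_map_sum[OF lin subspace e_mem[OF i]])
    then have "ip H (S f) g = (\<Sum>q\<in>Q i. ?c q * ip H (S (e i q)) g)"
      using gH by (simp only:) (subst ip_sum_left, auto simp: scale_mem Se[OF i] ip_scale_left)
    also have "\<dots> = (\<Sum>q\<in>Q i. ?c q * ip H (e i q) (T i g))"
    proof (intro sum.cong refl arg_cong2[where f=times])
      fix q assume q: "q \<in> Q i"
      have "ip H (T i g) (e i q) = ip H g (S (e i q))" using g ip_comb[OF i i q] by (simp add: T_def)
      then show "ip H (S (e i q)) g = ip H (e i q) (T i g)"
        using ip_commute[OF gH Se[OF i q]] ip_commute[OF TH e_mem[OF i q]] by simp
    qed
    also have "\<dots> = ip H f (T i g)"
      using TH by (subst (2) fe, subst ip_sum_left) (auto simp: scale_mem e_mem[OF i] ip_scale_left)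
    finally show ?thesis .
  qed
  have bound: "vnorm H (T i g) \<le> C * vnorm H g" if i: "i \<in> I" and g: "g \<in> vecs (W i)" for i g
  proof (cases "vnorm H (T i g) = 0")
    case True
    then show ?thesis using C(1) W_mem[OF i g] by simp
  next
    case False
    have gH: "g \<in> vecs H" and TH: "T i g \<in> vecs H" using g TW[OF i g] W_mem[OF i] by auto
    have "(vnorm H (T i g))\<^sup>2 = Re (ip H (S (T i g)) g)"
      unfolding adjT[OF i TW[OF i g] g] by (rule vnorm_sq[OF TH])
    also have "\<dots> \<le> vnorm H (S (T i g)) * vnorm H g"
      using cauchy_schwarz[OF diag_ops_mem[OF S TH] gH] complex_Re_le_cmod order_trans by blast
    also have "\<dots> \<le> (C * vnorm H (T i g)) * vnorm H g"
      by (intro mult_right_mono C(2) TH vnorm_nonneg gH)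
    finally have "vnorm H (T i g) * vnorm H (T i g) \<le> vnorm H (T i g) * (C * vnorm H g)"
      by (simp add: power2_eq_square mult_ac)
    moreover have "vnorm H (T i g) > 0" using False vnorm_nonneg[OF TH] by linarith
    ultimately show ?thesis by simp
  qed
  have Tb: "T i \<in> bounded_ops (W i)" if i: "i \<in> I" for i
  proof -
    have "linear_map (W i) (W i) (T i)"
      unfolding T_def using W_mem[OF i] Se[OF i]
      by (intro linear_map_comb[OF i]) (simp_all only: ip_add_left ip_scale_left)
    then show ?thesis using bound[OF i] by (auto simp: bounded_ops_def vnorm_W[OF i])
  qed
  obtain S' where S': "S' \<in> diag_ops" "\<And>i g. i \<in> I \<Longrightarrow> g \<in> vecs (W i) \<Longrightarrow> S' g = T i g"
    "\<And>f. f \<in> vecs H \<Longrightarrow> vnorm H (S' f) \<le> C * vnorm H f"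
    using diag_ops_of_blocks[OF Tb C(1) bound] by blast
  have "ip H (S f) g = ip H f (S' g)" if f: "f \<in> vecs H" and g: "g \<in> vecs H" for f g
  proof (rule has_sum_unique)
    show "((\<lambda>i. ip H (proj i (S f)) (proj i g)) has_sum ip H (S f) g) I"
      by (intro ip_has_sum diag_ops_mem[OF S] f g)
    have "ip H (proj i (S f)) (proj i g) = ip H (proj i f) (proj i (S' g))" if i: "i \<in> I" for i
      unfolding proj_commute[OF S f i] proj_commute[OF S'(1) g i] S'(2)[OF i proj_in_W[OF i]]
      by (intro adjT proj_in_W i)
    then show "((\<lambda>i. ip H (proj i (S f)) (proj i g)) has_sum ip H f (S' g)) I"
      using ip_has_sum[OF f diag_ops_mem[OF S'(1) g]] by (simp cong: has_sum_cong)
  qed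
  with S'(1) show ?thesis by (rule that)
qed

text \<open>One operator \<open>S'\<close> satisfies the adjoint identity on \<open>H\<close> and on
  each block, so both uses of \<open>adj\<close> select it.\<close>

lemma adj_diag_ops:
  assumes S: "S \<in> diag_ops"
  shows "adj H H S \<in> diag_ops"
    and "i \<in> I \<Longrightarrow> restr i (adj H H S) = adj (W i) (W i) (restr i S)"
proof -
  obtain S' where S': "S' \<in> diag_ops" "\<And>f g. f \<in> vecs H \<Longrightarrow> g \<in> vecs H \<Longrightarrow> ip H (S f) g = ip H f (S' g)"
    using diag_ops_adjoint[OF S] by blast
  have eq: "adj H H S = S'"
  proof
    fix g
    show "adj H H S g = S' g"
    proof (cases "g \<in> vecs H")
      case True
      then show ?thesis by (intro adj_apply diag_ops_mem[OF S'(1)] S'(2))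
    next
      case False
      then show ?thesis using linear_mapD(4)[OF diag_ops_linear[OF S'(1)] False] by (simp add: adj_def)
    qed
  qed
  then show "adj H H S \<in> diag_ops" using S' by simp
  assume i: "i \<in> I"
  show "restr i (adj H H S) = adj (W i) (W i) (restr i S)"
  proof
    fix g
    show "restr i (adj H H S) g = adj (W i) (W i) (restr i S) g"
    proof (cases "g \<in> vecs (W i)")
      case True
      have "adj (W i) (W i) (restr i S) g = S' g"
      proof (rule inner_product_fspace.adj_apply[OF inner_W[OF i] True diag_ops_W[OF S'(1) i True]])
        fix f assume "f \<in> vecs (W i)"
        then show "ip (W i) (restr i S f) g = ip (W i) f (S' g)"
          using S'(2) W_mem[OF i] True by (simp add: ip_W[OF i])
      qed
      then show ?thesis using True eq by simp
    qed (simp add: adj_def)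
  qed
qed

lemma diag_ops_closed:
  assumes "S \<in> diag_ops" "T \<in> diag_ops"
  shows "(\<lambda>f\<in>vecs H. S f + T f) \<in> diag_ops" "(\<lambda>f\<in>vecs H. fscale c (S f)) \<in> diag_ops" "compose (vecs H) S T \<in> diag_ops"
proof -
  have W: "S g \<in> vecs (W i)" "T g \<in> vecs (W i)" "g \<in> vecs H" if "i \<in> I" "g \<in> vecs (W i)" for i g
    using that assms diag_ops_W W_mem by blast+
  show "(\<lambda>f\<in>vecs H. S f + T f) \<in> diag_ops"
    unfolding diag_ops_def mem_Collect_eq
    by (intro conjI bounded_ops_add assms[THEN diag_ops_bounded] ballI image_subsetI)
      (simp only: W restrict_apply' W_scale_add(1))
  show "(\<lambda>f\<in>vecs H. fscale c (S f)) \<in> diag_ops"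
    unfolding diag_ops_def mem_Collect_eq
    by (intro conjI bounded_ops_scale assms(1)[THEN diag_ops_bounded] ballI image_subsetI)
      (simp only: W restrict_apply' W_scale_add(2))
  show "compose (vecs H) S T \<in> diag_ops"
    unfolding diag_ops_def mem_Collect_eq
    by (intro conjI bounded_ops_compose assms[THEN diag_ops_bounded] ballI image_subsetI)
      (simp only: W compose_eq)
qed

text \<open>The isomorphism sends an operator to the family of its restrictions.\<close>

lemma wstar_isomorphic_diag_ops:
  "wstar_isomorphic ((op_alg H) \<lparr> elems := diag_ops \<rparr>) (alg_sum I (\<lambda>i. op_alg (W i)))"
proof -
  let ?A = "(op_alg H) \<lparr> elems := diag_ops \<rparr>" and ?B = "alg_sum I (\<lambda>i. op_alg (W i))"
  define \<phi> where "\<phi> S = (\<lambda>i\<in>I. restr i S)" for S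
  have \<phi>_in: "\<phi> S \<in> elems ?B" if "S \<in> diag_ops" for S
    using restr_bounded[OF that] op_norm_diag(1)[OF that]
    by (auto simp: \<phi>_def alg_sum_def op_alg_def cong: image_cong_simp)
  have \<phi>_surj: "\<exists>S\<in>diag_ops. \<phi> S = T" if "T \<in> elems ?B" for T
  proof -
    have T: "T \<in> (\<Pi>\<^sub>E i\<in>I. bounded_ops (W i))" and bdd: "bdd_above ((\<lambda>i. op_norm (W i) (T i)) ` I)"
      using that by (auto simp: alg_sum_def op_alg_def)
    have Ti: "T i \<in> bounded_ops (W i)" if "i \<in> I" for i by (rule PiE_mem[OF T that])
    obtain S where S: "S \<in> diag_ops" "\<And>i g. i \<in> I \<Longrightarrow> g \<in> vecs (W i) \<Longrightarrow> S g = T i g"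
      "\<And>f. f \<in> vecs H \<Longrightarrow> vnorm H (S f) \<le> (SUP i\<in>I. op_norm (W i) (T i)) * vnorm H f"
      "(SUP i\<in>I. op_norm (W i) (T i)) \<ge> 0"
      using diag_ops_of_family[OF Ti bdd] by blast
    have "restr i S = T i" if i: "i \<in> I" for i
    proof
      fix g
      have "linear_map (W i) (W i) (T i)" using Ti[OF i] by (simp add: bounded_ops_def)
      then show "restr i S g = T i g"
        using S(2)[OF i] linear_mapD(4) by (cases "g \<in> vecs (W i)") fastforce+
    qed
    then have "\<phi> S = T" using T by (auto simp: \<phi>_def PiE_def extensional_def)
    with S(1) show ?thesis by blast
  qed
  have \<phi>_inj: "S = T" if "S \<in> diag_ops" "T \<in> diag_ops" "\<phi> S = \<phi> T" for S T
  proof (rule diag_ops_ext[OF that(1,2)])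
    fix i g assume "i \<in> I" "g \<in> vecs (W i)"
    then show "S g = T g" using fun_cong[OF fun_cong[OF that(3), of i], of g] by (simp add: \<phi>_def)
  qed
  have plus: "\<phi> (aplus ?A S T) = aplus ?B (\<phi> S) (\<phi> T)" if "S \<in> diag_ops" "T \<in> diag_ops" for S T
    by (intro ext) (simp add: \<phi>_def alg_sum_def op_alg_def restrict_def W_mem)
  have mult: "\<phi> (amult ?A S T) = amult ?B (\<phi> S) (\<phi> T)" if "S \<in> diag_ops" "T \<in> diag_ops" for S T
    by (intro ext) (simp add: \<phi>_def alg_sum_def op_alg_def restrict_def compose_def W_mem diag_ops_W[OF that(2)])
  have scale: "\<phi> (ascale ?A c S) = ascale ?B c (\<phi> S)" if "S \<in> diag_ops" for c S
    by (intro ext) (simp add: \<phi>_def alg_sum_def op_alg_def restrict_def W_mem)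
  have star: "\<phi> (astar ?A S) = astar ?B (\<phi> S)" if "S \<in> diag_ops" for S
    using adj_diag_ops(2)[OF that] by (intro ext) (simp add: \<phi>_def alg_sum_def op_alg_def)
  have norm: "anorm ?B (\<phi> S) = anorm ?A S" if "S \<in> diag_ops" for S
    using op_norm_diag(2)[OF that] by (simp add: \<phi>_def alg_sum_def op_alg_def cong: image_cong_simp)
  have closed_A: "aplus ?A S T \<in> diag_ops" "amult ?A S T \<in> diag_ops" "ascale ?A c S \<in> diag_ops" "astar ?A S \<in> diag_ops"
    if "S \<in> diag_ops" "T \<in> diag_ops" for c S T
    using diag_ops_closed[OF that] adj_diag_ops(1)[OF that(1)] by (simp_all add: op_alg_def)
  have elems_A: "elems ?A = diag_ops" by simp
  have "bij_betw \<phi> (elems ?A) (elems ?B)"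
    unfolding elems_A bij_betw_def inj_on_def using \<phi>_inj \<phi>_in \<phi>_surj by blast
  moreover have "alg_closed ?A"
    unfolding alg_closed_def elems_A by (intro conjI ballI allI closed_A; assumption)
  \<comment> \<open>Every element of the direct sum is some \<open>\<phi> S\<close>, and
    \<open>\<phi>\<close> carries the operations of \<open>?A\<close> to those of \<open>?B\<close>;
    closure is therefore inherited from \<open>?A\<close>.\<close>
  moreover have "alg_closed ?B"
    unfolding alg_closed_def
  proof (intro conjI ballI allI)
    fix x y assume "x \<in> elems ?B" "y \<in> elems ?B"
    then obtain S T where ST: "S \<in> diag_ops" "T \<in> diag_ops" and "\<phi> S = x" "\<phi> T = y"
      using \<phi>_surj by blast
    then have xy: "x = \<phi> S" "y = \<phi> T" by simp_all
    show "aplus ?B x y \<in> elems ?B" "amult ?B x y \<in> elems ?B"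
      unfolding xy plus[OF ST, symmetric] mult[OF ST, symmetric] by (intro \<phi>_in closed_A ST)+
  next
    fix x c assume "x \<in> elems ?B"
    then obtain S where S: "S \<in> diag_ops" and "\<phi> S = x" using \<phi>_surj by blast
    then have x: "x = \<phi> S" by simp
    show "astar ?B x \<in> elems ?B" "ascale ?B c x \<in> elems ?B"
      unfolding x star[OF S, symmetric] scale[OF S, symmetric] by (rule \<phi>_in, rule closed_A(4)[OF S S], rule \<phi>_in, rule closed_A(3)[OF S S])
  qed
  ultimately show ?thesis
    unfolding wstar_isomorphic_def elems_A
    by (intro conjI exI[of _ \<phi>] ballI allI) (simp_all only: plus mult scale star norm)
qed

end

section \<open>Matrices as block operators\<close>

lemma inner_coord_space:
  assumes "finite R"
  shows "inner_product_fspace (coord_space R)"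
proof
  have fs: "fscale c v q = c * v q" for c and v :: "nat \<Rightarrow> complex" and q by (simp add: fscale_def)
  show "cfun.subspace (vecs (coord_space R))"
    by (auto simp: cfun.subspace_def coord_space_def fs)
  fix f g h :: "nat \<Rightarrow> complex" and c
  show "ip (coord_space R) (f + g) h = ip (coord_space R) f h + ip (coord_space R) g h"
    by (simp add: coord_space_def distrib_right sum.distrib)
  show "ip (coord_space R) (fscale c f) h = c * ip (coord_space R) f h"
    by (simp add: coord_space_def fs sum_distrib_left mult_ac)
  show "ip (coord_space R) g f = cnj (ip (coord_space R) f g)"
    by (simp add: coord_space_def mult.commute)
  have self: "Re (ip (coord_space R) f f) = (\<Sum>q\<in>R. (cmod (f q))\<^sup>2)"
    unfolding coord_space_def fspace.simps complex_norm_square[symmetric] by simp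
  show "0 \<le> Re (ip (coord_space R) f f)" unfolding self by (simp add: sum_nonneg)
  assume f: "f \<in> vecs (coord_space R)" and "Re (ip (coord_space R) f f) = 0"
  then have "\<forall>q\<in>R. (cmod (f q))\<^sup>2 = 0" unfolding self using assms by (subst (asm) sum_nonneg_eq_0_iff) auto
  then have "f q = 0" for q using f by (cases "q \<in> R") (auto simp: coord_space_def)
  then show "f = 0" by auto
qed

lemma matrix_op_apply:
  "v \<in> vecs (coord_space R) \<Longrightarrow> matrix_op R A v q = (if q \<in> R then \<Sum>r\<in>R. A q r * v r else 0)"
  by (simp add: matrix_op_def)

text \<open>The sum of the moduli of all entries is a crude bound that depends on the block.
  Estimates uniform over the blocks are made through \<open>op_norm\<close> instead.\<close>

lemma matrix_op_bounded:
  assumes "finite R"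
  shows "matrix_op R A \<in> bounded_ops (coord_space R)"
proof -
  interpret inner_product_fspace "coord_space R" by (rule inner_coord_space[OF assms])
  have fs: "fscale c v q = c * v q" for c and v :: "nat \<Rightarrow> complex" and q by (simp add: fscale_def)
  have mem: "matrix_op R A v \<in> vecs (coord_space R)" if "v \<in> vecs (coord_space R)" for v
    using that matrix_op_apply[OF that] by (auto simp: coord_space_def)
  have "linear_map (coord_space R) (coord_space R) (matrix_op R A)"
  proof (rule linear_mapI)
    fix v w assume "v \<in> vecs (coord_space R)" "w \<in> vecs (coord_space R)"
    then show "matrix_op R A (v + w) = matrix_op R A v + matrix_op R A w"
      by (intro ext) (simp add: matrix_op_apply add_mem distrib_left sum.distrib)
  next
    fix c v assume "v \<in> vecs (coord_space R)"
    then show "matrix_op R A (fscale c v) = fscale c (matrix_op R A v)"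
      by (intro ext) (simp add: matrix_op_apply scale_mem fs sum_distrib_left mult_ac)
  qed (simp_all add: mem, simp add: matrix_op_def)
  moreover have "vnorm (coord_space R) (matrix_op R A v) \<le> (\<Sum>q\<in>R. \<Sum>r\<in>R. cmod (A q r)) * vnorm (coord_space R) v"
    if v: "v \<in> vecs (coord_space R)" for v
  proof -
    have sq: "vnorm (coord_space R) w = L2_set (\<lambda>q. cmod (w q)) R" for w
      unfolding vnorm_def L2_set_def coord_space_def fspace.simps complex_norm_square[symmetric] by simp
    have "vnorm (coord_space R) (matrix_op R A v) \<le> (\<Sum>q\<in>R. cmod (matrix_op R A v q))"
      unfolding sq by (rule L2_set_le_sum) simp
    also have "\<dots> \<le> (\<Sum>q\<in>R. \<Sum>r\<in>R. cmod (A q r) * vnorm (coord_space R) v)"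
    proof (rule sum_mono)
      fix q assume q: "q \<in> R"
      have "cmod (matrix_op R A v q) = cmod (\<Sum>r\<in>R. A q r * v r)" using q by (simp add: matrix_op_apply[OF v])
      also have "\<dots> \<le> (\<Sum>r\<in>R. cmod (A q r) * vnorm (coord_space R) v)"
      proof (rule sum_norm_le)
        fix r assume "r \<in> R"
        then have "cmod (v r) \<le> vnorm (coord_space R) v"
          unfolding sq using member_le_L2_set[OF assms, of r "\<lambda>q. cmod (v q)"] by simp
        then show "cmod (A q r * v r) \<le> cmod (A q r) * vnorm (coord_space R) v"
          by (simp add: norm_mult mult_left_mono)
      qed
      finally show "cmod (matrix_op R A v q) \<le> (\<Sum>r\<in>R. cmod (A q r) * vnorm (coord_space R) v)" .
    qed
    finally show ?thesis by (simp add: sum_distrib_right)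
  qed
  ultimately show ?thesis by (auto simp: bounded_ops_def)
qed

context orthonormal_blocks
begin

lemma seqs_component: "x \<in> vecs seqs \<Longrightarrow> (\<lambda>q. x (i, q)) \<in> vecs (coord_space (Q i))"
proof -
  assume "x \<in> vecs seqs"
  then have "x (i, q) = 0" if "q \<notin> Q i" for q using that unfolding vecs_seqs by blast
  then show "(\<lambda>q. x (i, q)) \<in> vecs (coord_space (Q i))" unfolding coord_space_def fspace.simps mem_Collect_eq by blast
qed

lemma ip_diag_op_comb:
  assumes S: "S \<in> diag_ops" and i: "i \<in> I" and q: "q \<in> Q i"
  shows "ip H (S (\<Sum>r\<in>Q i. fscale (c r) (e i r))) (e i q) = (\<Sum>r\<in>Q i. ip H (S (e i r)) (e i q) * c r)"
proof -
  have "S (\<Sum>r\<in>Q i. fscale (c r) (e i r)) = (\<Sum>r\<in>Q i. fscale (c r) (S (e i r)))"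
    by (rule linear_map_sum[OF diag_ops_linear[OF S] subspace e_mem[OF i]])
  moreover have "S (e i r) \<in> vecs H" if "r \<in> Q i" for r by (intro diag_ops_mem[OF S] e_mem i that)
  ultimately show ?thesis
    using e_mem[OF i q] by (simp only:) (subst ip_sum_left, auto simp: scale_mem ip_scale_left mult.commute)
qed

text \<open>Entries of a matrix sequence outside \<open>Q i\<close> are arbitrary, hence agreement
  of \<open>A\<close> with the matrix of \<open>S\<close> is asked on \<open>Q i\<close> only. In
  this form it serves both inclusions of \<open>image_diag_ops\<close>.\<close>

lemma conjugate_diag_op:
  assumes S: "S \<in> diag_ops"
    and A: "\<And>i q r. i \<in> I \<Longrightarrow> q \<in> Q i \<Longrightarrow> r \<in> Q i \<Longrightarrow> A i q r = ip H (S (e i r)) (e i q)"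
  shows "(\<lambda>x\<in>vecs seqs. coeff_map (S (adj H seqs coeff_map x))) =
    block_diag I (\<lambda>i. coord_space (Q i)) (\<lambda>i. matrix_op (Q i) (A i))"
proof
  fix x
  show "(\<lambda>x\<in>vecs seqs. coeff_map (S (adj H seqs coeff_map x))) x =
    block_diag I (\<lambda>i. coord_space (Q i)) (\<lambda>i. matrix_op (Q i) (A i)) x"
  proof (cases "x \<in> vecs seqs")
    case True
    then obtain f where f: "f \<in> vecs H" and x: "coeff_map f = x" by (rule coeff_map_surj)
    have adj: "adj H seqs coeff_map x = f" using adj_coeff_map[OF f] by (simp add: x)
    have "coeff_map (S f) (i, q) = (if i \<in> I then matrix_op (Q i) (A i) (\<lambda>r. x (i, r)) q else 0)" for i q
    proof (cases "i \<in> I \<and> q \<in> Q i")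
      case iq: True
      then have i: "i \<in> I" and q: "q \<in> Q i" by auto
      have "ip H (S f) (e i q) = ip H (S (proj i f)) (e i q)"
        using ip_proj[OF i i q, of "S f"] by (simp add: proj_commute[OF S f i])
      also have "\<dots> = (\<Sum>r\<in>Q i. ip H (S (e i r)) (e i q) * ip H f (e i r))"
        unfolding proj_def by (rule ip_diag_op_comb[OF S i q])
      also have "\<dots> = (\<Sum>r\<in>Q i. A i q r * x (i, r))"
        using i q by (intro sum.cong refl) (simp add: A x[symmetric] coeff_map_apply[OF f])
      finally show ?thesis
        using i q by (simp add: coeff_map_apply[OF diag_ops_mem[OF S f]] matrix_op_apply[OF seqs_component[OF True]])
    next
      case False
      then show ?thesis
        by (auto simp: coeff_map_apply[OF diag_ops_mem[OF S f]] matrix_op_apply[OF seqs_component[OF True]])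
    qed
    then show ?thesis using True by (auto simp: block_diag_def adj)
  next
    case False
    then show ?thesis by (simp add: block_diag_def)
  qed
qed

text \<open>Sending \<open>v\<close> to the combination of the \<open>e i r\<close> with
  coefficients \<open>v r\<close> is an isometry of the coordinate space into \<open>W i\<close>,
  and it carries the matrix to the restriction of \<open>S\<close>.\<close>

lemma op_norm_matrix_le:
  assumes S: "S \<in> diag_ops" and i: "i \<in> I"
    and A: "\<And>q r. q \<in> Q i \<Longrightarrow> r \<in> Q i \<Longrightarrow> A q r = ip H (S (e i r)) (e i q)"
  shows "op_norm (coord_space (Q i)) (matrix_op (Q i) A) \<le> op_norm H S"
proof -
  interpret C: inner_product_fspace "coord_space (Q i)" by (rule inner_coord_space[OF finite_Q[OF i]])
  have M: "0 \<le> op_norm H S" by (rule op_norm_nonneg[OF diag_ops_bounded[OF S]])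
  show ?thesis
  proof (rule C.op_norm_least[OF _ M])
    show "matrix_op (Q i) A \<in> vecs (coord_space (Q i)) \<rightarrow> vecs (coord_space (Q i))"
      using matrix_op_bounded[OF finite_Q[OF i], of A] linear_mapD(1) unfolding bounded_ops_def by blast
    fix v assume v: "v \<in> vecs (coord_space (Q i))"
    let ?g = "\<Sum>r\<in>Q i. fscale (v r) (e i r)"
    have gW: "?g \<in> vecs (W i)" by (rule comb_in_W[OF i])
    have mv: "matrix_op (Q i) A v \<in> vecs (coord_space (Q i))"
      using matrix_op_bounded[OF finite_Q[OF i], of A] linear_mapD(1)[OF _ v] unfolding bounded_ops_def by blast
    have g: "?g \<in> vecs H" and Sg: "S ?g \<in> vecs H" using W_mem[OF i gW] diag_ops_mem[OF S] by auto
    have "(vnorm (coord_space (Q i)) (matrix_op (Q i) A v))\<^sup>2 = (\<Sum>q\<in>Q i. (cmod (ip H (S ?g) (e i q)))\<^sup>2)"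
      unfolding vnorm_coord_space ip_diag_op_comb[OF S i]
      by (intro sum.cong refl) (simp add: matrix_op_apply[OF v] A ip_diag_op_comb[OF S i])
    also have "\<dots> = (vnorm H (S ?g))\<^sup>2"
      using vnorm_proj[OF i, of "S ?g"] proj_W[OF i diag_ops_W[OF S i gW]] by simp
    finally have "vnorm (coord_space (Q i)) (matrix_op (Q i) A v) = vnorm H (S ?g)"
      by (rule power2_eq_imp_eq[OF _ C.vnorm_nonneg[OF mv] vnorm_nonneg[OF Sg]])
    moreover have "(vnorm H ?g)\<^sup>2 = (vnorm (coord_space (Q i)) v)\<^sup>2"
      unfolding vnorm_comb[OF i] vnorm_coord_space ..
    then have "vnorm H ?g = vnorm (coord_space (Q i)) v"
      by (rule power2_eq_imp_eq[OF _ vnorm_nonneg[OF g] C.vnorm_nonneg[OF v]])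
    ultimately show "vnorm (coord_space (Q i)) (matrix_op (Q i) A v) \<le> op_norm H S * vnorm (coord_space (Q i)) v"
      using op_norm_upper[OF diag_ops_bounded[OF S] g] by simp
  qed
qed

text \<open>Converse of \<open>op_norm_matrix_le\<close>: the same isometry moves the uniform bound
  on the matrices to blocks \<open>T i\<close>, which \<open>diag_ops_of_blocks\<close>
  assembles.\<close>

lemma diag_op_of_matrices:
  assumes bdd: "bdd_above ((\<lambda>i. op_norm (coord_space (Q i)) (matrix_op (Q i) (A i))) ` I)"
  obtains S where "S \<in> diag_ops" "\<And>i q r. i \<in> I \<Longrightarrow> q \<in> Q i \<Longrightarrow> r \<in> Q i \<Longrightarrow> A i q r = ip H (S (e i r)) (e i q)"
proof -
  let ?M = "SUP i\<in>I. op_norm (coord_space (Q i)) (matrix_op (Q i) (A i))"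
  have upper: "op_norm (coord_space (Q i)) (matrix_op (Q i) (A i)) \<le> ?M" if "i \<in> I" for i
    using bdd that by (rule cSUP_upper2) simp
  obtain i0 where i0: "i0 \<in> I" using I_nonempty by blast
  have "0 \<le> op_norm (coord_space (Q i0)) (matrix_op (Q i0) (A i0))"
    by (intro inner_product_fspace.op_norm_nonneg inner_coord_space matrix_op_bounded finite_Q i0)
  then have M: "?M \<ge> 0" using upper[OF i0] by linarith
  define T where "T i = (\<lambda>g\<in>vecs (W i). \<Sum>q\<in>Q i. fscale (\<Sum>r\<in>Q i. A i q r * ip H g (e i r)) (e i q))" for i
  have TW: "T i g \<in> vecs (W i)" if "i \<in> I" "g \<in> vecs (W i)" for i g
    using that by (simp add: T_def comb_in_W)
  have bound: "vnorm H (T i g) \<le> ?M * vnorm H g" if i: "i \<in> I" and g: "g \<in> vecs (W i)" for i g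
  proof -
    interpret C: inner_product_fspace "coord_space (Q i)" by (rule inner_coord_space[OF finite_Q[OF i]])
    let ?v = "\<lambda>q. if q \<in> Q i then ip H g (e i q) else 0"
    have v: "?v \<in> vecs (coord_space (Q i))" by (simp add: coord_space_def)
    have gH: "g \<in> vecs H" and TH: "T i g \<in> vecs H" using g TW[OF i g] W_mem[OF i] by auto
    have mv: "matrix_op (Q i) (A i) ?v \<in> vecs (coord_space (Q i))"
      using matrix_op_bounded[OF finite_Q[OF i], of "A i"] linear_mapD(1)[OF _ v] unfolding bounded_ops_def by blast
    have "(vnorm H (T i g))\<^sup>2 = (\<Sum>q\<in>Q i. (cmod (\<Sum>r\<in>Q i. A i q r * ip H g (e i r)))\<^sup>2)"
      using g by (simp add: T_def vnorm_comb[OF i])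
    also have "\<dots> = (vnorm (coord_space (Q i)) (matrix_op (Q i) (A i) ?v))\<^sup>2"
      unfolding vnorm_coord_space by (intro sum.cong refl) (simp add: matrix_op_apply[OF v])
    finally have 1: "vnorm H (T i g) = vnorm (coord_space (Q i)) (matrix_op (Q i) (A i) ?v)"
      by (rule power2_eq_imp_eq[OF _ vnorm_nonneg[OF TH] C.vnorm_nonneg[OF mv]])
    have "(vnorm H g)\<^sup>2 = (vnorm (coord_space (Q i)) ?v)\<^sup>2"
      unfolding vnorm_coord_space using vnorm_proj[OF i, of g] proj_W[OF i g] by simp
    then have 2: "vnorm H g = vnorm (coord_space (Q i)) ?v"
      by (rule power2_eq_imp_eq[OF _ vnorm_nonneg[OF gH] C.vnorm_nonneg[OF v]])
    have "vnorm H (T i g) \<le> op_norm (coord_space (Q i)) (matrix_op (Q i) (A i)) * vnorm H g"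
      unfolding 1 2 by (rule C.op_norm_upper[OF matrix_op_bounded[OF finite_Q[OF i]] v])
    also have "\<dots> \<le> ?M * vnorm H g" by (intro mult_right_mono upper i vnorm_nonneg gH)
    finally show ?thesis .
  qed
  have Tb: "T i \<in> bounded_ops (W i)" if i: "i \<in> I" for i
  proof -
    have "linear_map (W i) (W i) (T i)"
      unfolding T_def using W_mem[OF i] e_mem[OF i]
      by (intro linear_map_comb[OF i])
        (simp_all only: ip_add_left ip_scale_left distrib_left sum.distrib sum_distrib_left mult.left_commute cong: sum.cong)
    then show ?thesis using bound[OF i] by (auto simp: bounded_ops_def vnorm_W[OF i])
  qed
  obtain S where S: "S \<in> diag_ops" "\<And>i g. i \<in> I \<Longrightarrow> g \<in> vecs (W i) \<Longrightarrow> S g = T i g"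
    "\<And>f. f \<in> vecs H \<Longrightarrow> vnorm H (S f) \<le> ?M * vnorm H f"
    using diag_ops_of_blocks[OF Tb M bound] by blast
  have "A i q r = ip H (S (e i r)) (e i q)" if i: "i \<in> I" and q: "q \<in> Q i" and r: "r \<in> Q i" for i q r
  proof -
    have "ip H (S (e i r)) (e i q) = (\<Sum>s\<in>Q i. A i q s * ip H (e i r) (e i s))"
      unfolding S(2)[OF i e_in_W[OF i r]] using e_in_W[OF i r] ip_comb[OF i i q] by (simp add: T_def)
    also have "\<dots> = (\<Sum>s\<in>Q i. if s = r then A i q r else 0)"
      using i r by (intro sum.cong refl) (auto simp: orthonormal)
    also have "\<dots> = A i q r" using r finite_Q[OF i] by simp
    finally show ?thesis by simp
  qed
  with S(1) show ?thesis by (rule that)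
qed

lemma image_diag_ops:
  "(\<lambda>S. \<lambda>x\<in>vecs seqs. coeff_map (S (adj H seqs coeff_map x))) ` diag_ops =
    {block_diag I (\<lambda>i. coord_space (Q i)) (\<lambda>i. matrix_op (Q i) (A i)) | A.
       bdd_above ((\<lambda>i. op_norm (coord_space (Q i)) (matrix_op (Q i) (A i))) ` I)}" (is "?F ` _ = ?B")
proof (intro equalityI subsetI)
  fix T assume "T \<in> ?F ` diag_ops"
  then obtain S where S: "S \<in> diag_ops" and T: "T = ?F S" by blast
  let ?A = "\<lambda>i q r. ip H (S (e i r)) (e i q)"
  have "T = block_diag I (\<lambda>i. coord_space (Q i)) (\<lambda>i. matrix_op (Q i) (?A i))"
    unfolding T by (rule conjugate_diag_op[OF S refl])
  moreover have "bdd_above ((\<lambda>i. op_norm (coord_space (Q i)) (matrix_op (Q i) (?A i))) ` I)"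
    by (rule bdd_aboveI2) (rule op_norm_matrix_le[OF S _ refl])
  ultimately show "T \<in> ?B" unfolding mem_Collect_eq by (intro exI[of _ ?A] conjI)
next
  fix T assume "T \<in> ?B"
  then obtain A where T: "T = block_diag I (\<lambda>i. coord_space (Q i)) (\<lambda>i. matrix_op (Q i) (A i))"
    and bdd: "bdd_above ((\<lambda>i. op_norm (coord_space (Q i)) (matrix_op (Q i) (A i))) ` I)" by blast
  obtain S where S: "S \<in> diag_ops" "\<And>i q r. i \<in> I \<Longrightarrow> q \<in> Q i \<Longrightarrow> r \<in> Q i \<Longrightarrow> A i q r = ip H (S (e i r)) (e i q)"
    using diag_op_of_matrices[OF bdd] by blast
  have "?F S = T" unfolding T by (rule conjugate_diag_op[OF S])
  with S(1) show "T \<in> ?F ` diag_ops" by blast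
qed

end

section \<open>The weighted measure on the disk\<close>

lemma measurable_ball [measurable]: "ball (a::'a::metric_space) r \<in> sets borel"
  by simp

text \<open>The usual Fubini argument for the uniqueness of translation invariant measures, applied to the
  unit ball, whose measure \<open>T\<close> preserves.\<close>

lemma distr_lborel_linear_isometry:
  fixes T :: "'a::euclidean_space \<Rightarrow> 'a"
  assumes lin: "linear T" and iso: "\<And>x. norm (T x) = norm x"
  shows "distr lborel borel T = lborel"
proof -
  define N where "N = distr lborel borel T"
  have meas_T [measurable]: "T \<in> borel_measurable borel"
    using lin by (intro borel_measurable_continuous_onI linear_continuous_on linear_conv_bounded_linear[THEN iffD1])
  have [simp, measurable_cong]: "sets N = sets borel" and [simp]: "space N = UNIV" by (auto simp: N_def)
  have inj: "inj T"
    by (rule linear_injective_0[THEN iffD2, OF lin, rule_format]) (metis iso norm_eq_zero)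
  then have surj: "surj T" using lin by (simp add: linear_inj_imp_surj)
  have ballN: "emeasure N (ball 0 r) = emeasure lborel (ball (0::'a) r)" for r
    unfolding N_def by (subst emeasure_distr) (auto intro!: arg_cong[where f="emeasure lborel"] simp: iso dist_norm)
  have "sigma_finite_measure N"
  proof
    have "emeasure N (ball 0 r) \<noteq> \<infinity>" for r
      unfolding ballN using emeasure_lborel_ball_finite[of 0 r] by (metis infinity_ennreal_def less_irrefl)
    moreover have "(\<Union>n::nat. ball (0::'a) (real n)) = UNIV"
      by (auto, meson reals_Archimedean2)
    ultimately show "\<exists>A. countable A \<and> A \<subseteq> sets N \<and> \<Union> A = space N \<and> (\<forall>a\<in>A. emeasure N a \<noteq> \<infinity>)"
      by (intro exI[of _ "range (\<lambda>n::nat. ball 0 (real n))"]) auto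
  qed
  then interpret pair_sigma_finite "lborel :: 'a measure" N
    by (intro pair_sigma_finite.intro lborel.sigma_finite_measure_axioms)
  have transN: "(\<integral>\<^sup>+y. f (y + c) \<partial>N) = (\<integral>\<^sup>+y. f y \<partial>N)" if [measurable]: "f \<in> borel_measurable borel" for f c
  proof -
    obtain d where d: "T d = c" using surj by (metis surjD)
    have "(\<integral>\<^sup>+y. f (y + c) \<partial>N) = (\<integral>\<^sup>+x. f (T (d + x)) \<partial>lborel)"
      unfolding N_def by (subst nn_integral_distr) (auto simp: linear_add[OF lin] d add.commute)
    also have "\<dots> = (\<integral>\<^sup>+x. f (T x) \<partial>distr lborel borel ((+) d))"
      by (subst nn_integral_distr) auto
    also have "\<dots> = (\<integral>\<^sup>+y. f y \<partial>N)"
      unfolding N_def by (subst lborel_distr_plus, subst nn_integral_distr) auto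
    finally show ?thesis .
  qed
  have transL: "(\<integral>\<^sup>+x. f (x + c) \<partial>lborel) = (\<integral>\<^sup>+x. f x \<partial>lborel)"
    if [measurable]: "f \<in> borel_measurable borel" for f and c :: 'a
    by (subst (2) lborel_distr_plus[of c, symmetric], subst nn_integral_distr) (auto simp: add.commute)
  have reflL: "(\<integral>\<^sup>+x. f (c - x) \<partial>lborel) = (\<integral>\<^sup>+x. f x \<partial>lborel)"
    if [measurable]: "f \<in> borel_measurable borel" for f and c :: 'a
  proof -
    have "lborel = distr lborel borel (\<lambda>x. c + (- 1) *\<^sub>R x)"
      using lborel_affine[of "-1" c] by (simp add: density_1)
    then have "(\<integral>\<^sup>+x. f x \<partial>lborel) = (\<integral>\<^sup>+x. f x \<partial>distr lborel borel (\<lambda>x. c + (- 1) *\<^sub>R x))" by simp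
    then show ?thesis by (subst (asm) nn_integral_distr) auto
  qed
  have "N = lborel"
  proof (rule measure_eqI)
    fix A assume "A \<in> sets N"
    then have [measurable]: "A \<in> sets borel" by simp
    let ?B = "ball 0 1 :: 'a set"
    \<comment> \<open>Translate \<open>x\<close> by \<open>y\<close>, exchange the integrals,
      translate \<open>y\<close> back by \<open>x\<close>, exchange again, and reflect
      \<open>x\<close>. The set \<open>A\<close> thereby moves from the variable of \<open>N\<close>
      to that of \<open>lborel\<close>, while \<open>?B\<close> moves the other way.\<close>
    have "emeasure lborel ?B * emeasure N A = (\<integral>\<^sup>+y. \<integral>\<^sup>+x. indicator ?B x * indicator A y \<partial>lborel \<partial>N)"
      by (simp add: nn_integral_multc nn_integral_cmult_indicator)
    also have "\<dots> = (\<integral>\<^sup>+y. \<integral>\<^sup>+x. indicator ?B (x + y) * indicator A y \<partial>lborel \<partial>N)"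
      by (rule nn_integral_cong, rule transL[symmetric]) measurable
    also have "\<dots> = (\<integral>\<^sup>+x. \<integral>\<^sup>+y. indicator ?B (y + x) * indicator A (y + x - x) \<partial>N \<partial>lborel)"
      by (subst Fubini') (auto simp: add.commute)
    also have "\<dots> = (\<integral>\<^sup>+x. \<integral>\<^sup>+y. indicator ?B y * indicator A (y - x) \<partial>N \<partial>lborel)"
      by (rule nn_integral_cong, rule transN) measurable
    also have "\<dots> = (\<integral>\<^sup>+y. \<integral>\<^sup>+x. indicator ?B y * indicator A (y - x) \<partial>lborel \<partial>N)"
      by (subst Fubini') auto
    also have "\<dots> = (\<integral>\<^sup>+y. indicator ?B y * (\<integral>\<^sup>+x. indicator A x \<partial>lborel) \<partial>N)"
      by (rule nn_integral_cong, subst nn_integral_cmult, measurable, subst reflL) auto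
    also have "\<dots> = emeasure lborel ?B * emeasure lborel A"
      by (simp add: nn_integral_multc ballN)
    \<comment> \<open>The unit ball has the same measure for \<open>N\<close>, and this measure is
      positive and finite, so it cancels.\<close>
    finally show "emeasure N A = emeasure lborel A"
      using emeasure_lborel_ball_finite[of "0::'a" 1] content_ball_pos[of 1 "0::'a"]
      by (subst (asm) ennreal_mult_cancel_left) (auto simp: measure_def)
  qed simp
  then show ?thesis unfolding N_def .
qed

section \<open>Radial integrals and rotations\<close>

lemma emeasure_disc_sq_greater:
  "emeasure (density lborel (indicator (ball 0 1))) {z::complex. x < (cmod z)\<^sup>2}
     = (if x < 0 then pi else if x < 1 then pi * (1 - x) else 0)"
proof -
  have [measurable]: "{z::complex. x < (cmod z)\<^sup>2} \<in> sets borel" by measurable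
  have *: "emeasure (density lborel (indicator (ball 0 1))) {z::complex. x < (cmod z)\<^sup>2} =
     emeasure lborel ({z::complex. x < (cmod z)\<^sup>2} \<inter> ball 0 1)"
    by (subst emeasure_density) (auto simp: indicator_inter_arith[symmetric] Int_commute intro!: borel_measurable_indicator)
  have b: "emeasure lborel (ball (0::complex) 1) = ennreal pi" 
    by (subst emeasure_ball) (auto simp: unit_ball_vol_2)
  consider "x < 0" | "0 \<le> x" "x < 1" | "1 \<le> x" by linarith
  then show ?thesis
  proof cases
    case 1
    then have "{z::complex. x < (cmod z)\<^sup>2} \<inter> ball 0 1 = ball 0 1"
      using zero_le_power2 by (auto simp del: zero_le_power2 intro: less_le_trans)
    then show ?thesis using * b 1 by simp
  next
    case 2
    have "x < (cmod z)\<^sup>2 \<longleftrightarrow> \<not> cmod z \<le> sqrt x" for z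
      by (metis not_le real_less_lsqrt real_le_rsqrt real_sqrt_abs abs_norm_cancel real_sqrt_less_iff)
    then have "{z::complex. x < (cmod z)\<^sup>2} \<inter> ball 0 1 = ball 0 1 - cball 0 (sqrt x)"
      unfolding set_eq_iff Int_iff Diff_iff mem_cball_0 mem_Collect_eq by blast
    moreover have sub: "cball 0 (sqrt x) \<subseteq> ball (0::complex) 1"
    proof
      fix z :: complex assume "z \<in> cball 0 (sqrt x)"
      moreover have "sqrt x < 1" using 2 by simp
      ultimately show "z \<in> ball 0 1" unfolding mem_cball_0 mem_ball_0 by (rule le_less_trans)
    qed
    moreover have "emeasure lborel (ball (0::complex) 1 - cball 0 (sqrt x)) = ennreal pi - ennreal (pi * x)"
      using 2 sub by (subst emeasure_Diff) (simp_all add: b emeasure_cball unit_ball_vol_2 ennreal_mult_eq_top_iff)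
    ultimately show ?thesis using * 2 by (simp add: ennreal_minus right_diff_distrib)
  next
    case 3
    have "{z::complex. x < (cmod z)\<^sup>2} \<inter> ball 0 1 = {}"
      using 3 by auto (smt (verit) norm_ge_zero power_le_one)
    then show ?thesis using * 3 by simp
  qed
qed

text \<open>A substitute for polar coordinates: under plane measure on the disk, the square of the
  modulus is uniformly distributed on [0,1] with total mass pi. It suffices to compare
  half-lines.\<close>

lemma distr_disc_cmod_sq:
  "distr (density lborel (indicator (ball (0::complex) 1))) borel (\<lambda>z. (cmod z)\<^sup>2)
     = density lborel (\<lambda>u. ennreal (pi * indicator {0..1} u))" (is "?M = ?N")
proof (rule measure_eqI_lessThan)
  show "sets ?M = sets borel" "sets ?N = sets borel" by auto
  have M: "emeasure ?M {x<..} = (if x < 0 then pi else if x < 1 then pi * (1 - x) else 0)" for x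
    by (subst emeasure_distr) (auto simp: emeasure_disc_sq_greater[symmetric] intro!: arg_cong2[where f=emeasure])
  fix x :: real
  show "emeasure ?M {x<..} < \<infinity>" unfolding M by auto
  have "emeasure ?N {x<..} = (\<integral>\<^sup>+u. ennreal pi * indicator ({0..1} \<inter> {x<..}) u \<partial>lborel)"
    by (subst emeasure_density) (auto intro!: nn_integral_cong simp: indicator_def)
  also have "\<dots> = ennreal pi * emeasure lborel ({0..1} \<inter> {x<..})"
    by (subst nn_integral_cmult) auto
  also have "\<dots> = (if x < 0 then pi else if x < 1 then pi * (1 - x) else 0)"
  proof -
    consider "x < 0" | "0 \<le> x" "x < 1" | "1 \<le> x" by linarith
    then show ?thesis
    proof cases
      case 1
      then have "{0..1} \<inter> {x<..} = {0..1}" by auto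
      then show ?thesis using 1 by simp
    next
      case 2
      then have "{0..1} \<inter> {x<..} = {x<..1}" by auto
      then show ?thesis using 2 by (simp add: ennreal_mult)
    next
      case 3
      then have "{0..1} \<inter> {x<..} = {}" by auto
      then show ?thesis using 3 by simp
    qed
  qed
  finally show "emeasure ?M {x<..} = emeasure ?N {x<..}" using M by simp
qed

lemma space_mu [simp]: "space (mu \<alpha>) = UNIV"
  and sets_mu [simp, measurable_cong]: "sets (mu \<alpha>) = sets borel"
  by (auto simp: mu_def)

lemma measurable_mu_iff [simp]: "borel_measurable (mu \<alpha>) = borel_measurable borel"
  by (rule measurable_cong_sets) auto

lemma measurable_mu_weight [measurable]:
  "(\<lambda>z::complex. ennreal (indicator (ball 0 1) z * ((\<alpha> + 1) / pi * (1 - (cmod z)\<^sup>2) powr \<alpha>))) \<in> borel_measurable borel"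
proof -
  have [measurable]: "(\<lambda>z::complex. indicator (ball 0 1) z :: real) \<in> borel_measurable borel"
    by (intro borel_measurable_indicator) simp
  show ?thesis by measurable
qed

lemma nn_integral_mu:
  assumes [measurable]: "f \<in> borel_measurable borel"
  shows "(\<integral>\<^sup>+z. f z \<partial>mu \<alpha>) =
    (\<integral>\<^sup>+z. ennreal (indicator (ball 0 1) z * ((\<alpha> + 1) / pi * (1 - (cmod z)\<^sup>2) powr \<alpha>)) * f z \<partial>lborel)"
  unfolding mu_def
  by (rule nn_integral_density) (simp_all only: measurable_lborel2 measurable_mu_weight assms)

lemma AE_mu_ball: "AE z in mu \<alpha>. z \<in> ball 0 1"
  unfolding mu_def
  by (subst AE_density, simp only: measurable_lborel2 measurable_mu_weight) (auto intro!: AE_I2 simp: indicator_def)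

text \<open>Rotations preserve plane measure, and the weight depends on the modulus only.\<close>

lemma distr_mu_rotate:
  assumes "cmod \<tau> = 1"
  shows "distr (mu \<alpha>) borel (\<lambda>z. \<tau> * z) = mu \<alpha>"
proof (rule measure_eqI)
  fix A assume "A \<in> sets (distr (mu \<alpha>) borel (\<lambda>z. \<tau> * z))"
  then have [measurable]: "A \<in> sets borel" by simp
  let ?w = "\<lambda>z::complex. ennreal (indicator (ball 0 1) z * ((\<alpha> + 1) / pi * (1 - (cmod z)\<^sup>2) powr \<alpha>))"
  have L: "distr lborel borel (\<lambda>z. \<tau> * z) = lborel"
    by (rule distr_lborel_linear_isometry)
      (auto simp: norm_mult assms linear_iff algebra_simps scaleR_conv_of_real)
  have [measurable]: "?w \<in> borel_measurable borel" by (rule measurable_mu_weight)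
  have "emeasure (distr (mu \<alpha>) borel (\<lambda>z. \<tau> * z)) A = (\<integral>\<^sup>+z. indicator A (\<tau> * z) \<partial>mu \<alpha>)"
    by (subst nn_integral_indicator[symmetric], simp, subst nn_integral_distr) auto
  also have "\<dots> = (\<integral>\<^sup>+z. ?w (\<tau> * z) * indicator A (\<tau> * z) \<partial>lborel)"
    by (subst nn_integral_mu, measurable) (auto intro!: nn_integral_cong simp: norm_mult assms indicator_def)
  also have "\<dots> = (\<integral>\<^sup>+z. ?w z * indicator A z \<partial>distr lborel borel (\<lambda>z. \<tau> * z))"
    by (subst nn_integral_distr) auto
  also have "\<dots> = emeasure (mu \<alpha>) A"
    unfolding L mu_def by (subst emeasure_density) auto
  finally show "emeasure (distr (mu \<alpha>) borel (\<lambda>z. \<tau> * z)) A = emeasure (mu \<alpha>) A" .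
qed simp

lemma integral_mu_homogeneous_zero:
  fixes F :: "complex \<Rightarrow> complex"
  assumes [measurable]: "F \<in> borel_measurable borel"
    and hom: "\<And>\<tau> z. cmod \<tau> = 1 \<Longrightarrow> F (\<tau> * z) = \<tau> powi k * F z" and k: "k \<noteq> 0"
  shows "(LINT z|mu \<alpha>. F z) = 0"
proof -
  \<comment> \<open>The rotation is chosen so that its k-th power is -1; the integral then equals
    its own negative.\<close>
  define \<tau> where "\<tau> = cis (pi / of_int k)"
  have t: "cmod \<tau> = 1" by (simp add: \<tau>_def)
  have "(LINT z|mu \<alpha>. F z) = (LINT z|distr (mu \<alpha>) borel (\<lambda>z. \<tau> * z). F z)"
    by (simp add: distr_mu_rotate t)
  also have "\<dots> = \<tau> powi k * (LINT z|mu \<alpha>. F z)"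
    by (subst integral_distr) (auto simp: hom[OF t])
  also have "\<tau> powi k = -1" unfolding \<tau>_def cis_power_int using k by simp
  finally show ?thesis by simp
qed

lemma nn_integral_mu_radial:
  assumes [measurable]: "h \<in> borel_measurable borel" and "\<alpha> > -1"
  shows "(\<integral>\<^sup>+z. h ((cmod z)\<^sup>2) \<partial>mu \<alpha>) =
    (\<integral>\<^sup>+u. ennreal ((\<alpha> + 1) * (1 - u) powr \<alpha>) * h u * indicator {0..1} u \<partial>lborel)"
proof -
  let ?h = "\<lambda>u::real. ennreal ((\<alpha> + 1) / pi * (1 - u) powr \<alpha>) * h u"
  have "(\<integral>\<^sup>+z. h ((cmod z)\<^sup>2) \<partial>mu \<alpha>) = (\<integral>\<^sup>+z. ?h ((cmod z)\<^sup>2) \<partial>density lborel (indicator (ball (0::complex) 1)))"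
    by (subst nn_integral_mu, measurable, subst nn_integral_density)
      (auto intro!: borel_measurable_indicator intro!: nn_integral_cong simp: indicator_def)
  also have "\<dots> = (\<integral>\<^sup>+u. ?h u \<partial>density lborel (\<lambda>u. ennreal (pi * indicator {0..1} u)))"
    by (subst distr_disc_cmod_sq[symmetric], subst nn_integral_distr) auto
  also have "\<dots> = (\<integral>\<^sup>+u. ennreal (pi * indicator {0..1} u) * ?h u \<partial>lborel)"
    by (subst nn_integral_density) auto
  also have "\<dots> = (\<integral>\<^sup>+u. ennreal ((\<alpha> + 1) * (1 - u) powr \<alpha>) * h u * indicator {0..1} u \<partial>lborel)"
    using assms(2) by (intro nn_integral_cong)
      (auto simp: indicator_def mult.assoc[symmetric] ennreal_mult[symmetric])
  finally show ?thesis .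
qed

lemma integral_mu_radial_power:
  assumes "\<alpha> > -1"
  shows "integrable (mu \<alpha>) (\<lambda>z. ((cmod z)\<^sup>2) ^ m * (1 - (cmod z)\<^sup>2) ^ i)"
    and "(LINT z|mu \<alpha>. ((cmod z)\<^sup>2) ^ m * (1 - (cmod z)\<^sup>2) ^ i) = (\<alpha> + 1) * Beta (real m + 1) (real i + \<alpha> + 1)"
proof -
  let ?b = "\<lambda>u::real. u powr (real m + 1 - 1) * (1 - u) powr (real i + \<alpha> + 1 - 1)"
  have hi: "(?b has_integral Beta (real m + 1) (real i + \<alpha> + 1)) {0..1}"
    using assms by (intro has_integral_Beta_real) auto
  have Bpos: "Beta (real m + 1) (real i + \<alpha> + 1) \<ge> 0"
    by (rule has_integral_nonneg[OF hi]) auto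
  have nn: "(\<integral>\<^sup>+u. ennreal (?b u) * indicator {0..1} u \<partial>lborel) = ennreal (Beta (real m + 1) (real i + \<alpha> + 1))"
    by (rule nn_integral_has_integral_lebesgue'[OF _ hi]) simp
  have "(\<integral>\<^sup>+z. ennreal (((cmod z)\<^sup>2) ^ m * (1 - (cmod z)\<^sup>2) ^ i) \<partial>mu \<alpha>) =
    (\<integral>\<^sup>+u. ennreal ((\<alpha> + 1) * (1 - u) powr \<alpha>) * ennreal (u ^ m * (1 - u) ^ i) * indicator {0..1} u \<partial>lborel)"
    using assms by (subst nn_integral_mu_radial[where h="\<lambda>u. ennreal (u ^ m * (1 - u) ^ i)", symmetric]) auto
  also have "\<dots> = (\<integral>\<^sup>+u. ennreal (\<alpha> + 1) * (ennreal (?b u) * indicator {0..1} u) \<partial>lborel)"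
  proof (rule nn_integral_cong_AE)
    \<comment> \<open>Powers and \<open>powr\<close> disagree at base 0, where
      \<open>0 ^ 0 = 1\<close> but \<open>0 powr 0 = 0\<close>. The endpoints form a null
      set.\<close>
    have "AE u in lborel. u \<noteq> (0::real)" "AE u in lborel. u \<noteq> (1::real)" by (auto intro: AE_lborel_singleton)
    then show "AE u in lborel. ennreal ((\<alpha> + 1) * (1 - u) powr \<alpha>) * ennreal (u ^ m * (1 - u) ^ i) * indicator {0..1} u
        = ennreal (\<alpha> + 1) * (ennreal (?b u) * indicator {0..1} u)"
    proof eventually_elim
      fix u :: real assume u: "u \<noteq> 0" "u \<noteq> 1"
      show "ennreal ((\<alpha> + 1) * (1 - u) powr \<alpha>) * ennreal (u ^ m * (1 - u) ^ i) * indicator {0..1} u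
        = ennreal (\<alpha> + 1) * (ennreal (?b u) * indicator {0..1} u)"
        using u assms by (cases "u \<in> {0..1}")
          (auto simp: powr_realpow[symmetric] powr_add ennreal_mult[symmetric] mult_ac)
    qed
  qed
  also have "\<dots> = ennreal ((\<alpha> + 1) * Beta (real m + 1) (real i + \<alpha> + 1))"
    using assms Bpos by (subst nn_integral_cmult, measurable, subst nn) (auto simp: ennreal_mult[symmetric])
  finally have *: "(\<integral>\<^sup>+z. ennreal (((cmod z)\<^sup>2) ^ m * (1 - (cmod z)\<^sup>2) ^ i) \<partial>mu \<alpha>) =
    ennreal ((\<alpha> + 1) * Beta (real m + 1) (real i + \<alpha> + 1))" .
  have nonneg: "AE z in mu \<alpha>. 0 \<le> ((cmod z)\<^sup>2) ^ m * (1 - (cmod z)\<^sup>2) ^ i"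
    using AE_mu_ball by eventually_elim (auto intro!: mult_nonneg_nonneg zero_le_power simp: abs_square_le_1 power_le_one)
  show "integrable (mu \<alpha>) (\<lambda>z. ((cmod z)\<^sup>2) ^ m * (1 - (cmod z)\<^sup>2) ^ i)"
    using nonneg * by (intro integrableI_nonneg) auto
  show "(LINT z|mu \<alpha>. ((cmod z)\<^sup>2) ^ m * (1 - (cmod z)\<^sup>2) ^ i) = (\<alpha> + 1) * Beta (real m + 1) (real i + \<alpha> + 1)"
    using nonneg * assms Bpos by (subst integral_eq_nn_integral) auto
qed

lemma finite_measure_mu:
  assumes "\<alpha> > -1"
  shows "finite_measure (mu \<alpha>)"
proof
  have "integrable (mu \<alpha>) (\<lambda>z. 1 :: real)"
    using integral_mu_radial_power(1)[OF assms, of 0 0] by simp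
  then show "emeasure (mu \<alpha>) (space (mu \<alpha>)) \<noteq> \<infinity>"
    by (auto simp: integrable_iff_bounded)
qed

section \<open>Polyanalytic functions as power series\<close>

text \<open>A normal form of n-analytic functions on the disk, equivalent by
  \<open>n_analytic_on_polyanalytic_sum\<close> and \<open>polyanalytic_sum_n_analytic_on\<close>.
  Closure under vector operations and under rotations is visible in it.\<close>

definition polyanalytic_sum :: "nat \<Rightarrow> (complex \<Rightarrow> complex) \<Rightarrow> bool" where
  "polyanalytic_sum n f \<longleftrightarrow> (\<exists>g. (\<forall>q<n. g q holomorphic_on ball 0 1) \<and>
     (\<forall>z\<in>ball 0 1. f z = (\<Sum>q<n. cnj z ^ q * g q z)))"

lemma frechet_derivative_eqI:
  "(f has_derivative f') (at z) \<Longrightarrow> frechet_derivative f (at z) = f'"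
  using frechet_derivative_at by metis

lemma d_zbar_has_derivative: "(f has_derivative f') (at z) \<Longrightarrow> d_zbar f z = (f' 1 + \<i> * f' \<i>) / 2"
  by (simp add: d_zbar_def frechet_derivative_eqI)

lemma has_derivative_cnj_power [derivative_intros]:
  "((\<lambda>z. cnj z ^ q) has_derivative (\<lambda>v. of_nat q * cnj v * cnj z ^ (q - 1))) (at z)"
  using has_derivative_power[OF bounded_linear_imp_has_derivative[OF bounded_linear_cnj]] by simp

lemma polyanalytic_sum_has_derivative:
  assumes g: "\<And>q. q < n \<Longrightarrow> g q holomorphic_on ball 0 1"
    and f: "\<And>z. z \<in> ball 0 1 \<Longrightarrow> f z = (\<Sum>q<n. cnj z ^ q * g q z)" and z: "z \<in> ball 0 1"
  shows "(f has_derivative (\<lambda>v. \<Sum>q<n. cnj z ^ q * (deriv (g q) z * v) + of_nat q * cnj v * cnj z ^ (q - 1) * g q z)) (at z)"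
proof -
  have "((\<lambda>z. \<Sum>q<n. cnj z ^ q * g q z) has_derivative
    (\<lambda>v. \<Sum>q<n. cnj z ^ q * (deriv (g q) z * v) + of_nat q * cnj v * cnj z ^ (q - 1) * g q z)) (at z)"
  proof (intro has_derivative_sum has_derivative_mult has_derivative_cnj_power)
    fix q assume "q \<in> {..<n}"
    then have "(g q has_field_derivative deriv (g q) z) (at z)"
      using g z by (intro holomorphic_derivI[of _ "ball 0 1"]) auto
    then show "(g q has_derivative (\<lambda>v. deriv (g q) z * v)) (at z)"
      by (simp add: has_field_derivative_def)
  qed
  then show ?thesis
    by (rule has_derivative_transform_within_open[OF _ open_ball z]) (simp add: f)
qed

text \<open>Reindexes the derivative in \<open>cnj z\<close> as a sum of the same length, with zero
  as the top coefficient, so that derivatives keep the form of a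
  \<open>polyanalytic_sum\<close>.\<close>

lemma sum_cnj_shift:
  fixes g :: "nat \<Rightarrow> complex"
  shows "(\<Sum>q<n. of_nat q * c * w ^ (q - 1) * g q) =
    (\<Sum>q<n. w ^ q * (if Suc q < n then of_nat (Suc q) * c * g (Suc q) else 0))"
proof (cases n)
  case (Suc m)
  have "(\<Sum>q<n. of_nat q * c * w ^ (q - 1) * g q) = (\<Sum>q<m. of_nat (Suc q) * c * w ^ q * g (Suc q))"
    unfolding Suc by (subst sum.lessThan_Suc_shift) simp
  also have "\<dots> = (\<Sum>q<n. w ^ q * (if Suc q < n then of_nat (Suc q) * c * g (Suc q) else 0))"
    unfolding Suc by (simp add: mult_ac)
  finally show ?thesis .
qed simp

text \<open>Every directional derivative of a polyanalytic sum is a polyanalytic sum of the same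
  order, which makes the induction on \<open>k\<close> close.\<close>

lemma Ck_on_polyanalytic_sum: "polyanalytic_sum n f \<Longrightarrow> Ck_on k (ball 0 1) f"
proof (induction k arbitrary: f)
  case (0 f)
  then obtain g where "\<And>q. q < n \<Longrightarrow> g q holomorphic_on ball 0 1"
    and "\<And>z. z \<in> ball 0 1 \<Longrightarrow> f z = (\<Sum>q<n. cnj z ^ q * g q z)"
    unfolding polyanalytic_sum_def by blast
  from polyanalytic_sum_has_derivative[OF this]
  have "continuous_on (ball 0 1) f"
    by (intro continuous_at_imp_continuous_on ballI) (rule has_derivative_continuous)
  then show ?case by simp
next
  case (Suc k f)
  then obtain g where g: "\<And>q. q < n \<Longrightarrow> g q holomorphic_on ball 0 1"
    and f: "\<And>z. z \<in> ball 0 1 \<Longrightarrow> f z = (\<Sum>q<n. cnj z ^ q * g q z)"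
    unfolding polyanalytic_sum_def by blast
  have d: "(f has_derivative (\<lambda>v. \<Sum>q<n. cnj z ^ q * (deriv (g q) z * v) + of_nat q * cnj v * cnj z ^ (q - 1) * g q z)) (at z)" if "z \<in> ball 0 1" for z
    by (rule polyanalytic_sum_has_derivative) (use g f that in auto)
  have "polyanalytic_sum n (\<lambda>z. frechet_derivative f (at z) v)" for v
    unfolding polyanalytic_sum_def
  proof (intro exI[of _ "\<lambda>q z. deriv (g q) z * v + (if Suc q < n then of_nat (Suc q) * cnj v * g (Suc q) z else 0)"] conjI allI impI ballI)
    fix q assume "q < n"
    then show "(\<lambda>z. deriv (g q) z * v + (if Suc q < n then of_nat (Suc q) * cnj v * g (Suc q) z else 0)) holomorphic_on ball 0 1"
      using g by (cases "Suc q < n") (auto intro!: holomorphic_intros)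
  next
    fix z :: complex assume z: "z \<in> ball 0 1"
    show "frechet_derivative f (at z) v = (\<Sum>q<n. cnj z ^ q * (deriv (g q) z * v + (if Suc q < n then of_nat (Suc q) * cnj v * g (Suc q) z else 0)))"
      unfolding frechet_derivative_eqI[OF d[OF z]] sum.distrib distrib_left
      by (simp only: sum_cnj_shift)
  qed
  then show ?case using Suc.IH d unfolding Ck_on.simps differentiable_def by blast
qed

lemma d_zbar_polyanalytic_sum:
  assumes g: "\<And>q. q < Suc n \<Longrightarrow> g q holomorphic_on ball 0 1"
    and f: "\<And>z. z \<in> ball 0 1 \<Longrightarrow> f z = (\<Sum>q<Suc n. cnj z ^ q * g q z)" and z: "z \<in> ball 0 1"
  shows "d_zbar f z = (\<Sum>q<n. cnj z ^ q * (of_nat (Suc q) * g (Suc q) z))"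
proof -
  have "d_zbar f z = (\<Sum>q<Suc n. of_nat q * 1 * cnj z ^ (q - 1) * g q z)"
  proof -
    have "(f has_derivative (\<lambda>v. \<Sum>q<Suc n. cnj z ^ q * (deriv (g q) z * v) + of_nat q * cnj v * cnj z ^ (q - 1) * g q z)) (at z)"
      by (rule polyanalytic_sum_has_derivative) (use g f z in auto)
    note d_zbar_has_derivative[OF this]
    also have "((\<Sum>q<Suc n. cnj z ^ q * (deriv (g q) z * 1) + of_nat q * cnj 1 * cnj z ^ (q - 1) * g q z) +
       \<i> * (\<Sum>q<Suc n. cnj z ^ q * (deriv (g q) z * \<i>) + of_nat q * cnj \<i> * cnj z ^ (q - 1) * g q z)) / 2
      = (\<Sum>q<Suc n. of_nat q * 1 * cnj z ^ (q - 1) * g q z)"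
      unfolding sum_distrib_left sum.distrib[symmetric] sum_divide_distrib
      by (intro sum.cong refl) (simp add: field_simps)
    finally show ?thesis .
  qed
  also have "\<dots> = (\<Sum>q<n. cnj z ^ q * (of_nat (Suc q) * g (Suc q) z))"
    by (subst sum_cnj_shift) (simp add: algebra_simps)
  finally show ?thesis .
qed

lemma n_analytic_on_polyanalytic_sum:
  assumes "polyanalytic_sum n f"
  shows "n_analytic_on n (ball 0 1) f"
proof -
  have "\<forall>z\<in>ball 0 1. (d_zbar ^^ n) f z = 0" using assms
  proof (induction n arbitrary: f)
    case (Suc n f)
    then obtain g where g: "\<And>q. q < Suc n \<Longrightarrow> g q holomorphic_on ball 0 1"
      and f: "\<And>z. z \<in> ball 0 1 \<Longrightarrow> f z = (\<Sum>q<Suc n. cnj z ^ q * g q z)"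
      unfolding polyanalytic_sum_def by blast
    have "polyanalytic_sum n (d_zbar f)"
      unfolding polyanalytic_sum_def
      using g d_zbar_polyanalytic_sum[OF g f]
      by (intro exI[of _ "\<lambda>q z. of_nat (Suc q) * g (Suc q) z"] conjI) (auto intro!: holomorphic_intros simp del: of_nat_Suc)
    then show ?case using Suc.IH by (simp add: funpow_swap1)
  qed (auto simp: polyanalytic_sum_def)
  then show ?thesis using Ck_on_polyanalytic_sum[OF assms] by (simp add: n_analytic_on_def)
qed

lemma Ck_on_cong:
  assumes "open S" "\<And>z. z \<in> S \<Longrightarrow> f z = g z" "Ck_on k S f"
  shows "Ck_on k S g"
  using assms(2,3)
proof (induction k arbitrary: f g)
  case 0
  then show ?case using continuous_on_cong by force
next
  case (Suc k f g)
  have D: "g differentiable (at z)" if "z \<in> S" for z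
    using Suc.prems that assms(1) has_derivative_transform_within_open
    unfolding differentiable_def Ck_on.simps by metis
  have "frechet_derivative f (at z) v = frechet_derivative g (at z) v" if "z \<in> S" for z v
    by (subst frechet_derivative_transform_within_open[OF _ assms(1) that]) (use Suc.prems that in auto)
  then show ?case using Suc.IH[of "\<lambda>z. frechet_derivative f (at z) _" "\<lambda>z. frechet_derivative g (at z) _"] Suc.prems D
    by auto
qed

lemma Ck_on_lincomb:
  assumes "open S" "Ck_on k S f" "Ck_on k S g"
  shows "Ck_on k S (\<lambda>z. a * f z + b * g z)"
  using assms(2,3)
proof (induction k arbitrary: f g)
  case 0
  then show ?case by (auto intro!: continuous_intros)
next
  case (Suc k f g)
  have D: "((\<lambda>z. a * f z + b * g z) has_derivative (\<lambda>v. a * frechet_derivative f (at z) v + b * frechet_derivative g (at z) v)) (at z)"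
    if "z \<in> S" for z
    using Suc.prems that by (auto intro!: derivative_eq_intros simp: frechet_derivative_works)
  have "Ck_on k S (\<lambda>z. frechet_derivative (\<lambda>z. a * f z + b * g z) (at z) v)" for v
    by (rule Ck_on_cong[OF assms(1) _ Suc.IH[of "\<lambda>z. frechet_derivative f (at z) v" "\<lambda>z. frechet_derivative g (at z) v"]])
      (use Suc.prems frechet_derivative_eqI[OF D] in auto)
  then show ?case using D by (auto simp: differentiable_def)
qed

lemma Ck_on_d_zbar: "open S \<Longrightarrow> Ck_on (Suc k) S f \<Longrightarrow> Ck_on k S (d_zbar f)"
  unfolding d_zbar_def
  using Ck_on_lincomb[of S k "\<lambda>z. frechet_derivative f (at z) 1" "\<lambda>z. frechet_derivative f (at z) \<i>" "1/2" "\<i>/2"]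
  by (simp add: add_divide_distrib)

text \<open>The hypothesis is the Cauchy-Riemann equation \<open>f' \<i> = \<i> * f' 1\<close>,
  which makes the real-linear derivative multiplication by \<open>f' 1\<close>.\<close>

lemma d_zbar_zero_imp_field_derivative:
  assumes "(f has_derivative f') (at z)" "d_zbar f z = 0"
  shows "f field_differentiable (at z)"
proof -
  interpret f': bounded_linear f' by (rule has_derivative_bounded_linear[OF assms(1)])
  have "\<i> * (f' 1 + \<i> * f' \<i>) = 0" using d_zbar_has_derivative[OF assms(1)] assms(2) by simp
  then have i: "f' \<i> = \<i> * f' 1" 
    unfolding distrib_left by (simp add: mult.assoc[symmetric])
  have "f' v = f' 1 * v" for v
  proof -
    have "f' v = f' (Re v *\<^sub>R 1 + Im v *\<^sub>R \<i>)" by (simp add: scaleR_conv_of_real complex_eq[symmetric] mult.commute)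
    also have "\<dots> = of_real (Re v) * f' 1 + of_real (Im v) * (\<i> * f' 1)"
      by (simp only: f'.add f'.scaleR i) (simp add: scaleR_conv_of_real)
    also have "\<dots> = f' 1 * (of_real (Re v) + \<i> * of_real (Im v))" by (simp add: algebra_simps)
    finally show ?thesis by (simp add: complex_eq[symmetric])
  qed
  then have "f' = times (f' 1)" by (rule ext)
  with assms(1) have "(f has_field_derivative f' 1) (at z)" unfolding has_field_derivative_def by simp
  then show ?thesis unfolding field_differentiable_def by blast
qed

text \<open>Integration in \<open>cnj z\<close>: the induction hypothesis describes
  \<open>d_zbar f\<close>. Subtracting from \<open>f\<close> an explicit primitive of it leaves a
  function killed by \<open>d_zbar\<close>, that is, a holomorphic one.\<close>

lemma polyanalytic_sum_n_analytic_on: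
  assumes "n_analytic_on n (ball 0 1) f"
  shows "polyanalytic_sum n f"
  using assms
proof (induction n arbitrary: f)
  case 0
  then show ?case by (auto simp: n_analytic_on_def polyanalytic_sum_def)
next
  case (Suc n f)
  have "n_analytic_on n (ball 0 1) (d_zbar f)"
    using Suc.prems Ck_on_d_zbar[of "ball 0 1"] unfolding n_analytic_on_def by (simp add: funpow_swap1 del: Ck_on.simps)
  from Suc.IH[OF this] obtain g where g: "\<And>q. q < n \<Longrightarrow> g q holomorphic_on ball 0 1"
    and df: "\<And>z. z \<in> ball 0 1 \<Longrightarrow> d_zbar f z = (\<Sum>q<n. cnj z ^ q * g q z)"
    unfolding polyanalytic_sum_def by blast
  \<comment> \<open>The term \<open>cnj z ^ r * g r z\<close> has the primitive
    \<open>cnj z ^ Suc r * g r z / of_nat (Suc r)\<close>; hence the shift of the index and the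
    division.\<close>
  define G where "G q z = (case q of 0 \<Rightarrow> 0 | Suc r \<Rightarrow> g r z / of_nat (Suc r))" for q z
  define h where "h z = f z - (\<Sum>q<Suc n. cnj z ^ q * G q z)" for z
  have G: "G q holomorphic_on ball 0 1" if "q < Suc n" for q
    using that g by (cases q) (auto simp: G_def[abs_def] intro!: holomorphic_intros simp del: of_nat_Suc)
  have dF: "(\<lambda>z. \<Sum>q<Suc n. cnj z ^ q * G q z) differentiable (at z)" if "z \<in> ball 0 1" for z
    using polyanalytic_sum_has_derivative[of "Suc n" G "\<lambda>z. \<Sum>q<Suc n. cnj z ^ q * G q z", OF G refl that]
    unfolding differentiable_def by blast
  note ddF = d_zbar_polyanalytic_sum[of n G "\<lambda>z. \<Sum>q<Suc n. cnj z ^ q * G q z", OF G refl]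
  have "h field_differentiable (at z)" if z: "z \<in> ball 0 1" for z
  proof -
    have "Ck_on (Suc 0) (ball 0 1) f" using Suc.prems unfolding n_analytic_on_def by blast
    then have "f differentiable (at z)" using z by simp
    then have f: "(f has_derivative frechet_derivative f (at z)) (at z)" by (simp add: frechet_derivative_works)
    have "(h has_derivative (\<lambda>v. frechet_derivative f (at z) v - frechet_derivative (\<lambda>z. \<Sum>q<Suc n. cnj z ^ q * G q z) (at z) v)) (at z)"
      unfolding h_def
      by (rule has_derivative_diff[OF f dF[OF z, unfolded frechet_derivative_works]])
    moreover from d_zbar_has_derivative[OF this] have "d_zbar h z = d_zbar f z - d_zbar (\<lambda>z. \<Sum>q<Suc n. cnj z ^ q * G q z) z"
      by (simp add: d_zbar_def algebra_simps diff_divide_distrib add_divide_distrib)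
    then have "d_zbar h z = 0"
      using ddF[OF _ z] df[OF z] by (simp add: G_def del: of_nat_Suc)
    ultimately show ?thesis by (rule d_zbar_zero_imp_field_derivative)
  qed
  then have h: "h holomorphic_on ball 0 1"
    by (simp add: holomorphic_on_def field_differentiable_at_within)
  \<comment> \<open>The holomorphic remainder \<open>h\<close> is the coefficient of
    \<open>cnj z ^ 0\<close>, the place where \<open>G\<close> vanishes.\<close>
  show ?case unfolding polyanalytic_sum_def
  proof (intro exI[of _ "\<lambda>q z. G q z + (if q = 0 then h z else 0)"] conjI allI impI ballI)
    fix q assume "q < Suc n"
    then show "(\<lambda>z. G q z + (if q = 0 then h z else 0)) holomorphic_on ball 0 1"
      using G h by (cases "q = 0") (auto intro!: holomorphic_intros)
  next
    fix z :: complex assume "z \<in> ball 0 1"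
    have "(\<Sum>q<Suc n. cnj z ^ q * (if q = 0 then h z else 0)) = h z"
      by (subst sum.lessThan_Suc_shift) simp
    then show "f z = (\<Sum>q<Suc n. cnj z ^ q * (G q z + (if q = 0 then h z else 0)))"
      unfolding distrib_left sum.distrib h_def by simp
  qed
qed

section \<open>Power series coefficients and frequency blocks\<close>

lemma uniform_limit_sum:
  fixes f :: "'i \<Rightarrow> 'n \<Rightarrow> 'a \<Rightarrow> 'b::real_normed_vector"
  assumes "\<And>i. i \<in> I \<Longrightarrow> uniform_limit X (f i) (l i) F"
  shows "uniform_limit X (\<lambda>n x. \<Sum>i\<in>I. f i n x) (\<lambda>x. \<Sum>i\<in>I. l i x) F"
  using assms by (induction I rule: infinite_finite_induct) (auto intro!: uniform_limit_intros)

definition poly_series :: "nat \<Rightarrow> (nat \<Rightarrow> nat \<Rightarrow> complex) \<Rightarrow> complex \<Rightarrow> complex" where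
  "poly_series n a z = (\<Sum>q<n. cnj z ^ q * (\<Sum>m. a q m * z ^ m))"

text \<open>
  Blocks are numbered by \<open>k = \<xi> + n - 1\<close>, so that the term with \<open>cnj z ^ q\<close> in the block \<open>k\<close> has
  \<open>z\<close>-exponent \<open>q + \<xi> = q + k + 1 - n\<close>.
\<close>

definition poly_block :: "nat \<Rightarrow> (nat \<Rightarrow> nat \<Rightarrow> complex) \<Rightarrow> nat \<Rightarrow> complex \<Rightarrow> complex" where
  "poly_block n a k z = (\<Sum>q | q < n \<and> n \<le> q + k + 1. a q (q + k + 1 - n) * (z ^ (q + k + 1 - n) * cnj z ^ q))"

lemma n_analytic_on_obtain_series:
  assumes "n_analytic_on n (ball 0 1) f"
  obtains a where "\<And>q. q < n \<Longrightarrow> conv_radius (a q) \<ge> 1"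
    and "\<And>z. z \<in> ball 0 1 \<Longrightarrow> f z = poly_series n a z"
proof -
  from polyanalytic_sum_n_analytic_on[OF assms] obtain g where
    g: "\<And>q. q < n \<Longrightarrow> g q holomorphic_on ball 0 1"
    and f: "\<And>z. z \<in> ball 0 1 \<Longrightarrow> f z = (\<Sum>q<n. cnj z ^ q * g q z)"
    unfolding polyanalytic_sum_def by blast
  define a where "a q m = (deriv ^^ m) (g q) 0 / fact m" for q m
  have sums: "(\<lambda>m. a q m * z ^ m) sums g q z" if "q < n" "z \<in> ball 0 1" for q z
    using holomorphic_power_series[OF g[OF that(1)] that(2)] by (simp add: a_def)
  show ?thesis
  proof
    fix q assume q: "q < n"
    show "conv_radius (a q) \<ge> 1"
    proof (rule conv_radius_geI_ex')
      fix r :: real assume r: "0 < r" "ereal r < 1"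
      then show "summable (\<lambda>m. a q m * of_real r ^ m)"
        using sums[OF q, of "of_real r"] by (auto simp: sums_iff one_ereal_def)
    qed
  next
    fix z :: complex assume "z \<in> ball 0 1"
    then show "f z = poly_series n a z"
      using sums f by (simp add: poly_series_def sums_iff)
  qed
qed

lemma n_analytic_on_poly_series:
  assumes "\<And>q. q < n \<Longrightarrow> conv_radius (a q) \<ge> 1" and "\<And>z. z \<in> ball 0 1 \<Longrightarrow> f z = poly_series n a z"
  shows "n_analytic_on n (ball 0 1) f"
proof (rule n_analytic_on_polyanalytic_sum)
  have "(\<lambda>z. \<Sum>m. a q m * z ^ m) holomorphic_on ball 0 1" if "q < n" for q
    unfolding holomorphic_on_def field_differentiable_def
  proof
    fix z :: complex assume z: "z \<in> ball 0 1"
    then have "ereal (cmod z) < 1" by (simp add: one_ereal_def)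
    also have "1 \<le> conv_radius (a q)" by (rule assms(1)[OF that])
    finally have *: "ereal (cmod z) < conv_radius (a q)" .
    have "((\<lambda>z. \<Sum>m. a q m * z ^ m) has_field_derivative (\<Sum>m. diffs (a q) m * z ^ m)) (at z)"
      using has_field_derivative_powser[OF *] by simp
    then show "\<exists>f'. ((\<lambda>z. \<Sum>m. a q m * z ^ m) has_field_derivative f') (at z within ball 0 1)"
      using has_field_derivative_at_within by blast
  qed
  then show "polyanalytic_sum n f"
    unfolding polyanalytic_sum_def using assms(2)
    by (intro exI[of _ "\<lambda>q z. \<Sum>m. a q m * z ^ m"]) (auto simp: poly_series_def)
qed

text \<open>Blocks follow the diagonals on which p - q is constant, so the first \<open>N\<close> of
  them cut the power series attached to \<open>cnj z ^ q\<close> at a degree that shifts with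
  \<open>q\<close>.\<close>

lemma sum_poly_block:
  assumes "N \<ge> n"
  shows "(\<Sum>k<N. poly_block n a k z) = (\<Sum>q<n. cnj z ^ q * (\<Sum>m<N + q + 1 - n. a q m * z ^ m))"
proof -
  have "(\<Sum>k<N. poly_block n a k z) =
    (\<Sum>k<N. \<Sum>q<n. if n \<le> q + k + 1 then a q (q + k + 1 - n) * (z ^ (q + k + 1 - n) * cnj z ^ q) else 0)"
    unfolding poly_block_def by (intro sum.cong sum.mono_neutral_cong_left) auto
  also have "\<dots> = (\<Sum>q<n. \<Sum>k<N. if n \<le> q + k + 1 then a q (q + k + 1 - n) * (z ^ (q + k + 1 - n) * cnj z ^ q) else 0)"
    by (rule sum.swap)
  also have "\<dots> = (\<Sum>q<n. \<Sum>m<N + q + 1 - n. a q m * (z ^ m * cnj z ^ q))"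
  proof (rule sum.cong[OF refl])
    fix q assume q: "q \<in> {..<n}"
    show "(\<Sum>k<N. if n \<le> q + k + 1 then a q (q + k + 1 - n) * (z ^ (q + k + 1 - n) * cnj z ^ q) else 0)
      = (\<Sum>m<N + q + 1 - n. a q m * (z ^ m * cnj z ^ q))"
      unfolding sum.inter_filter[OF finite_lessThan, symmetric]
      by (rule sum.reindex_bij_witness[of _ "\<lambda>m. m + n - q - 1" "\<lambda>k. q + k + 1 - n"]) (use q assms in auto)
  qed
  finally show ?thesis by (simp add: sum_distrib_left mult_ac)
qed

lemma uniform_limit_poly_block:
  assumes a: "\<And>q. q < n \<Longrightarrow> conv_radius (a q) \<ge> 1" and R: "R < 1"
  shows "uniform_limit (cball 0 R) (\<lambda>N z. \<Sum>k<N. poly_block n a k z) (poly_series n a) sequentially"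
proof -
  have "uniform_limit (cball 0 R) (\<lambda>N z. \<Sum>q<n. cnj z ^ q * (\<Sum>m<N + q + 1 - n. a q m * z ^ m)) (poly_series n a) sequentially"
    unfolding poly_series_def
  proof (rule uniform_limit_sum)
    fix q assume "q \<in> {..<n}"
    then have q: "q < n" by simp
    have "ereal R < 1" using R by (simp add: one_ereal_def)
    also have "1 \<le> conv_radius (a q)" by (rule a[OF q])
    finally have R': "ereal R < conv_radius (a q)" .
    \<comment> \<open>The shifted truncation degrees still tend to infinity, so uniform convergence
      of the power series can be composed with them.\<close>
    have "filterlim (\<lambda>N. N + q + 1 - n) sequentially sequentially"
      unfolding filterlim_at_top
    proof
      fix Z show "\<forall>\<^sub>F N in sequentially. Z \<le> N + q + 1 - n"
        using eventually_ge_at_top[of "Z + n"] by eventually_elim simp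
    qed
    from filterlim_compose[OF powser_uniform_limit[OF R', of 0, unfolded] this]
    have lim: "uniform_limit (cball 0 R) (\<lambda>N z. \<Sum>m<N + q + 1 - n. a q m * z ^ m) (\<lambda>z. \<Sum>m. a q m * z ^ m) sequentially"
      by simp
    have "continuous_on (cball 0 R) (\<lambda>z. \<Sum>m. a q m * z ^ m)"
      using powser_continuous_suminf[OF R', of 0] by simp
    then have b1: "bounded ((\<lambda>z. \<Sum>m. a q m * z ^ m) ` cball 0 R)"
      by (intro compact_imp_bounded compact_continuous_image) auto
    have b2: "bounded ((\<lambda>z. cnj z ^ q) ` cball 0 R)"
      by (intro compact_imp_bounded compact_continuous_image) (auto intro!: continuous_intros)
    show "uniform_limit (cball 0 R) (\<lambda>N z. cnj z ^ q * (\<Sum>m<N + q + 1 - n. a q m * z ^ m)) (\<lambda>z. cnj z ^ q * (\<Sum>m. a q m * z ^ m)) sequentially"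
      by (rule uniform_lim_mult[OF uniform_limit_const lim b2 b1])
  qed
  then show ?thesis
    by (rule uniform_limit_cong[THEN iffD1, rotated 2])
      (auto simp: sum_poly_block intro!: eventually_mono[OF eventually_ge_at_top[of n]])
qed

section \<open>Disk polynomials\<close>

text \<open>Carries differentiability along with the value: \<open>d_z\<close> is built from
  \<open>frechet_derivative\<close>, which means nothing at points where the function is not
  differentiable. The product and sum rules can then be chained.\<close>

definition has_d_z :: "(complex \<Rightarrow> complex) \<Rightarrow> complex \<Rightarrow> complex \<Rightarrow> bool" where
  "has_d_z f a z \<longleftrightarrow> f differentiable (at z) \<and> d_z f z = a"

definition has_d_zbar :: "(complex \<Rightarrow> complex) \<Rightarrow> complex \<Rightarrow> complex \<Rightarrow> bool" where
  "has_d_zbar f a z \<longleftrightarrow> f differentiable (at z) \<and> d_zbar f z = a"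

lemma has_d_z_has_derivative:
  "(f has_derivative f') (at z) \<Longrightarrow> has_d_z f ((f' 1 - \<i> * f' \<i>) / 2) z"
  and has_d_zbar_has_derivative:
  "(f has_derivative f') (at z) \<Longrightarrow> has_d_zbar f ((f' 1 + \<i> * f' \<i>) / 2) z"
  by (auto simp: has_d_z_def has_d_zbar_def d_z_def d_zbar_def differentiable_def frechet_derivative_at[symmetric])

lemma has_d_zI: "(f has_derivative f') (at z) \<Longrightarrow> a = (f' 1 - \<i> * f' \<i>) / 2 \<Longrightarrow> has_d_z f a z"
  and has_d_zbarI: "(f has_derivative f') (at z) \<Longrightarrow> a = (f' 1 + \<i> * f' \<i>) / 2 \<Longrightarrow> has_d_zbar f a z"
  using has_d_z_has_derivative has_d_zbar_has_derivative by blast+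

lemma has_d_zD:
  assumes "has_d_z f a z"
  shows "(f has_derivative frechet_derivative f (at z)) (at z)"
    and "a = (frechet_derivative f (at z) 1 - \<i> * frechet_derivative f (at z) \<i>) / 2"
  using assms by (auto simp: has_d_z_def d_z_def frechet_derivative_works)

lemma has_d_zbarD:
  assumes "has_d_zbar f a z"
  shows "(f has_derivative frechet_derivative f (at z)) (at z)"
    and "a = (frechet_derivative f (at z) 1 + \<i> * frechet_derivative f (at z) \<i>) / 2"
  using assms by (auto simp: has_d_zbar_def d_zbar_def frechet_derivative_works)

lemma has_d_z_mult:
  assumes "has_d_z f a z" "has_d_z g b z"
  shows "has_d_z (\<lambda>w. f w * g w) (a * g z + f z * b) z"
  by (rule has_d_zI[OF has_derivative_mult[OF has_d_zD(1)[OF assms(1)] has_d_zD(1)[OF assms(2)]]],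
      simp only: has_d_zD(2)[OF assms(1)] has_d_zD(2)[OF assms(2)], simp add: field_simps)

lemma has_d_zbar_mult:
  assumes "has_d_zbar f a z" "has_d_zbar g b z"
  shows "has_d_zbar (\<lambda>w. f w * g w) (a * g z + f z * b) z"
  by (rule has_d_zbarI[OF has_derivative_mult[OF has_d_zbarD(1)[OF assms(1)] has_d_zbarD(1)[OF assms(2)]]],
      simp only: has_d_zbarD(2)[OF assms(1)] has_d_zbarD(2)[OF assms(2)], simp add: field_simps)

lemma has_d_z_add:
  assumes "has_d_z f a z" "has_d_z g b z"
  shows "has_d_z (\<lambda>w. f w + g w) (a + b) z"
  by (rule has_d_zI[OF has_derivative_add[OF has_d_zD(1)[OF assms(1)] has_d_zD(1)[OF assms(2)]]],
      simp only: has_d_zD(2)[OF assms(1)] has_d_zD(2)[OF assms(2)], simp add: field_simps)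

lemma has_d_z_const: "has_d_z (\<lambda>w. c) 0 z"
  and has_d_zbar_const: "has_d_zbar (\<lambda>w. c) 0 z"
  using has_d_z_has_derivative[OF has_derivative_const] has_d_zbar_has_derivative[OF has_derivative_const] by simp_all

lemma has_d_z_cmult: "has_d_z f a z \<Longrightarrow> has_d_z (\<lambda>w. c * f w) (c * a) z"
  and has_d_zbar_cmult: "has_d_zbar f a z \<Longrightarrow> has_d_zbar (\<lambda>w. c * f w) (c * a) z"
  using has_d_z_mult[OF has_d_z_const] has_d_zbar_mult[OF has_d_zbar_const] by force+

lemma has_d_z_sum:
  "(\<And>i. i \<in> I \<Longrightarrow> has_d_z (f i) (a i) z) \<Longrightarrow> has_d_z (\<lambda>w. \<Sum>i\<in>I. f i w) (\<Sum>i\<in>I. a i) z"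
  by (induction I rule: infinite_finite_induct) (auto intro: has_d_z_const has_d_z_add)

lemma has_d_z_transform:
  assumes "has_d_z f a z" "open S" "z \<in> S" "\<And>w. w \<in> S \<Longrightarrow> f w = g w"
  shows "has_d_z g a z"
  by (rule has_d_zI[OF has_derivative_transform_within_open[OF has_d_zD(1)[OF assms(1)] assms(2-4)] has_d_zD(2)[OF assms(1)]])

lemma has_d_zbar_transform:
  assumes "has_d_zbar f a z" "open S" "z \<in> S" "\<And>w. w \<in> S \<Longrightarrow> f w = g w"
  shows "has_d_zbar g a z"
  by (rule has_d_zbarI[OF has_derivative_transform_within_open[OF has_d_zbarD(1)[OF assms(1)] assms(2-4)] has_d_zbarD(2)[OF assms(1)]])

lemma has_d_z_power: "has_d_z (\<lambda>z. z ^ p) (of_nat p * z ^ (p - 1)) z"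
  and has_d_zbar_power: "has_d_zbar (\<lambda>z. z ^ p) 0 z"
proof -
  have "((\<lambda>z. z ^ p) has_derivative (\<lambda>v. of_nat p * v * z ^ (p - 1))) (at z)"
    by (rule has_derivative_power) (rule has_derivative_ident)
  from has_d_z_has_derivative[OF this] has_d_zbar_has_derivative[OF this]
  show "has_d_z (\<lambda>z. z ^ p) (of_nat p * z ^ (p - 1)) z" "has_d_zbar (\<lambda>z. z ^ p) 0 z"
    by (simp_all add: mult_ac)
qed

lemma has_d_z_cnj_power: "has_d_z (\<lambda>z. cnj z ^ p) 0 z"
proof -
  have "((\<lambda>z. cnj z ^ p) has_derivative (\<lambda>v. of_nat p * cnj v * cnj z ^ (p - 1))) (at z)"
    by (intro has_derivative_power bounded_linear_imp_has_derivative bounded_linear_cnj)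
  from has_d_z_has_derivative[OF this] show ?thesis by (simp add: mult_ac)
qed

section \<open>Powers of the weight and the explicit form of disk polynomials\<close>

definition disk_weight :: "complex \<Rightarrow> complex \<Rightarrow> complex" where
  "disk_weight \<beta> z = (1 - z * cnj z) powr \<beta>"

lemma one_minus_mult_cnj: "1 - z * cnj z = of_real (1 - (cmod z)\<^sup>2)"
  using complex_norm_square[of z] by simp

lemma one_minus_norm_sq_pos: "z \<in> ball 0 1 \<Longrightarrow> 1 - (cmod z)\<^sup>2 > (0::real)"
  by (simp add: abs_square_less_1)

lemma one_minus_mult_cnj_nonpos:
  assumes "z \<in> ball 0 1" shows "1 - z * cnj z \<notin> \<real>\<^sub>\<le>\<^sub>0" "1 - z * cnj z \<noteq> 0"
  unfolding one_minus_mult_cnj using one_minus_norm_sq_pos[OF assms]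
  by (auto simp del: of_real_diff simp: complex_nonpos_Reals_iff)

lemma disk_weight_has_derivative:
  assumes "z \<in> ball 0 1"
  shows "(disk_weight \<beta> has_derivative (\<lambda>v. - \<beta> * disk_weight (\<beta> - 1) z * (v * cnj z + z * cnj v))) (at z)"
proof -
  have "((\<lambda>z. 1 - z * cnj z) has_derivative (\<lambda>v. 0 - (z * cnj v + v * cnj z))) (at z)"
    by (intro has_derivative_diff has_derivative_mult has_derivative_const has_derivative_ident
        bounded_linear_imp_has_derivative bounded_linear_cnj)
  from has_derivative_compose[OF this has_field_derivative_powr[OF one_minus_mult_cnj_nonpos(1)[OF assms], of \<beta>, unfolded has_field_derivative_def]]
  show ?thesis unfolding disk_weight_def by (simp add: algebra_simps)
qed

lemma has_d_z_disk_weight: "z \<in> ball 0 1 \<Longrightarrow> has_d_z (disk_weight \<beta>) (- \<beta> * cnj z * disk_weight (\<beta> - 1) z) z"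
  and has_d_zbar_disk_weight: "z \<in> ball 0 1 \<Longrightarrow> has_d_zbar (disk_weight \<beta>) (- \<beta> * z * disk_weight (\<beta> - 1) z) z"
proof -
  assume z: "z \<in> ball 0 1"
  have i: "\<i> * \<i> = -1" by simp
  have "(- \<beta> * w * (1 * a + b * cnj 1)) - \<i> * (- \<beta> * w * (\<i> * a + b * cnj \<i>)) = 2 * (- \<beta> * a * w)"
    "(- \<beta> * w * (1 * a + b * cnj 1)) + \<i> * (- \<beta> * w * (\<i> * a + b * cnj \<i>)) = 2 * (- \<beta> * b * w)" for w a b
    unfolding complex_cnj_one complex_cnj_i using i by algebra+
  then show "has_d_z (disk_weight \<beta>) (- \<beta> * cnj z * disk_weight (\<beta> - 1) z) z"
    "has_d_zbar (disk_weight \<beta>) (- \<beta> * z * disk_weight (\<beta> - 1) z) z"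
    using has_d_z_has_derivative[OF disk_weight_has_derivative[OF z, of \<beta>]]
      has_d_zbar_has_derivative[OF disk_weight_has_derivative[OF z, of \<beta>]] by simp_all
qed

lemma disk_weight_mult:
  "z \<in> ball 0 1 \<Longrightarrow> disk_weight a z * disk_weight b z = disk_weight (a + b) z"
  by (simp add: disk_weight_def powr_add)

lemma disk_weight_of_nat:
  "z \<in> ball 0 1 \<Longrightarrow> disk_weight (of_nat k) z = (1 - z * cnj z) ^ k"
  using one_minus_mult_cnj_nonpos(2)[of z] by (simp add: disk_weight_def powr_nat')

definition falling :: "'a::comm_ring_1 \<Rightarrow> nat \<Rightarrow> 'a" where
  "falling x k = (\<Prod>i<k. x - of_nat i)"

lemma falling_0 [simp]: "falling x 0 = 1"
  and falling_Suc: "falling x (Suc k) = falling x k * (x - of_nat k)"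
  by (simp_all add: falling_def)

lemma falling_of_real: "falling (of_real x) k = of_real (falling x k)"
  by (simp add: falling_def)

text \<open>\<open>rGamma\<close> is used since \<open>x - real k + 1\<close> may be a pole of
  Gamma; there both sides vanish.\<close>

lemma falling_Gamma:
  assumes "x > -1"
  shows "falling x k = Gamma (x + 1) * rGamma (x - real k + 1)"
proof (induction k)
  case 0
  have "Gamma (x + 1) \<noteq> 0" using assms Gamma_real_pos[of "x + 1"] by linarith
  then show ?case by (simp add: rGamma_inverse_Gamma)
next
  case (Suc k)
  have "x - real (Suc k) + 1 = x - real k" by simp
  moreover have "Gamma (x + 1) * rGamma (x - real k + 1) * (x - real k) = Gamma (x + 1) * rGamma (x - real k)"
    by (subst (2) rGamma_plus1[symmetric]) (simp only: mult_ac)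
  ultimately show ?case unfolding falling_Suc Suc by simp
qed

lemma falling_of_nat:
  assumes "j \<le> p" shows "falling (real p) j = fact p / fact (p - j)"
  using assms
proof (induction j)
  case (Suc j)
  then have "p - j = Suc (p - Suc j)" by simp
  then have "(fact (p - j) :: real) = real (p - j) * fact (p - Suc j)" by (metis fact_Suc of_nat_fact of_nat_mult)
  moreover have "real (p - j) \<noteq> 0" using Suc.prems by simp
  ultimately have "fact p / fact (p - j) * real (p - j) = (fact p / fact (p - Suc j) :: real)" by simp
  then show ?case using Suc by (simp add: falling_Suc of_nat_diff)
qed simp

lemma falling_of_nat_eq_0: "j > p \<Longrightarrow> falling (of_nat p :: 'a::comm_ring_1) j = 0"
  unfolding falling_def by (intro prod_zero) auto

lemma d_zbar_funpow_disk_weight: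
  "z \<in> ball 0 1 \<Longrightarrow> (d_zbar ^^ p) (disk_weight \<beta>) z = (-1) ^ p * falling \<beta> p * z ^ p * disk_weight (\<beta> - of_nat p) z"
proof (induction p arbitrary: z)
  case (Suc p z)
  have "has_d_zbar (\<lambda>z. ((-1) ^ p * falling \<beta> p) * (z ^ p * disk_weight (\<beta> - of_nat p) z))
    (((-1) ^ p * falling \<beta> p) * (0 * disk_weight (\<beta> - of_nat p) z +
        z ^ p * (- (\<beta> - of_nat p) * z * disk_weight (\<beta> - of_nat p - 1) z))) z"
    by (intro has_d_zbar_cmult has_d_zbar_mult has_d_zbar_power has_d_zbar_disk_weight Suc.prems)
  from has_d_zbar_transform[OF this open_ball Suc.prems, of "(d_zbar ^^ p) (disk_weight \<beta>)"] Suc.IH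
  have "d_zbar ((d_zbar ^^ p) (disk_weight \<beta>)) z = (((-1) ^ p * falling \<beta> p) * (0 * disk_weight (\<beta> - of_nat p) z +
        z ^ p * (- (\<beta> - of_nat p) * z * disk_weight (\<beta> - of_nat p - 1) z)))"
    by (simp add: has_d_zbar_def mult.assoc)
  then show ?case by (simp add: falling_Suc algebra_simps)
qed simp

text \<open>Leibniz' rule, with \<open>A\<close> and \<open>B\<close> listing the successive
  derivatives of the two factors; Pascal's rule recombines the coefficients.\<close>

lemma d_z_funpow_mult:
  assumes A: "\<And>j z. z \<in> ball 0 1 \<Longrightarrow> has_d_z (A j) (A (Suc j) z) z"
    and B: "\<And>j z. z \<in> ball 0 1 \<Longrightarrow> has_d_z (B j) (B (Suc j) z) z"
    and f: "\<And>z. z \<in> ball 0 1 \<Longrightarrow> f z = A 0 z * B 0 z"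
  shows "z \<in> ball 0 1 \<Longrightarrow> (d_z ^^ q) f z = (\<Sum>i\<le>q. of_nat (q choose i) * (A i z * B (q - i) z))"
proof (induction q arbitrary: z)
  case (Suc q z)
  let ?D = "\<Sum>i\<le>q. of_nat (q choose i) * (A (Suc i) z * B (q - i) z + A i z * B (Suc (q - i)) z)"
  have "has_d_z (\<lambda>z. \<Sum>i\<le>q. of_nat (q choose i) * (A i z * B (q - i) z)) ?D z"
    by (intro has_d_z_sum has_d_z_cmult has_d_z_mult A B Suc.prems)
  from has_d_z_transform[OF this open_ball Suc.prems, of "(d_z ^^ q) f"] Suc.IH
  have "d_z ((d_z ^^ q) f) z = ?D" by (simp add: has_d_z_def)
  also have "?D = (\<Sum>i\<le>q. of_nat (q choose i) * (A (Suc i) z * B (q - i) z)) +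
     (\<Sum>i\<le>q. of_nat (q choose i) * (A i z * B (Suc q - i) z))"
    by (simp add: distrib_left sum.distrib Suc_diff_le)
  also have "(\<Sum>i\<le>q. of_nat (q choose i) * (A i z * B (Suc q - i) z)) =
    (\<Sum>i\<le>Suc q. of_nat (q choose i) * (A i z * B (Suc q - i) z))" by simp
  also have "\<dots> = A 0 z * B (Suc q) z + (\<Sum>i\<le>q. of_nat (q choose Suc i) * (A (Suc i) z * B (q - i) z))"
    by (subst sum.atMost_Suc_shift) simp
  also have "(\<Sum>i\<le>q. of_nat (q choose i) * (A (Suc i) z * B (q - i) z)) +
      (A 0 z * B (Suc q) z + (\<Sum>i\<le>q. of_nat (q choose Suc i) * (A (Suc i) z * B (q - i) z))) =
    (\<Sum>i\<le>Suc q. of_nat (Suc q choose i) * (A i z * B (Suc q - i) z))"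
    unfolding sum.atMost_Suc_shift[of "\<lambda>i. of_nat (Suc q choose i) * (A i z * B (Suc q - i) z)"]
    by (simp add: distrib_right sum.distrib)
  finally show ?case by simp
qed (simp add: f)

definition disk_poly_const :: "real \<Rightarrow> nat \<Rightarrow> nat \<Rightarrow> real" where
  "disk_poly_const \<alpha> p q = sqrt ((\<alpha> + real p + real q + 1) * Gamma (\<alpha> + real p + 1) * Gamma (\<alpha> + real q + 1) /
                    ((\<alpha> + 1) * fact p * fact q * (Gamma (\<alpha> + real p + real q + 1))\<^sup>2))"

text \<open>The coefficients in the mixed form of \<open>disk_poly_explicit\<close>, which is what
  Leibniz' rule produces. Each term of that form, paired with a monomial of the same frequency,
  integrates to a single Beta value.\<close>

definition disk_poly_coeff :: "real \<Rightarrow> nat \<Rightarrow> nat \<Rightarrow> nat \<Rightarrow> real" where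
  "disk_poly_coeff \<alpha> p q i = disk_poly_const \<alpha> p q * Gamma (\<alpha> + real p + real q + 1) * fact p * fact q * (-1) ^ i /
     (fact i * fact (p - i) * fact (q - i) * Gamma (real i + \<alpha> + 1))"

text \<open>The p-fold \<open>d_zbar\<close> turns the weight into a multiple of z^p times the
  weight with exponent q + \<alpha>. Leibniz' rule for the q-fold \<open>d_z\<close> then leaves a
  weight whose non-integral exponent is cancelled by the outer factor.\<close>

lemma disk_poly_explicit:
  assumes \<alpha>: "\<alpha> > -1" and z: "z \<in> ball 0 1"
  shows "disk_poly \<alpha> p q z =
    (\<Sum>i\<le>min p q. of_real (disk_poly_coeff \<alpha> p q i) * (z ^ (p - i) * cnj z ^ (q - i) * (1 - z * cnj z) ^ i))"
proof -
  define \<beta> :: complex where "\<beta> = of_real (real p + real q + \<alpha>)"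
  define \<gamma> :: complex where "\<gamma> = of_real (real q + \<alpha>)"
  have \<gamma>: "\<beta> - of_nat p = \<gamma>" by (simp add: \<beta>_def \<gamma>_def)
  \<comment> \<open>\<open>C\<close> collects the constants of the p-fold \<open>d_zbar\<close>.
    \<open>A\<close> lists the z-derivatives of \<open>C * z ^ p\<close>, and \<open>B\<close> those
    of the weight with exponent \<open>\<gamma>\<close>.\<close>
  define C where "C = (-1) ^ p * falling \<beta> p"
  define A where "A j z = C * falling (of_nat p) j * z ^ (p - j)" for j and z :: complex
  define B where "B k z = (-1) ^ k * falling \<gamma> k * (cnj z ^ k * disk_weight (\<gamma> - of_nat k) z)" for k and z :: complex
  have A: "has_d_z (A j) (A (Suc j) z) z" for j z
  proof -
    have "has_d_z (A j) (C * falling (of_nat p) j * (of_nat (p - j) * z ^ (p - j - 1))) z"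
      unfolding A_def by (intro has_d_z_cmult has_d_z_power)
    moreover have "falling (of_nat p) j * of_nat (p - j) = falling (of_nat p :: complex) (Suc j)"
      by (cases "j \<le> p") (auto simp: falling_Suc of_nat_diff falling_of_nat_eq_0)
    then have "C * (falling (of_nat p) j * of_nat (p - j)) * z ^ (p - j - 1) = A (Suc j) z"
      unfolding A_def by simp
    then have "C * falling (of_nat p) j * (of_nat (p - j) * z ^ (p - j - 1)) = A (Suc j) z"
      by (simp only: mult.assoc)
    ultimately show ?thesis by simp
  qed
  have B: "has_d_z (B k) (B (Suc k) z) z" if "z \<in> ball 0 1" for k z
  proof -
    have "has_d_z (B k) ((-1) ^ k * falling \<gamma> k * (0 * disk_weight (\<gamma> - of_nat k) z + cnj z ^ k *
      (- (\<gamma> - of_nat k) * cnj z * disk_weight (\<gamma> - of_nat k - 1) z))) z"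
      unfolding B_def by (intro has_d_z_cmult has_d_z_mult has_d_z_cnj_power has_d_z_disk_weight that)
    then show ?thesis unfolding B_def by (simp add: falling_Suc algebra_simps)
  qed
  have "(d_z ^^ q) ((d_zbar ^^ p) (disk_weight \<beta>)) z = (\<Sum>i\<le>q. of_nat (q choose i) * (A i z * B (q - i) z))"
  proof (rule d_z_funpow_mult[of A B])
    fix z :: complex assume "z \<in> ball 0 1"
    then show "(d_zbar ^^ p) (disk_weight \<beta>) z = A 0 z * B 0 z"
      by (simp add: A_def B_def C_def d_zbar_funpow_disk_weight \<gamma>)
  qed (use A B z in simp_all)
  \<comment> \<open>Differentiating z^p more than p times gives zero; formally, the falling
    factorial vanishes.\<close>
  also have "\<dots> = (\<Sum>i\<le>min p q. of_nat (q choose i) * (A i z * B (q - i) z))"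
    by (rule sum.mono_neutral_right) (auto simp: A_def falling_of_nat_eq_0)
  finally have *: "(d_z ^^ q) ((d_zbar ^^ p) (disk_weight \<beta>)) z = \<dots>" .
  have "disk_poly \<alpha> p q z = (-1) ^ (p + q) * of_real (disk_poly_const \<alpha> p q) * disk_weight (of_real (- \<alpha>)) z *
     (d_z ^^ q) ((d_zbar ^^ p) (disk_weight \<beta>)) z"
    using z by (simp only: disk_poly_def disk_poly_const_def on_disk_def disk_weight_def[abs_def] \<beta>_def if_True)
  also have "\<dots> = (\<Sum>i\<le>min p q. (-1) ^ (p + q) * of_real (disk_poly_const \<alpha> p q) * disk_weight (of_real (- \<alpha>)) z *
     (of_nat (q choose i) * (A i z * B (q - i) z)))"
    unfolding * by (simp add: sum_distrib_left)
  also have "\<dots> = (\<Sum>i\<le>min p q. of_real (disk_poly_coeff \<alpha> p q i) * (z ^ (p - i) * cnj z ^ (q - i) * (1 - z * cnj z) ^ i))"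
  proof (rule sum.cong[OF refl])
    fix i assume "i \<in> {..min p q}"
    then have i: "i \<le> p" "i \<le> q" by auto
    \<comment> \<open>The exponents -\<alpha> and \<gamma> - (q - i) add up to the natural number i,
      so the product is an ordinary power.\<close>
    have w: "disk_weight (of_real (- \<alpha>)) z * disk_weight (\<gamma> - of_nat (q - i)) z = (1 - z * cnj z) ^ i"
      using i by (simp add: disk_weight_mult[OF z] disk_weight_of_nat[OF z, symmetric] \<gamma>_def of_nat_diff)
    have f1: "falling \<beta> p = of_real (Gamma (\<alpha> + real p + real q + 1) * rGamma (real q + \<alpha> + 1))"
      using \<alpha> unfolding \<beta>_def falling_of_real by (subst falling_Gamma) (auto simp: algebra_simps)
    have f2: "falling \<gamma> (q - i) = of_real (Gamma (real q + \<alpha> + 1) * rGamma (real i + \<alpha> + 1))"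
      using \<alpha> i unfolding \<gamma>_def falling_of_real by (subst falling_Gamma) (auto simp: algebra_simps of_nat_diff)
    have f3: "falling (of_nat p :: complex) i = of_real (fact p / fact (p - i))"
      using falling_of_nat[OF i(1)] falling_of_real[of "real p" i, where ?'a=complex] by simp
    have G: "Gamma (real q + \<alpha> + 1) * rGamma (real q + \<alpha> + 1) = 1"
    proof -
      have "Gamma (real q + \<alpha> + 1) > 0" using \<alpha> by (intro Gamma_real_pos) linarith
      then show ?thesis by (simp add: rGamma_inverse_Gamma)
    qed
    have sgn: "(-1) ^ (p + q) * (-1) ^ p * (-1) ^ (q - i) = ((-1) ^ i :: complex)"
    proof -
      have "(-1) ^ (p + q) * (-1) ^ p * (-1) ^ (q - i) = ((-1) ^ (p + q + p + (q - i)) :: complex)" by (simp add: power_add)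
      also have "p + q + p + (q - i) = 2 * (p + (q - i)) + i" using i by simp
      also have "(-1) ^ (2 * (p + (q - i)) + i) = ((-1) ^ i :: complex)" by (simp add: power_add power_mult)
      finally show ?thesis .
    qed
    have "(-1) ^ (p + q) * of_real (disk_poly_const \<alpha> p q) * disk_weight (of_real (- \<alpha>)) z * (of_nat (q choose i) * (A i z * B (q - i) z))
      = ((-1) ^ (p + q) * (-1) ^ p * (-1) ^ (q - i)) * of_real (disk_poly_const \<alpha> p q) * of_nat (q choose i)
        * falling \<beta> p * falling (of_nat p) i * falling \<gamma> (q - i) * (z ^ (p - i) * cnj z ^ (q - i)
        * (disk_weight (of_real (- \<alpha>)) z * disk_weight (\<gamma> - of_nat (q - i)) z))"
      unfolding A_def B_def C_def by (simp only: mult_ac)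
    also have "\<dots> = of_real ((-1) ^ i * disk_poly_const \<alpha> p q * real (q choose i)
        * Gamma (\<alpha> + real p + real q + 1) * (fact p / fact (p - i)) * rGamma (real i + \<alpha> + 1)
        * (Gamma (real q + \<alpha> + 1) * rGamma (real q + \<alpha> + 1))) * (z ^ (p - i) * cnj z ^ (q - i) * (1 - z * cnj z) ^ i)"
      unfolding w sgn f1 f2 f3 by (simp add: mult_ac)
    also have "(-1) ^ i * disk_poly_const \<alpha> p q * real (q choose i)
        * Gamma (\<alpha> + real p + real q + 1) * (fact p / fact (p - i)) * rGamma (real i + \<alpha> + 1)
        * (Gamma (real q + \<alpha> + 1) * rGamma (real q + \<alpha> + 1)) = disk_poly_coeff \<alpha> p q i"
      unfolding G disk_poly_coeff_def using i
      by (simp add: rGamma_inverse_Gamma binomial_fact field_simps)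
    finally show "(-1) ^ (p + q) * of_real (disk_poly_const \<alpha> p q) * disk_weight (of_real (- \<alpha>)) z * (of_nat (q choose i) * (A i z * B (q - i) z))
      = of_real (disk_poly_coeff \<alpha> p q i) * (z ^ (p - i) * cnj z ^ (q - i) * (1 - z * cnj z) ^ i)" .
  qed
  finally show ?thesis .
qed

section \<open>Square integrable functions\<close>

lemma borel_measurable_cnj [measurable (raw)]:
  "f \<in> borel_measurable M \<Longrightarrow> (\<lambda>x. cnj (f x)) \<in> borel_measurable M"
  by (rule measurable_compose[OF _ borel_measurable_continuous_onI]) (auto intro: continuous_intros)

text \<open>Integrability of \<open>(cmod (f z))\<^sup>2\<close> yields measurability of the modulus
  only, so that of \<open>f\<close> is added. For members of \<open>polyanalytic_space\<close> it is
  recovered from their expansion in \<open>square_int_polyanalytic\<close>.\<close>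

definition square_int :: "real \<Rightarrow> (complex \<Rightarrow> complex) \<Rightarrow> bool" where
  "square_int \<alpha> f \<longleftrightarrow> f \<in> borel_measurable borel \<and> integrable (mu \<alpha>) (\<lambda>z. (cmod (f z))\<^sup>2)"

lemma square_int_measurable: "square_int \<alpha> f \<Longrightarrow> f \<in> borel_measurable borel"
  by (simp add: square_int_def)

lemma l2_prod_integrable:
  assumes "square_int \<alpha> f" "square_int \<alpha> g"
  shows "integrable (mu \<alpha>) (\<lambda>z. f z * cnj (g z))"
proof (rule Bochner_Integration.integrable_bound)
  show "integrable (mu \<alpha>) (\<lambda>z. (cmod (f z))\<^sup>2 + (cmod (g z))\<^sup>2)"
    using assms by (auto simp: square_int_def)
  have [measurable]: "f \<in> borel_measurable borel" "g \<in> borel_measurable borel"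
    using assms by (auto simp: square_int_def)
  show "(\<lambda>z. f z * cnj (g z)) \<in> borel_measurable (mu \<alpha>)" by simp
  have "x * y \<le> x\<^sup>2 + y\<^sup>2" for x y :: real
    using sum_squares_bound[of x y] zero_le_power2[of x] zero_le_power2[of y] by linarith
  then show "AE z in mu \<alpha>. norm (f z * cnj (g z)) \<le> norm ((cmod (f z))\<^sup>2 + (cmod (g z))\<^sup>2)"
    by (simp add: norm_mult)
qed

lemma square_int_fscale: "square_int \<alpha> f \<Longrightarrow> square_int \<alpha> (fscale c f)"
  by (auto simp: square_int_def fscale_def norm_mult power_mult_distrib)

lemma square_int_add:
  assumes "square_int \<alpha> f" "square_int \<alpha> g"
  shows "square_int \<alpha> (f + g)"
  unfolding square_int_def
proof
  have [measurable]: "f \<in> borel_measurable borel" "g \<in> borel_measurable borel"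
    using assms by (auto simp: square_int_def)
  show "f + g \<in> borel_measurable borel" unfolding plus_fun_def by measurable
  show "integrable (mu \<alpha>) (\<lambda>z. (cmod ((f + g) z))\<^sup>2)"
  proof (rule Bochner_Integration.integrable_bound)
    show "integrable (mu \<alpha>) (\<lambda>z. 2 * (cmod (f z))\<^sup>2 + 2 * (cmod (g z))\<^sup>2)"
      using assms by (auto simp: square_int_def)
    show "(\<lambda>z. (cmod ((f + g) z))\<^sup>2) \<in> borel_measurable (mu \<alpha>)" unfolding plus_fun_def by simp
    have "(cmod (a + b))\<^sup>2 \<le> 2 * (cmod a)\<^sup>2 + 2 * (cmod b)\<^sup>2" for a b
    proof -
      have "(cmod (a + b))\<^sup>2 \<le> (cmod a + cmod b)\<^sup>2" by (intro power_mono norm_triangle_ineq) auto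
      also have "\<dots> \<le> 2 * (cmod a)\<^sup>2 + 2 * (cmod b)\<^sup>2"
        using sum_squares_bound[of "cmod a" "cmod b"] by (simp add: power2_sum)
      finally show ?thesis .
    qed
    then show "AE z in mu \<alpha>. norm ((cmod ((f + g) z))\<^sup>2) \<le> norm (2 * (cmod (f z))\<^sup>2 + 2 * (cmod (g z))\<^sup>2)"
      by simp
  qed
qed

lemma square_int_zero: "square_int \<alpha> 0"
  by (simp add: square_int_def zero_fun_def)

lemma square_int_sum: "(\<And>i. i \<in> I \<Longrightarrow> square_int \<alpha> (f i)) \<Longrightarrow> square_int \<alpha> (\<Sum>i\<in>I. f i)"
  by (induction I rule: infinite_finite_induct) (auto intro: square_int_zero square_int_add)

lemma l2_ip_add_left:
  "square_int \<alpha> f \<Longrightarrow> square_int \<alpha> g \<Longrightarrow> square_int \<alpha> h \<Longrightarrow> l2_ip \<alpha> (f + g) h = l2_ip \<alpha> f h + l2_ip \<alpha> g h"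
  using l2_prod_integrable[of \<alpha> f h] l2_prod_integrable[of \<alpha> g h]
  by (simp add: l2_ip_def distrib_right)

lemma l2_ip_fscale_left: "l2_ip \<alpha> (fscale c f) h = c * l2_ip \<alpha> f h"
  by (simp add: l2_ip_def fscale_def mult.assoc)

lemma l2_ip_commute: "l2_ip \<alpha> g f = cnj (l2_ip \<alpha> f g)"
  unfolding l2_ip_def by (subst Bochner_Integration.integral_cnj[symmetric]) (simp add: mult.commute)

lemma l2_ip_add_right:
  "square_int \<alpha> f \<Longrightarrow> square_int \<alpha> g \<Longrightarrow> square_int \<alpha> h \<Longrightarrow> l2_ip \<alpha> h (f + g) = l2_ip \<alpha> h f + l2_ip \<alpha> h g"
  using l2_ip_add_left[of \<alpha> f g h] by (metis complex_cnj_add l2_ip_commute)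

lemma l2_ip_fscale_right: "l2_ip \<alpha> h (fscale c f) = cnj c * l2_ip \<alpha> h f"
  using l2_ip_fscale_left[of \<alpha> c f h] by (metis complex_cnj_mult l2_ip_commute)

lemma l2_ip_zero_left [simp]: "l2_ip \<alpha> 0 h = 0"
  and l2_ip_zero_right [simp]: "l2_ip \<alpha> h 0 = 0"
  by (simp_all add: l2_ip_def)

lemma l2_ip_sum_left:
  "(\<And>i. i \<in> I \<Longrightarrow> square_int \<alpha> (f i)) \<Longrightarrow> square_int \<alpha> h \<Longrightarrow> l2_ip \<alpha> (\<Sum>i\<in>I. f i) h = (\<Sum>i\<in>I. l2_ip \<alpha> (f i) h)"
  by (induction I rule: infinite_finite_induct) (auto simp: l2_ip_add_left square_int_sum)

lemma l2_ip_sum_right: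
  "(\<And>i. i \<in> I \<Longrightarrow> square_int \<alpha> (f i)) \<Longrightarrow> square_int \<alpha> h \<Longrightarrow> l2_ip \<alpha> h (\<Sum>i\<in>I. f i) = (\<Sum>i\<in>I. l2_ip \<alpha> h (f i))"
  by (induction I rule: infinite_finite_induct) (auto simp: l2_ip_add_right square_int_sum)

lemma l2_ip_self: "l2_ip \<alpha> f f = of_real (LINT z|mu \<alpha>. (cmod (f z))\<^sup>2)"
  unfolding l2_ip_def by (subst integral_complex_of_real[symmetric]) (simp only: complex_norm_square)

lemma l2_ip_nonneg: "Re (l2_ip \<alpha> f f) \<ge> 0"
  by (simp add: l2_ip_self)

lemma sum_fun_apply: "(\<Sum>i\<in>I. f i) x = (\<Sum>i\<in>I. f i x)"
  by (induction I rule: infinite_finite_induct) auto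

lemma square_int_bounded:
  assumes "\<alpha> > -1" and [measurable]: "f \<in> borel_measurable borel" and "\<And>z. z \<in> ball 0 1 \<Longrightarrow> cmod (f z) \<le> C"
  shows "square_int \<alpha> f"
  unfolding square_int_def
proof
  interpret finite_measure "mu \<alpha>" by (rule finite_measure_mu[OF assms(1)])
  show "integrable (mu \<alpha>) (\<lambda>z. (cmod (f z))\<^sup>2)"
  proof (rule integrable_const_bound)
    show "AE z in mu \<alpha>. norm ((cmod (f z))\<^sup>2) \<le> C\<^sup>2"
      using AE_mu_ball by eventually_elim (auto intro!: power_mono assms(3))
  qed simp
qed fact

section \<open>Disk polynomials in terms of monomials\<close>

lemma measurable_on_disk: "f \<in> borel_measurable borel \<Longrightarrow> on_disk f \<in> borel_measurable borel"
  unfolding on_disk_def by (rule measurable_If_set) auto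

lemma monomial_measurable [measurable]: "monomial p q \<in> borel_measurable borel"
  unfolding monomial_def by (intro measurable_on_disk) measurable

lemma norm_monomial_le: "cmod (monomial p q z) \<le> 1"
  by (auto simp: monomial_def on_disk_def norm_mult norm_power power_le_one intro!: mult_le_one)

lemma square_int_monomial: "\<alpha> > -1 \<Longrightarrow> square_int \<alpha> (monomial p q)"
  by (rule square_int_bounded[where C=1]) (auto simp: norm_monomial_le)

definition disk_term :: "nat \<Rightarrow> nat \<Rightarrow> nat \<Rightarrow> complex \<Rightarrow> complex" where
  "disk_term p q i = on_disk (\<lambda>z. z ^ (p - i) * cnj z ^ (q - i) * (1 - z * cnj z) ^ i)"

lemma disk_poly_eq_sum_disk_term:
  assumes "\<alpha> > -1"
  shows "disk_poly \<alpha> p q = (\<Sum>i\<le>min p q. fscale (of_real (disk_poly_coeff \<alpha> p q i)) (disk_term p q i))"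
proof
  fix z
  show "disk_poly \<alpha> p q z = (\<Sum>i\<le>min p q. fscale (of_real (disk_poly_coeff \<alpha> p q i)) (disk_term p q i)) z"
  proof (cases "z \<in> ball 0 1")
    case True
    then show ?thesis
      unfolding disk_poly_explicit[OF assms True] sum_fun_apply fscale_def by (simp add: disk_term_def on_disk_def)
  next
    case False
    then have "disk_poly \<alpha> p q z = 0" by (simp add: disk_poly_def on_disk_def)
    with False show ?thesis unfolding sum_fun_apply fscale_def by (simp add: disk_term_def on_disk_def)
  qed
qed

lemma disk_term_eq_sum_monomial:
  assumes "i \<le> p" "i \<le> q"
  shows "disk_term p q i = (\<Sum>j\<le>i. fscale (of_real (real (i choose j) * (-1) ^ (i - j))) (monomial (p - j) (q - j)))"
proof
  fix z
  have "(1 - z * cnj z) ^ i = (\<Sum>j\<le>i. of_nat (i choose j) * 1 ^ j * (- (z * cnj z)) ^ (i - j))"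
    using binomial_ring[of 1 "- (z * cnj z)" i] by simp
  then have "z ^ (p - i) * cnj z ^ (q - i) * (1 - z * cnj z) ^ i =
    (\<Sum>j\<le>i. of_real (real (i choose j) * (-1) ^ (i - j)) * ((z ^ (p - i) * z ^ (i - j)) * (cnj z ^ (q - i) * cnj z ^ (i - j))))"
    by (simp add: sum_distrib_left power_minus[of "z * cnj z"] power_mult_distrib mult_ac)
  also have "\<dots> = (\<Sum>j\<le>i. of_real (real (i choose j) * (-1) ^ (i - j)) * (z ^ (p - j) * cnj z ^ (q - j)))"
    using assms by (intro sum.cong refl) (simp add: power_add[symmetric])
  finally show "disk_term p q i z = (\<Sum>j\<le>i. fscale (of_real (real (i choose j) * (-1) ^ (i - j))) (monomial (p - j) (q - j))) z"
    unfolding sum_fun_apply fscale_def by (simp add: disk_term_def monomial_def on_disk_def)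
qed

text \<open>The coefficient of \<open>monomial (p - j) (q - j)\<close> in the disk polynomial;
  \<open>j = 0\<close> is the leading one.\<close>

definition disk_poly_monomial_coeff :: "real \<Rightarrow> nat \<Rightarrow> nat \<Rightarrow> nat \<Rightarrow> real" where
  "disk_poly_monomial_coeff \<alpha> p q j =
     (\<Sum>i\<in>{j..min p q}. disk_poly_coeff \<alpha> p q i * (real (i choose j) * (-1) ^ (i - j)))"

lemma fscale_sum: "fscale c (\<Sum>i\<in>I. f i) = (\<Sum>i\<in>I. fscale c (f i))"
  by (rule cfun.scale_sum_right)

lemma fscale_fscale: "fscale a (fscale b f) = fscale (a * b) f"
  by (rule cfun.scale_scale)

lemma disk_poly_eq_sum_monomial:
  assumes "\<alpha> > -1"
  shows "disk_poly \<alpha> p q = (\<Sum>j\<le>min p q. fscale (of_real (disk_poly_monomial_coeff \<alpha> p q j)) (monomial (p - j) (q - j)))"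
proof -
  have "disk_poly \<alpha> p q = (\<Sum>i\<le>min p q. \<Sum>j\<le>i. fscale (of_real (disk_poly_coeff \<alpha> p q i * (real (i choose j) * (-1) ^ (i - j)))) (monomial (p - j) (q - j)))"
    unfolding disk_poly_eq_sum_disk_term[OF assms]
    by (intro sum.cong refl) (simp add: disk_term_eq_sum_monomial fscale_sum fscale_fscale)
  also have "\<dots> = (\<Sum>j\<le>min p q. \<Sum>i\<in>{j..min p q}. fscale (of_real (disk_poly_coeff \<alpha> p q i * (real (i choose j) * (-1) ^ (i - j)))) (monomial (p - j) (q - j)))"
  proof -
    let ?g = "\<lambda>i j. fscale (of_real (disk_poly_coeff \<alpha> p q i * (real (i choose j) * (-1) ^ (i - j)))) (monomial (p - j) (q - j))"
    let ?M = "min p q"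
    have "(\<Sum>i\<le>?M. sum (?g i) {..i}) = (\<Sum>i\<le>?M. sum (?g i) {j \<in> {..?M}. j \<le> i})"
      by (intro sum.cong) auto
    also have "\<dots> = (\<Sum>j\<le>?M. sum (\<lambda>i. ?g i j) {i \<in> {..?M}. j \<le> i})"
      by (rule sum.swap_restrict) auto
    also have "\<dots> = (\<Sum>j\<le>?M. sum (\<lambda>i. ?g i j) {j..?M})"
      by (intro sum.cong) auto
    finally show ?thesis .
  qed
  finally show ?thesis
    by (simp add: disk_poly_monomial_coeff_def cfun.scale_sum_left)
qed

lemma square_int_disk_poly: "\<alpha> > -1 \<Longrightarrow> square_int \<alpha> (disk_poly \<alpha> p q)"
  by (simp add: disk_poly_eq_sum_monomial square_int_sum square_int_fscale square_int_monomial)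

lemma square_int_disk_term: "\<alpha> > -1 \<Longrightarrow> i \<le> p \<Longrightarrow> i \<le> q \<Longrightarrow> square_int \<alpha> (disk_term p q i)"
  by (simp add: disk_term_eq_sum_monomial square_int_sum square_int_fscale square_int_monomial)

text \<open>Equal frequencies make the integrand a function of the modulus, so that
  \<open>integral_mu_radial_power\<close> applies.\<close>

lemma l2_ip_disk_term_monomial:
  assumes "\<alpha> > -1" "p + q' = p' + q" "i \<le> p" "i \<le> q"
  shows "l2_ip \<alpha> (disk_term p q i) (monomial p' q') = of_real ((\<alpha> + 1) * Beta (real (p + q' - i) + 1) (real i + \<alpha> + 1))"
proof -
  have "disk_term p q i z * cnj (monomial p' q' z) = of_real (((cmod z)\<^sup>2) ^ (p + q' - i) * (1 - (cmod z)\<^sup>2) ^ i)"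
    if "z \<in> ball 0 1" for z
  proof -
    have e: "p - i + q' = p + q' - i" "q - i + p' = p + q' - i" using assms by auto
    have "disk_term p q i z * cnj (monomial p' q' z) = (z ^ (p - i) * z ^ q') * (cnj z ^ (q - i) * cnj z ^ p') * (1 - z * cnj z) ^ i"
      using that by (simp add: disk_term_def monomial_def on_disk_def mult_ac)
    also have "\<dots> = (z * cnj z) ^ (p + q' - i) * (1 - z * cnj z) ^ i"
      unfolding power_add[symmetric] e by (simp add: power_mult_distrib)
    finally show ?thesis by (simp add: complex_norm_square[symmetric])
  qed
  note eq = this
  have [measurable]: "disk_term p q i \<in> borel_measurable borel"
    by (rule square_int_measurable[OF square_int_disk_term[OF assms(1,3,4)]])
  have "AE z in mu \<alpha>. disk_term p q i z * cnj (monomial p' q' z) = of_real (((cmod z)\<^sup>2) ^ (p + q' - i) * (1 - (cmod z)\<^sup>2) ^ i)"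
    using AE_mu_ball by eventually_elim (rule eq)
  then have "l2_ip \<alpha> (disk_term p q i) (monomial p' q') = (LINT z|mu \<alpha>. of_real (((cmod z)\<^sup>2) ^ (p + q' - i) * (1 - (cmod z)\<^sup>2) ^ i))"
    unfolding l2_ip_def by (intro integral_cong_AE) (simp_all del: of_real_mult)
  also have "\<dots> = of_real ((\<alpha> + 1) * Beta (real (p + q' - i) + 1) (real i + \<alpha> + 1))"
    by (simp only: integral_complex_of_real integral_mu_radial_power(2)[OF assms(1)])
  finally show ?thesis .
qed

section \<open>Orthonormality of the disk polynomials\<close>

text \<open>This is the q-th backward difference of \<open>m choose k\<close> in the variable m.
  Pascal's rule for \<open>Suc q choose i\<close> splits the sum into the instances for m and m -
  1.\<close>

lemma alternating_sum_binomial: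
  "q \<le> m \<Longrightarrow> (\<Sum>i\<le>q. (-1) ^ i * of_nat (q choose i) * of_nat ((m - i) choose k)) =
     (if k < q then 0 else of_nat ((m - q) choose (k - q)) :: 'a::comm_ring_1)"
proof (induction q arbitrary: m)
  case (Suc q m)
  let ?t = "\<lambda>m i. (-1) ^ i * of_nat (q choose i) * of_nat ((m - i) choose k) :: 'a"
  have "(\<Sum>i\<le>Suc q. (-1) ^ i * of_nat (Suc q choose i) * of_nat ((m - i) choose k) :: 'a)
    = of_nat (m choose k) + (\<Sum>i\<le>q. (-1) ^ Suc i * of_nat (q choose Suc i) * of_nat ((m - Suc i) choose k))
      + (\<Sum>i\<le>q. (-1) ^ Suc i * of_nat (q choose i) * of_nat ((m - Suc i) choose k))"
    by (subst sum.atMost_Suc_shift) (simp del: power_Suc add: distrib_left distrib_right sum.distrib add_ac)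
  also have "of_nat (m choose k) + (\<Sum>i\<le>q. (-1) ^ Suc i * of_nat (q choose Suc i) * of_nat ((m - Suc i) choose k)) = (\<Sum>i\<le>Suc q. ?t m i)"
    by (subst sum.atMost_Suc_shift) simp
  also have "\<dots> = (\<Sum>i\<le>q. ?t m i)" by (simp add: binomial_eq_0)
  also have "\<dots> = (if k < q then 0 else of_nat ((m - q) choose (k - q)))"
    using Suc by simp
  also have "(\<Sum>i\<le>q. (-1) ^ Suc i * of_nat (q choose i) * of_nat ((m - Suc i) choose k)) = - (\<Sum>i\<le>q. ?t (m - 1) i)"
    by (simp add: sum_negf)
  also have "(\<Sum>i\<le>q. ?t (m - 1) i) = (if k < q then 0 else of_nat ((m - 1 - q) choose (k - q)))"
    using Suc.prems by (intro Suc.IH) simp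
  also have "(if k < q then 0 else of_nat ((m - q) choose (k - q))) + - (if k < q then 0 else of_nat ((m - 1 - q) choose (k - q)))
    = (if k < Suc q then 0 else of_nat ((m - Suc q) choose (k - Suc q)) :: 'a)"
  proof -
    obtain r where r: "m - q = Suc r" using Suc.prems by (cases "m - q") auto
    then have r': "m - 1 - q = r" "m - Suc q = r" by auto
    consider "k < q" | "k = q" | s where "k - q = Suc s" "k > q" by (cases "k - q") (auto, linarith)
    then show ?thesis
    proof cases
      case 3
      then have "k - Suc q = s" by simp
      with 3 show ?thesis unfolding r r' by simp
    qed (simp_all add: r r')
  qed
  finally show ?case .
qed simp

text \<open>Up to a constant, the sum is a q-th difference of a polynomial of degree q', which is
  zero for q' < q and constant for q' = q.\<close>

lemma alternating_sum_fact:
  assumes "p + q' = p' + q" "q' \<le> q"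
  shows "(\<Sum>i\<le>min p q. (-1) ^ i * fact (p + q' - i) / (fact i * fact (p - i) * fact (q - i)) :: real) = (if q' = q then 1 else 0)"
proof -
  \<comment> \<open>The case q \<le> p. The other one follows by exchanging p with q and p' with q',
    which leaves the sum unchanged because p + q' = p' + q.\<close>
  have main: "(\<Sum>i\<le>min p q. (-1) ^ i * fact (p + q' - i) / (fact i * fact (p - i) * fact (q - i)) :: real) = (if q' = q then 1 else 0)"
    if "p + q' = p' + q" "q' \<le> q" "q \<le> p" for p q p' q' :: nat
  proof -
    have "(\<Sum>i\<le>min p q. (-1) ^ i * fact (p + q' - i) / (fact i * fact (p - i) * fact (q - i)) :: real)
      = (\<Sum>i\<le>q. fact q' / fact q * ((-1) ^ i * real (q choose i) * real ((p + q' - i) choose q')))"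
    proof (rule sum.cong)
      show "{..min p q} = {..q}" using that by auto
      fix i assume "i \<in> {..q}"
      then have i: "i \<le> q" "i \<le> p" using that by auto
      have "p + q' - i - q' = p - i" by simp
      moreover have "q' \<le> p + q' - i" using i by simp
      ultimately have c: "real ((p + q' - i) choose q') = fact (p + q' - i) / (fact q' * fact (p - i))"
        using binomial_fact[of q' "p + q' - i", where ?'a=real] by simp
      show "(-1) ^ i * fact (p + q' - i) / (fact i * fact (p - i) * fact (q - i)) =
          fact q' / fact q * ((-1) ^ i * real (q choose i) * real ((p + q' - i) choose q'))"
        unfolding c binomial_fact[OF i(1), where ?'a=real] by simp
    qed
    also have "\<dots> = fact q' / fact q * (if q' < q then 0 else real ((p + q' - q) choose (q' - q)))"
      unfolding sum_distrib_left[symmetric] using that by (subst alternating_sum_binomial) auto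
    also have "\<dots> = (if q' = q then 1 else 0)" using that by auto
    finally show ?thesis .
  qed
  show ?thesis
  proof (cases "q \<le> p")
    case False
    have "(\<Sum>i\<le>min q p. (-1) ^ i * fact (q + p' - i) / (fact i * fact (q - i) * fact (p - i)) :: real) = (if p' = p then 1 else 0)"
      by (rule main[where p=q and q=p and p'=q' and q'=p']) (use assms False in auto)
    moreover have "q + p' = p + q'" "p' = p \<longleftrightarrow> q' = q" using assms by auto
    ultimately show ?thesis by (simp add: min.commute mult_ac)
  qed (use assms main in auto)
qed

lemma disk_poly_const_pos: "\<alpha> > -1 \<Longrightarrow> disk_poly_const \<alpha> p q > 0"
  unfolding disk_poly_const_def by (intro real_sqrt_gt_zero divide_pos_pos mult_pos_pos zero_less_power Gamma_real_pos) auto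

text \<open>In each Beta value the factor \<open>Gamma (real i + \<alpha> + 1)\<close> cancels
  against \<open>disk_poly_coeff\<close>, and the Gamma value in the denominator is independent of
  \<open>i\<close>. What remains is \<open>alternating_sum_fact\<close>.\<close>

lemma l2_ip_disk_poly_monomial:
  assumes \<alpha>: "\<alpha> > -1" and "p + q' = p' + q" "q' \<le> q"
  shows "l2_ip \<alpha> (disk_poly \<alpha> p q) (monomial p' q') = of_real (if q' = q then
    (\<alpha> + 1) * disk_poly_const \<alpha> p q * fact p * fact q / (\<alpha> + real p + real q + 1) else 0)"
proof -
  let ?K = "disk_poly_const \<alpha> p q * Gamma (\<alpha> + real p + real q + 1) * fact p * fact q"
  have "l2_ip \<alpha> (disk_poly \<alpha> p q) (monomial p' q') = (\<Sum>i\<le>min p q. of_real (disk_poly_coeff \<alpha> p q i * ((\<alpha> + 1) * Beta (real (p + q' - i) + 1) (real i + \<alpha> + 1))))"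
    unfolding disk_poly_eq_sum_disk_term[OF \<alpha>]
    by (subst l2_ip_sum_left)
      (auto simp: l2_ip_fscale_left l2_ip_disk_term_monomial[OF \<alpha> assms(2)] square_int_fscale square_int_disk_term square_int_monomial \<alpha>)
  also have "\<dots> = of_real (\<Sum>i\<le>min p q. disk_poly_coeff \<alpha> p q i * ((\<alpha> + 1) * Beta (real (p + q' - i) + 1) (real i + \<alpha> + 1)))"
    by simp
  also have "(\<Sum>i\<le>min p q. disk_poly_coeff \<alpha> p q i * ((\<alpha> + 1) * Beta (real (p + q' - i) + 1) (real i + \<alpha> + 1))) =
    (\<Sum>i\<le>min p q. ?K * (\<alpha> + 1) / Gamma (real p + real q' + \<alpha> + 2) * ((-1) ^ i * fact (p + q' - i) / (fact i * fact (p - i) * fact (q - i))))"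
  proof (intro sum.cong refl)
    fix i assume i: "i \<in> {..min p q}"
    have G: "Gamma (real (p + q' - i) + 1) = fact (p + q' - i)" by (subst Gamma_fact[symmetric]) (simp add: add.commute)
    have sum: "real (p + q' - i) + 1 + (real i + \<alpha> + 1) = real p + real q' + \<alpha> + 2" using i by (simp add: of_nat_diff)
    have "Gamma (real i + \<alpha> + 1) > 0" using \<alpha> by (intro Gamma_real_pos) linarith
    then show "disk_poly_coeff \<alpha> p q i * ((\<alpha> + 1) * Beta (real (p + q' - i) + 1) (real i + \<alpha> + 1)) =
        ?K * (\<alpha> + 1) / Gamma (real p + real q' + \<alpha> + 2) * ((-1) ^ i * fact (p + q' - i) / (fact i * fact (p - i) * fact (q - i)))"
      unfolding Beta_def disk_poly_coeff_def G sum by (simp add: mult_ac)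
  qed
  also have "\<dots> = ?K * (\<alpha> + 1) / Gamma (real p + real q' + \<alpha> + 2) * (if q' = q then 1 else 0)"
    unfolding sum_distrib_left[symmetric] alternating_sum_fact[OF assms(2,3)] ..
  also have "\<dots> = (if q' = q then (\<alpha> + 1) * disk_poly_const \<alpha> p q * fact p * fact q / (\<alpha> + real p + real q + 1) else 0)"
  proof -
    have pos: "\<alpha> + real p + real q + 1 > 0" "Gamma (\<alpha> + real p + real q + 1) > 0" using \<alpha> by (auto intro!: Gamma_real_pos)
    have *: "Gamma (\<alpha> + real p + real q + 1 + 1) = (\<alpha> + real p + real q + 1) * Gamma (\<alpha> + real p + real q + 1)"
      using pos by (intro Gamma_plus1) (auto elim!: nonpos_Ints_cases)
    have sum: "real p + real q + \<alpha> + 2 = \<alpha> + real p + real q + 1 + 1" by simp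
    have "Gamma (real p + real q + \<alpha> + 2) = (\<alpha> + real p + real q + 1) * Gamma (\<alpha> + real p + real q + 1)"
      unfolding sum by (rule *)
    then show ?thesis using pos[THEN less_imp_neq, THEN not_sym] by (cases "q' = q") simp_all
  qed
  finally show ?thesis .
qed

text \<open>For j = 0 the two signs \<open>(-1) ^ i\<close> cancel, and the positive sum that
  remains is the Chu-Vandermonde convolution for q and p + \<alpha>.\<close>

lemma disk_poly_leading_coeff:
  assumes \<alpha>: "\<alpha> > -1"
  shows "disk_poly_monomial_coeff \<alpha> p q 0 =
    disk_poly_const \<alpha> p q * (Gamma (\<alpha> + real p + real q + 1))\<^sup>2 / (Gamma (\<alpha> + real p + 1) * Gamma (\<alpha> + real q + 1))"
proof -
  let ?K = "disk_poly_const \<alpha> p q * Gamma (\<alpha> + real p + real q + 1) * fact p * fact q"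
  have pos: "Gamma (\<alpha> + real k + 1) > 0" for k using \<alpha> by (intro Gamma_real_pos) linarith
  have nonpos: "x + 1 \<notin> \<int>\<^sub>\<le>\<^sub>0" if "x > -1" for x :: real using that by (auto elim!: nonpos_Ints_cases)
  have "(\<Sum>k=0..p. (real q gchoose k) * ((real p + \<alpha>) gchoose (p - k))) =
    (\<Sum>i\<le>min p q. fact q * Gamma (\<alpha> + real p + 1) * (1 / (fact i * fact (p - i) * fact (q - i) * Gamma (real i + \<alpha> + 1))))"
  proof (rule sum.mono_neutral_cong_right)
    show "\<forall>i\<in>{0..p} - {..min p q}. (real q gchoose i) * (real p + \<alpha> gchoose (p - i)) = 0"
      by (auto simp: binomial_gbinomial[symmetric])
    fix i assume i: "i \<in> {..min p q}"
    have "((real p + \<alpha>) gchoose (p - i)) = Gamma (real p + \<alpha> + 1) / (fact (p - i) * Gamma (real p + \<alpha> - real (p - i) + 1))"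
      using \<alpha> by (intro gbinomial_Gamma nonpos) linarith
    moreover have "real p + \<alpha> - real (p - i) + 1 = real i + \<alpha> + 1" using i by (simp add: of_nat_diff)
    ultimately show "(real q gchoose i) * ((real p + \<alpha>) gchoose (p - i)) =
       fact q * Gamma (\<alpha> + real p + 1) * (1 / (fact i * fact (p - i) * fact (q - i) * Gamma (real i + \<alpha> + 1)))"
      using i binomial_fact[of i q, where ?'a=real] by (simp add: binomial_gbinomial[symmetric] add.commute)
  qed auto
  also have "(\<Sum>k=0..p. (real q gchoose k) * ((real p + \<alpha>) gchoose (p - k))) = (real q + (real p + \<alpha>)) gchoose p"
    by (rule gbinomial_Vandermonde)
  also have "\<dots> = Gamma (\<alpha> + real p + real q + 1) / (fact p * Gamma (\<alpha> + real q + 1))"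
    using \<alpha> by (subst gbinomial_Gamma) (auto intro!: nonpos simp: algebra_simps)
  finally have *: "fact q * Gamma (\<alpha> + real p + 1) * (\<Sum>i\<le>min p q. 1 / (fact i * fact (p - i) * fact (q - i) * Gamma (real i + \<alpha> + 1)))
    = Gamma (\<alpha> + real p + real q + 1) / (fact p * Gamma (\<alpha> + real q + 1))"
    by (simp only: sum_distrib_left)
  have "disk_poly_monomial_coeff \<alpha> p q 0 = ?K * (\<Sum>i\<le>min p q. 1 / (fact i * fact (p - i) * fact (q - i) * Gamma (real i + \<alpha> + 1)))"
    unfolding disk_poly_monomial_coeff_def disk_poly_coeff_def sum_distrib_left atLeast0AtMost
    by (intro sum.cong refl) (simp add: power_mult_distrib[symmetric])
  also have "(\<Sum>i\<le>min p q. 1 / (fact i * fact (p - i) * fact (q - i) * Gamma (real i + \<alpha> + 1)))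
    = Gamma (\<alpha> + real p + real q + 1) / (fact p * Gamma (\<alpha> + real q + 1)) / (fact q * Gamma (\<alpha> + real p + 1))"
    unfolding *[symmetric] using pos[of p] by simp
  finally show ?thesis by (simp add: power2_eq_square mult_ac)
qed

lemma disk_poly_leading_coeff_pos: "\<alpha> > -1 \<Longrightarrow> disk_poly_monomial_coeff \<alpha> p q 0 > 0"
  unfolding disk_poly_leading_coeff
  by (intro divide_pos_pos mult_pos_pos disk_poly_const_pos zero_less_power Gamma_real_pos) auto

text \<open>The polynomial is orthogonal to all its monomials except the leading one, so the norm is
  the leading coefficient times one known integral. The normalizing constant makes this product
  1.\<close>

lemma l2_ip_disk_poly_self:
  assumes \<alpha>: "\<alpha> > -1"
  shows "l2_ip \<alpha> (disk_poly \<alpha> p q) (disk_poly \<alpha> p q) = 1"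
proof -
  let ?e = "disk_poly_monomial_coeff \<alpha> p q"
  have "l2_ip \<alpha> (disk_poly \<alpha> p q) (disk_poly \<alpha> p q) = (\<Sum>j\<le>min p q. of_real (?e j) * l2_ip \<alpha> (disk_poly \<alpha> p q) (monomial (p - j) (q - j)))"
    by (subst (2) disk_poly_eq_sum_monomial[OF \<alpha>], subst l2_ip_sum_right)
      (auto simp: l2_ip_fscale_right square_int_fscale square_int_monomial square_int_disk_poly \<alpha>)
  also have "\<dots> = (\<Sum>j\<le>min p q. if j = 0 then of_real (?e 0 * ((\<alpha> + 1) * disk_poly_const \<alpha> p q * fact p * fact q / (\<alpha> + real p + real q + 1))) else 0)"
  proof (intro sum.cong refl)
    fix j assume "j \<in> {..min p q}"
    then have "p + (q - j) = (p - j) + q" "q - j = q \<longleftrightarrow> j = 0" by auto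
    then show "of_real (?e j) * l2_ip \<alpha> (disk_poly \<alpha> p q) (monomial (p - j) (q - j)) =
       (if j = 0 then of_real (?e 0 * ((\<alpha> + 1) * disk_poly_const \<alpha> p q * fact p * fact q / (\<alpha> + real p + real q + 1))) else 0)"
      by (simp add: l2_ip_disk_poly_monomial[OF \<alpha>])
  qed
  also have "\<dots> = of_real (?e 0 * ((\<alpha> + 1) * disk_poly_const \<alpha> p q * fact p * fact q / (\<alpha> + real p + real q + 1)))"
    by simp
  also have "?e 0 * ((\<alpha> + 1) * disk_poly_const \<alpha> p q * fact p * fact q / (\<alpha> + real p + real q + 1)) =
    (disk_poly_const \<alpha> p q)\<^sup>2 * ((Gamma (\<alpha> + real p + real q + 1))\<^sup>2 * (\<alpha> + 1) * fact p * fact q /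
      ((\<alpha> + real p + real q + 1) * Gamma (\<alpha> + real p + 1) * Gamma (\<alpha> + real q + 1)))"
    unfolding disk_poly_leading_coeff[OF \<alpha>] by (simp add: power2_eq_square mult_ac)
  also have "\<dots> = 1"
  proof -
    have pos: "\<alpha> + 1 > 0" "\<alpha> + real p + real q + 1 > 0" "Gamma (\<alpha> + real p + 1) > 0" "Gamma (\<alpha> + real q + 1) > 0" "Gamma (\<alpha> + real p + real q + 1) > 0"
      using \<alpha> by (auto intro!: Gamma_real_pos)
    then have "(disk_poly_const \<alpha> p q)\<^sup>2 = (\<alpha> + real p + real q + 1) * Gamma (\<alpha> + real p + 1) * Gamma (\<alpha> + real q + 1) /
                    ((\<alpha> + 1) * fact p * fact q * (Gamma (\<alpha> + real p + real q + 1))\<^sup>2)"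
      unfolding disk_poly_const_def by (intro real_sqrt_pow2) auto
    then show ?thesis using pos[THEN less_imp_neq, THEN not_sym] by simp
  qed
  finally show ?thesis by simp
qed

lemma l2_ip_disk_poly_same_frequency:
  assumes \<alpha>: "\<alpha> > -1" and "p + q' = p' + q" "q' < q"
  shows "l2_ip \<alpha> (disk_poly \<alpha> p q) (disk_poly \<alpha> p' q') = 0"
proof -
  have "l2_ip \<alpha> (disk_poly \<alpha> p q) (monomial (p' - j) (q' - j)) = 0" if "j \<le> min p' q'" for j
    using assms that by (subst l2_ip_disk_poly_monomial) auto
  then show ?thesis
    by (subst (2) disk_poly_eq_sum_monomial[OF \<alpha>], subst l2_ip_sum_right)
      (auto simp: l2_ip_fscale_right square_int_fscale square_int_monomial square_int_disk_poly \<alpha>)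
qed

lemma monomial_rotate:
  assumes "cmod \<tau> = 1"
  shows "monomial p q (\<tau> * z) = \<tau> powi (int p - int q) * monomial p q z"
proof -
  have "\<tau> \<noteq> 0" using assms by auto
  have "cnj \<tau> = inverse \<tau>" using complex_norm_square[of \<tau>] assms by (simp add: inverse_unique)
  then have "\<tau> powi (int p - int q) = \<tau> ^ p * cnj \<tau> ^ q"
    using \<open>\<tau> \<noteq> 0\<close> by (simp add: power_int_diff power_inverse divide_inverse)
  then show ?thesis
    by (simp add: monomial_def on_disk_def norm_mult assms power_mult_distrib mult_ac)
qed

lemma disk_poly_rotate:
  assumes "\<alpha> > -1" "cmod \<tau> = 1"
  shows "disk_poly \<alpha> p q (\<tau> * z) = \<tau> powi (int p - int q) * disk_poly \<alpha> p q z"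
proof -
  have "int (p - j) - int (q - j) = int p - int q" if "j \<le> min p q" for j using that by auto
  then show ?thesis
    unfolding disk_poly_eq_sum_monomial[OF assms(1)] sum_fun_apply fscale_def sum_distrib_left
    by (intro sum.cong refl) (simp add: monomial_rotate[OF assms(2)])
qed

text \<open>The source of all orthogonality between different frequencies: for disk polynomials, for
  blocks cut off at a radius, and for the image of a block under a radial operator.\<close>

lemma l2_ip_homogeneous_zero:
  assumes [measurable]: "f \<in> borel_measurable borel" "g \<in> borel_measurable borel"
    and f: "\<And>\<tau> z. cmod \<tau> = 1 \<Longrightarrow> f (\<tau> * z) = \<tau> powi k * f z"
    and g: "\<And>\<tau> z. cmod \<tau> = 1 \<Longrightarrow> g (\<tau> * z) = \<tau> powi l * g z"
    and "k \<noteq> l"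
  shows "l2_ip \<alpha> f g = 0"
  unfolding l2_ip_def
proof (rule integral_mu_homogeneous_zero[where k="k - l"])
  fix \<tau> z :: complex assume \<tau>: "cmod \<tau> = 1"
  then have "\<tau> \<noteq> 0" by auto
  have "cnj \<tau> = inverse \<tau>" using complex_norm_square[of \<tau>] \<tau> by (simp add: inverse_unique)
  then have "cnj (\<tau> powi l) = inverse (\<tau> powi l)" by (cases l rule: int_cases2) (auto simp: power_int_minus power_inverse)
  then show "f (\<tau> * z) * cnj (g (\<tau> * z)) = \<tau> powi (k - l) * (f z * cnj (g z))"
    using \<open>\<tau> \<noteq> 0\<close> by (simp add: f[OF \<tau>] g[OF \<tau>] power_int_diff divide_inverse mult_ac)
qed (use assms in auto)

lemma disk_poly_orthonormal:
  assumes \<alpha>: "\<alpha> > -1"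
  shows "l2_ip \<alpha> (disk_poly \<alpha> p q) (disk_poly \<alpha> p' q') = (if p = p' \<and> q = q' then 1 else 0)"
proof (cases "p + q' = p' + q")
  case True
  consider "q' < q" | "q < q'" | "q = q'" "p = p'" using True by linarith
  then show ?thesis
  proof cases
    case 1
    with l2_ip_disk_poly_same_frequency[OF \<alpha> True] show ?thesis by simp
  next
    case 2
    with l2_ip_disk_poly_same_frequency[OF \<alpha> True[symmetric]] show ?thesis
      by (subst l2_ip_commute) simp
  next
    case 3
    then show ?thesis using l2_ip_disk_poly_self[OF \<alpha>] by simp
  qed
next
  case False
  have "l2_ip \<alpha> (disk_poly \<alpha> p q) (disk_poly \<alpha> p' q') = 0"
    by (rule l2_ip_homogeneous_zero[where k="int p - int q" and l="int p' - int q'"])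
      (use False square_int_measurable[OF square_int_disk_poly[OF \<alpha>]] disk_poly_rotate[OF \<alpha>] in auto)
  with False show ?thesis by auto
qed

section \<open>Polynomial growth of the coefficients in p\<close>

definition poly_bounded :: "(nat \<Rightarrow> real) \<Rightarrow> bool" where
  "poly_bounded f \<longleftrightarrow> (\<exists>C L. \<forall>p. \<bar>f p\<bar> \<le> C * real (p + 1) ^ L)"

lemma poly_boundedI: "(\<And>p. \<bar>f p\<bar> \<le> C * real (p + 1) ^ L) \<Longrightarrow> poly_bounded f"
  unfolding poly_bounded_def by blast

lemma poly_boundedE:
  assumes "poly_bounded f"
  obtains C L where "C \<ge> 0" "\<forall>p. \<bar>f p\<bar> \<le> C * real (p + 1) ^ L"
proof -
  from assms obtain C L where CL: "\<And>p. \<bar>f p\<bar> \<le> C * real (p + 1) ^ L" unfolding poly_bounded_def by blast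
  from CL[of 0] have "C \<ge> 0" by simp
  with CL that show ?thesis by blast
qed

lemma poly_bounded_const: "poly_bounded (\<lambda>p. c)"
  by (rule poly_boundedI[where C="\<bar>c\<bar>" and L=0]) simp

lemma poly_bounded_mono:
  assumes "poly_bounded g" "\<And>p. \<bar>f p\<bar> \<le> \<bar>g p\<bar>"
  shows "poly_bounded f"
  using assms unfolding poly_bounded_def by (meson order_trans)

lemma poly_bounded_add:
  assumes "poly_bounded f" "poly_bounded g"
  shows "poly_bounded (\<lambda>p. f p + g p)"
proof -
  obtain C L where C: "C \<ge> 0" "\<forall>p. \<bar>f p\<bar> \<le> C * real (p + 1) ^ L" by (rule poly_boundedE[OF assms(1)])
  obtain D M where D: "D \<ge> 0" "\<forall>p. \<bar>g p\<bar> \<le> D * real (p + 1) ^ M" by (rule poly_boundedE[OF assms(2)])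
  show ?thesis
  proof (rule poly_boundedI[where C="C + D" and L="L + M"])
    fix p
    have "\<bar>f p + g p\<bar> \<le> C * real (p + 1) ^ L + D * real (p + 1) ^ M"
      using C(2)[rule_format, of p] D(2)[rule_format, of p] by linarith
    also have "\<dots> \<le> C * real (p + 1) ^ (L + M) + D * real (p + 1) ^ (L + M)"
      using C(1) D(1) by (intro add_mono mult_left_mono power_increasing) auto
    finally show "\<bar>f p + g p\<bar> \<le> (C + D) * real (p + 1) ^ (L + M)" by (simp add: algebra_simps)
  qed
qed

lemma poly_bounded_mult:
  assumes "poly_bounded f" "poly_bounded g"
  shows "poly_bounded (\<lambda>p. f p * g p)"
proof -
  obtain C L where C: "C \<ge> 0" "\<forall>p. \<bar>f p\<bar> \<le> C * real (p + 1) ^ L" by (rule poly_boundedE[OF assms(1)])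
  obtain D M where D: "D \<ge> 0" "\<forall>p. \<bar>g p\<bar> \<le> D * real (p + 1) ^ M" by (rule poly_boundedE[OF assms(2)])
  show ?thesis
  proof (rule poly_boundedI[where C="C * D" and L="L + M"])
    fix p
    have "\<bar>f p * g p\<bar> \<le> (C * real (p + 1) ^ L) * (D * real (p + 1) ^ M)"
      unfolding abs_mult using C D by (intro mult_mono) (auto simp del: of_nat_add of_nat_Suc)
    then show "\<bar>f p * g p\<bar> \<le> C * D * real (p + 1) ^ (L + M)" by (simp add: power_add mult_ac)
  qed
qed

lemma poly_bounded_sum: "(\<And>i. i \<in> I \<Longrightarrow> poly_bounded (f i)) \<Longrightarrow> poly_bounded (\<lambda>p. \<Sum>i\<in>I. f i p)"
  by (induction I rule: infinite_finite_induct) (auto intro: poly_bounded_const poly_bounded_add)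

lemma poly_bounded_shift:
  assumes "poly_bounded f"
  shows "poly_bounded (\<lambda>p. f (p + c))"
proof -
  obtain C L where C: "C \<ge> 0" "\<forall>p. \<bar>f p\<bar> \<le> C * real (p + 1) ^ L" by (rule poly_boundedE[OF assms(1)])
  show ?thesis
  proof (rule poly_boundedI[where C="C * real (c + 1) ^ L" and L="L"])
    fix p
    have "\<bar>f (p + c)\<bar> \<le> C * real (p + c + 1) ^ L" using C(2) by blast
    also have "\<dots> \<le> C * (real (c + 1) * real (p + 1)) ^ L"
      using C(1) by (intro mult_left_mono power_mono) (auto simp: algebra_simps)
    finally show "\<bar>f (p + c)\<bar> \<le> C * real (c + 1) ^ L * real (p + 1) ^ L" by (simp add: power_mult_distrib mult_ac)
  qed
qed

lemma poly_bounded_linear: "poly_bounded (\<lambda>p. real p + c)"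
  by (intro poly_bounded_add poly_bounded_const) (rule poly_boundedI[where C=1 and L=1], simp)

text \<open>Comparison with the series whose coefficients are (m + 1)^L; its radius of convergence
  is 1 by the ratio test.\<close>

lemma poly_bounded_imp_conv_radius:
  fixes a :: "nat \<Rightarrow> complex"
  assumes "poly_bounded f" "\<And>m. cmod (a m) \<le> f m"
  shows "conv_radius a \<ge> 1"
proof -
  obtain C L where C: "C \<ge> 0" "\<forall>p. \<bar>f p\<bar> \<le> C * real (p + 1) ^ L" by (rule poly_boundedE[OF assms(1)])
  have cr: "conv_radius (\<lambda>m. of_real ((real (m + 1)) ^ L) :: complex) = 1"
  proof (rule conv_radius_ratio_limit_nonzero[where c=1])
    have "(\<lambda>m. (real (m + 1) / real (m + 2)) ^ L) \<longlonglongrightarrow> 1 ^ L"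
      by (intro tendsto_power) (use LIMSEQ_n_over_Suc_n[THEN LIMSEQ_Suc] in simp)
    then show "(\<lambda>m. norm (of_real ((real (m + 1)) ^ L) :: complex) / norm (of_real ((real (Suc m + 1)) ^ L) :: complex)) \<longlonglongrightarrow> 1"
      by (simp only: norm_of_real power_divide) (simp add: abs_of_nonneg power_divide)
  qed (auto simp: one_ereal_def)
  show ?thesis
  proof (rule conv_radius_geI_ex')
    fix r :: real assume r: "0 < r" "ereal r < 1"
    have "summable (\<lambda>m. norm (of_real ((real (m + 1)) ^ L) * of_real r ^ m :: complex))"
      by (rule abs_summable_in_conv_radius) (subst cr, use r in simp)
    then have "summable (\<lambda>m. C * norm (of_real ((real (m + 1)) ^ L) * of_real r ^ m :: complex))"
      by (rule summable_mult)
    then show "summable (\<lambda>m. a m * of_real r ^ m)"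
    proof (rule summable_comparison_test'[where N=0])
      fix m :: nat
      have "cmod (a m) \<le> C * real (m + 1) ^ L" using assms(2)[of m] C(2)[rule_format, of m] by linarith
      then show "norm (a m * of_real r ^ m) \<le> C * norm (of_real ((real (m + 1)) ^ L) * of_real r ^ m :: complex)"
        using r unfolding norm_mult norm_power norm_of_real
        by (simp add: abs_of_nonneg mult_right_mono mult.assoc[symmetric] del: of_nat_add of_nat_Suc)
    qed
  qed
qed

text \<open>A product of at most \<open>i\<close> factors, none exceeding p + 1; this also covers p
  < i, where natural subtraction leaves p! itself.\<close>

lemma poly_bounded_fact_ratio: "poly_bounded (\<lambda>p. fact p / fact (p - i))"
proof (rule poly_boundedI[where C=1 and L=i])
  fix p
  show "\<bar>fact p / fact (p - i)\<bar> \<le> 1 * real (p + 1) ^ i"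
  proof (induction i)
    case (Suc i)
    have "fact p / fact (p - Suc i) \<le> fact p / fact (p - i) * real (p + 1)"
    proof (cases "p - i")
      case (Suc d)
      then have d: "p - Suc i = d" "real (Suc d) \<le> real (p + 1)" by auto
      have "fact p / fact d = fact p / fact (Suc d) * (real (Suc d))" by simp
      also have "\<dots> \<le> fact p / fact (Suc d) * real (p + 1)" using d(2) by (intro mult_left_mono) auto
      finally show ?thesis unfolding Suc d(1) .
    qed simp
    also have "\<dots> \<le> real (p + 1) ^ i * real (p + 1)"
      using Suc by (intro mult_right_mono) auto
    finally show ?case by (simp add: mult.commute)
  qed simp
qed

text \<open>Induction on p with the functional equation of Gamma: replacing \<alpha> by an integer
  \<open>L\<close> that is at least \<alpha> only enlarges each factor, and turns the quotient into
  a ratio of factorials.\<close>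

lemma poly_bounded_Gamma_ratio:
  assumes "\<alpha> > -1"
  shows "poly_bounded (\<lambda>p. Gamma (\<alpha> + real p + 1) / fact p)"
proof -
  define L where "L = nat \<lceil>\<alpha>\<rceil> "
  have L: "\<alpha> \<le> real L" unfolding L_def by linarith
  have G0: "Gamma (\<alpha> + real p + 1) > 0" for p using assms by (intro Gamma_real_pos) linarith
  have "Gamma (\<alpha> + real p + 1) / fact p \<le> Gamma (\<alpha> + 1) * (fact (p + L) / fact p)" for p
  proof (induction p)
    case (Suc p)
    have "\<alpha> + real p + 1 \<notin> \<int>\<^sub>\<le>\<^sub>0" using assms by (auto elim!: nonpos_Ints_cases)
    from Gamma_plus1[OF this]
    have "Gamma (\<alpha> + real (Suc p) + 1) = (\<alpha> + real p + 1) * Gamma (\<alpha> + real p + 1)"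
      by (simp add: add_ac)
    also have "\<dots> \<le> real (p + L + 1) * Gamma (\<alpha> + real p + 1)"
      using L G0[of p] by (intro mult_right_mono) auto
    finally have "Gamma (\<alpha> + real (Suc p) + 1) / fact (Suc p) \<le> real (p + L + 1) * Gamma (\<alpha> + real p + 1) / fact (Suc p)"
      by (intro divide_right_mono) auto
    also have "\<dots> = real (p + L + 1) / real (Suc p) * (Gamma (\<alpha> + real p + 1) / fact p)" by simp
    also have "\<dots> \<le> real (p + L + 1) / real (Suc p) * (Gamma (\<alpha> + 1) * (fact (p + L) / fact p))"
      by (intro mult_left_mono Suc) auto
    also have "\<dots> = Gamma (\<alpha> + 1) * (fact (Suc p + L) / fact (Suc p))" by simp
    finally show ?case .
  qed (use G0[of 0] fact_ge_1[of L, where ?'a=real] in simp)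
  moreover have "poly_bounded (\<lambda>p. Gamma (\<alpha> + 1) * (fact (p + L) / fact (p + L - L)))"
    by (intro poly_bounded_mult poly_bounded_const poly_bounded_shift[OF poly_bounded_fact_ratio])
  ultimately show ?thesis
    using G0 G0[of 0] by (elim poly_bounded_mono) (simp add: abs_mult less_imp_le abs_of_pos)
qed

text \<open>The factor \<open>Gamma (\<alpha> + real p + real q + 1)\<close> cancels the one in the
  normalizing constant. Under the root remains \<open>S p\<close>, made of a linear factor, a Gamma
  ratio and a constant.\<close>

lemma poly_bounded_disk_poly_coeff:
  assumes \<alpha>: "\<alpha> > -1"
  shows "poly_bounded (\<lambda>p. disk_poly_coeff \<alpha> p q i)"
proof -
  define S where "S p = (\<alpha> + real p + real q + 1) * (Gamma (\<alpha> + real p + 1) / fact p) * (Gamma (\<alpha> + real q + 1) / ((\<alpha> + 1) * fact q))" for p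
  have pos: "\<alpha> + 1 > 0" "\<alpha> + real p + real q + 1 > 0" "Gamma (\<alpha> + real p + 1) > 0" "Gamma (\<alpha> + real q + 1) > 0" "Gamma (\<alpha> + real p + real q + 1) > 0" for p
    using \<alpha> by (auto intro!: Gamma_real_pos)
  have S0: "S p \<ge> 0" for p unfolding S_def using pos(1) pos(2,3)[of p] pos(4) by auto
  have "poly_bounded (\<lambda>p. real p + (\<alpha> + real q + 1))" by (rule poly_bounded_linear)
  then have "poly_bounded S" unfolding S_def
    by (intro poly_bounded_mult poly_bounded_Gamma_ratio[OF \<alpha>] poly_bounded_const) (simp add: add_ac)
  have eq: "disk_poly_const \<alpha> p q * Gamma (\<alpha> + real p + real q + 1) = sqrt (S p)" for p
  proof -
    have "disk_poly_const \<alpha> p q = sqrt (S p) / Gamma (\<alpha> + real p + real q + 1)"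
      unfolding disk_poly_const_def S_def real_sqrt_divide[symmetric]
      using pos(5)[of p] real_sqrt_divide[of "S p" "(Gamma (\<alpha> + real p + real q + 1))\<^sup>2"]
      unfolding S_def by (simp add: mult_ac)
    then show ?thesis using pos(5)[of p] by simp
  qed
  have "poly_bounded (\<lambda>p. (1 + S p) * (fact p / fact (p - i)) * (fact q / (fact i * fact (q - i) * Gamma (real i + \<alpha> + 1))))"
    by (intro poly_bounded_mult poly_bounded_add poly_bounded_const \<open>poly_bounded S\<close> poly_bounded_fact_ratio)
  then show ?thesis
  proof (rule poly_bounded_mono)
    fix p
    \<comment> \<open>Avoids half-integral powers of p in the growth estimate.\<close>
    have "sqrt (S p) \<le> 1 + S p"
      using S0[of p] by (intro real_le_lsqrt) (auto simp: power2_eq_square algebra_simps)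
    have "\<bar>disk_poly_coeff \<alpha> p q i\<bar> = sqrt (S p) * \<bar>(fact p / fact (p - i)) * (fact q / (fact i * fact (q - i) * Gamma (real i + \<alpha> + 1)))\<bar>"
      unfolding disk_poly_coeff_def eq using S0[of p] by (simp add: abs_mult power_abs mult_ac)
    also have "\<dots> \<le> (1 + S p) * \<bar>(fact p / fact (p - i)) * (fact q / (fact i * fact (q - i) * Gamma (real i + \<alpha> + 1)))\<bar>"
      by (intro mult_right_mono \<open>sqrt (S p) \<le> 1 + S p\<close>) auto
    also have "\<dots> = \<bar>(1 + S p) * (fact p / fact (p - i)) * (fact q / (fact i * fact (q - i) * Gamma (real i + \<alpha> + 1)))\<bar>"
      using S0[of p] by (simp add: abs_mult mult.assoc)
    finally show "\<bar>disk_poly_coeff \<alpha> p q i\<bar> \<le> \<bar>(1 + S p) * (fact p / fact (p - i)) * (fact q / (fact i * fact (q - i) * Gamma (real i + \<alpha> + 1)))\<bar>" .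
  qed
qed

text \<open>As \<open>q\<close> is fixed, extending the sum to all i \<le> q bounds it by a number
  of terms independent of p.\<close>

lemma poly_bounded_monomial_coeff:
  assumes \<alpha>: "\<alpha> > -1"
  shows "poly_bounded (\<lambda>p. disk_poly_monomial_coeff \<alpha> p q j)"
proof (rule poly_bounded_mono)
  show "poly_bounded (\<lambda>p. \<Sum>i\<le>q. \<bar>disk_poly_coeff \<alpha> p q i\<bar> * real (i choose j))"
    by (intro poly_bounded_sum poly_bounded_mult poly_bounded_const poly_bounded_mono[OF poly_bounded_disk_poly_coeff[OF \<alpha>]]) auto
  fix p
  have "\<bar>disk_poly_monomial_coeff \<alpha> p q j\<bar> \<le> (\<Sum>i\<in>{j..min p q}. \<bar>disk_poly_coeff \<alpha> p q i * (real (i choose j) * (-1) ^ (i - j))\<bar>)"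
    unfolding disk_poly_monomial_coeff_def by (rule sum_abs)
  also have "\<dots> = (\<Sum>i\<in>{j..min p q}. \<bar>disk_poly_coeff \<alpha> p q i\<bar> * real (i choose j))"
    by (simp add: abs_mult power_abs)
  also have "\<dots> \<le> (\<Sum>i\<le>q. \<bar>disk_poly_coeff \<alpha> p q i\<bar> * real (i choose j))"
    by (intro sum_mono2) auto
  finally show "\<bar>disk_poly_monomial_coeff \<alpha> p q j\<bar> \<le> \<bar>\<Sum>i\<le>q. \<bar>disk_poly_coeff \<alpha> p q i\<bar> * real (i choose j)\<bar>"
    by linarith
qed

section \<open>Frequency expansions\<close>

abbreviation W :: "nat \<Rightarrow> real \<Rightarrow> int \<Rightarrow> complex fspace" where
  "W n \<alpha> \<xi> \<equiv> W_space \<alpha> \<xi> (nat (min (int n) (int n + \<xi>)))"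

abbreviation basis :: "real \<Rightarrow> int \<Rightarrow> nat \<Rightarrow> complex \<Rightarrow> complex" where
  "basis \<alpha> \<xi> q \<equiv> disk_poly \<alpha> (nat (int q + \<xi>)) q"

lemma finite_coords [simp]: "finite (coords n \<xi>)"
  by (rule finite_subset[of _ "{..n}"]) (auto simp: coords_def)

lemma ip_W [simp]: "ip (W_space \<alpha> \<xi> s) = l2_ip \<alpha>"
  by (simp add: W_space_def)

text \<open>Along the diagonal p - q = \<xi>, the condition on the minimum says just that q < n, for
  either sign of \<xi>.\<close>

lemma W_generators:
  assumes "\<xi> \<in> freqs n"
  shows "{monomial p q | p q. int p - int q = \<xi> \<and> min p q < nat (min (int n) (int n + \<xi>))}
    = (\<lambda>q. monomial (nat (int q + \<xi>)) q) ` coords n \<xi>"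
proof (intro set_eqI iffI)
  fix f assume "f \<in> {monomial p q | p q. int p - int q = \<xi> \<and> min p q < nat (min (int n) (int n + \<xi>))}"
  then obtain p q where f: "f = monomial p q" "int p - int q = \<xi>" "min p q < nat (min (int n) (int n + \<xi>))" by blast
  then have "p = nat (int q + \<xi>)" "q \<in> coords n \<xi>" by (auto simp: coords_def min_def split: if_splits)
  then show "f \<in> (\<lambda>q. monomial (nat (int q + \<xi>)) q) ` coords n \<xi>" using f by blast
next
  fix f assume "f \<in> (\<lambda>q. monomial (nat (int q + \<xi>)) q) ` coords n \<xi>"
  then obtain q where f: "f = monomial (nat (int q + \<xi>)) q" and q: "q \<in> coords n \<xi>" by blast
  then have "int (nat (int q + \<xi>)) - int q = \<xi>" "min (nat (int q + \<xi>)) q < nat (min (int n) (int n + \<xi>))"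
    by (auto simp: coords_def min_def split: if_splits)
  with f show "f \<in> {monomial p q | p q. int p - int q = \<xi> \<and> min p q < nat (min (int n) (int n + \<xi>))}" by blast
qed

lemma vecs_W_monomials:
  "\<xi> \<in> freqs n \<Longrightarrow> vecs (W n \<alpha> \<xi>) = cfun.span ((\<lambda>q. monomial (nat (int q + \<xi>)) q) ` coords n \<xi>)"
  by (simp add: W_space_def W_generators)

text \<open>Keeps all monomials of a disk polynomial inside the block of that polynomial.\<close>

lemma coords_diff:
  assumes "q \<in> coords n \<xi>" "j \<le> min (nat (int q + \<xi>)) q"
  shows "q - j \<in> coords n \<xi>" "nat (int (q - j) + \<xi>) = nat (int q + \<xi>) - j"
proof -
  have q: "max 0 (- \<xi>) \<le> int q" "int q \<le> int n - 1" using assms(1) by (simp_all add: coords_def)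
  then have j: "int j \<le> int q" "int j \<le> int q + \<xi>" using assms(2) by linarith+
  then have "int (q - j) = int q - int j" by simp
  with q j show "q - j \<in> coords n \<xi>" "nat (int (q - j) + \<xi>) = nat (int q + \<xi>) - j"
    unfolding coords_def mem_Collect_eq by linarith+
qed

text \<open>The change from monomials to disk polynomials is triangular in q with nonzero diagonal;
  the induction solves for the leading monomial.\<close>

lemma vecs_W_basis:
  assumes \<alpha>: "\<alpha> > -1" and \<xi>: "\<xi> \<in> freqs n"
  shows "vecs (W n \<alpha> \<xi>) = cfun.span (basis \<alpha> \<xi> ` coords n \<xi>)"
proof -
  let ?m = "\<lambda>q. monomial (nat (int q + \<xi>)) q"
  have "basis \<alpha> \<xi> q \<in> cfun.span (?m ` coords n \<xi>)" if q: "q \<in> coords n \<xi>" for q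
  proof -
    have "monomial (nat (int q + \<xi>) - j) (q - j) \<in> cfun.span (?m ` coords n \<xi>)" if "j \<le> min (nat (int q + \<xi>)) q" for j
      using coords_diff(1)[OF q that] unfolding coords_diff(2)[OF q that, symmetric]
      by (intro cfun.span_base imageI)
    then show ?thesis
      unfolding disk_poly_eq_sum_monomial[OF \<alpha>] by (intro cfun.span_sum cfun.span_scale) auto
  qed
  moreover have "?m q \<in> cfun.span (basis \<alpha> \<xi> ` coords n \<xi>)" if "q \<in> coords n \<xi>" for q
    using that
  proof (induction q rule: less_induct)
    case (less q)
    let ?p = "nat (int q + \<xi>)"
    let ?e = "disk_poly_monomial_coeff \<alpha> ?p q"
    let ?r = "\<Sum>j\<in>{1..min ?p q}. fscale (of_real (?e j)) (monomial (?p - j) (q - j))"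
    have e0: "?e 0 > 0" by (rule disk_poly_leading_coeff_pos[OF \<alpha>])
    have "{..min ?p q} = insert 0 {1..min ?p q}" by auto
    then have "basis \<alpha> \<xi> q = fscale (of_real (?e 0)) (monomial ?p q) + ?r"
      unfolding disk_poly_eq_sum_monomial[OF \<alpha>] by simp
    then have "monomial ?p q = fscale (of_real (1 / ?e 0)) (basis \<alpha> \<xi> q - ?r)"
      using e0 by (simp add: fscale_fscale)
    moreover have "monomial (?p - j) (q - j) \<in> cfun.span (basis \<alpha> \<xi> ` coords n \<xi>)" if "j \<in> {1..min ?p q}" for j
      using less.IH[of "q - j"] coords_diff[OF less.prems, of j] that by auto
    then have "fscale (of_real (1 / ?e 0)) (basis \<alpha> \<xi> q - ?r) \<in> cfun.span (basis \<alpha> \<xi> ` coords n \<xi>)"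
      using less.prems by (intro cfun.span_scale cfun.span_diff cfun.span_sum) (auto intro: cfun.span_base)
    ultimately show ?case by simp
  qed
  ultimately show ?thesis
    unfolding vecs_W_monomials[OF \<xi>] by (intro cfun.span_eq[THEN iffD2] conjI) auto
qed

lemma basis_orthonormal:
  assumes "\<alpha> > -1" "q \<in> coords n \<xi>" "r \<in> coords n \<eta>"
  shows "l2_ip \<alpha> (basis \<alpha> \<xi> q) (basis \<alpha> \<eta> r) = (if \<xi> = \<eta> \<and> q = r then 1 else 0)"
proof -
  have "0 \<le> int q + \<xi>" "0 \<le> int r + \<eta>" using assms(2,3) by (simp_all add: coords_def)
  then have "nat (int q + \<xi>) = nat (int r + \<eta>) \<longleftrightarrow> int q + \<xi> = int r + \<eta>" by (rule eq_nat_nat_iff)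
  then show ?thesis unfolding disk_poly_orthonormal[OF assms(1)] by auto
qed

lemma basis_in_W: "\<alpha> > -1 \<Longrightarrow> \<xi> \<in> freqs n \<Longrightarrow> q \<in> coords n \<xi> \<Longrightarrow> basis \<alpha> \<xi> q \<in> vecs (W n \<alpha> \<xi>)"
  unfolding vecs_W_basis by (auto intro: cfun.span_base)

lemma W_subspace: "cfun.subspace (vecs (W n \<alpha> \<xi>))"
  by (simp add: W_space_def cfun.subspace_span)

lemma W_basis_sum:
  "\<alpha> > -1 \<Longrightarrow> \<xi> \<in> freqs n \<Longrightarrow> (\<Sum>q\<in>coords n \<xi>. fscale (c q) (basis \<alpha> \<xi> q)) \<in> vecs (W n \<alpha> \<xi>)"
  by (intro cfun.subspace_sum[OF W_subspace] cfun.subspace_scale[OF W_subspace] basis_in_W)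

lemma l2_ip_basis_sum:
  assumes "\<alpha> > -1" "q \<in> coords n \<xi>"
  shows "l2_ip \<alpha> (\<Sum>q\<in>coords n \<xi>. fscale (c q) (basis \<alpha> \<xi> q)) (basis \<alpha> \<xi> q) = c q"
proof -
  have "l2_ip \<alpha> (\<Sum>q\<in>coords n \<xi>. fscale (c q) (basis \<alpha> \<xi> q)) (basis \<alpha> \<xi> q) = (\<Sum>r\<in>coords n \<xi>. c r * (if r = q then 1 else 0))"
    using assms by (subst l2_ip_sum_left) (auto simp: square_int_fscale square_int_disk_poly l2_ip_fscale_left basis_orthonormal intro!: sum.cong)
  also have "\<dots> = c q" using assms(2) by (simp add: if_distrib sum.delta cong: if_cong)
  finally show ?thesis .
qed

lemma W_expand:
  assumes \<alpha>: "\<alpha> > -1" and \<xi>: "\<xi> \<in> freqs n" and g: "g \<in> vecs (W n \<alpha> \<xi>)"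
  shows "g = (\<Sum>q\<in>coords n \<xi>. fscale (l2_ip \<alpha> g (basis \<alpha> \<xi> q)) (basis \<alpha> \<xi> q))"
proof -
  obtain c where c: "g = (\<Sum>q\<in>coords n \<xi>. fscale (c q) (basis \<alpha> \<xi> q))"
    using span_image_finite[of "coords n \<xi>" g "basis \<alpha> \<xi>"] g unfolding vecs_W_basis[OF \<alpha> \<xi>] by auto
  have "(\<Sum>q\<in>coords n \<xi>. fscale (l2_ip \<alpha> g (basis \<alpha> \<xi> q)) (basis \<alpha> \<xi> q)) = (\<Sum>q\<in>coords n \<xi>. fscale (c q) (basis \<alpha> \<xi> q))"
    by (rule sum.cong[OF refl]) (simp add: c l2_ip_basis_sum[OF \<alpha>])
  then show ?thesis using c by simp
qed

lemma W_square_int: "\<alpha> > -1 \<Longrightarrow> \<xi> \<in> freqs n \<Longrightarrow> g \<in> vecs (W n \<alpha> \<xi>) \<Longrightarrow> square_int \<alpha> g"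
  by (subst W_expand[where g=g]) (auto intro: square_int_sum square_int_fscale square_int_disk_poly)

lemma W_ip_expand:
  assumes \<alpha>: "\<alpha> > -1" and \<xi>: "\<xi> \<in> freqs n" and f: "square_int \<alpha> f" and g: "g \<in> vecs (W n \<alpha> \<xi>)"
  shows "l2_ip \<alpha> f g = (\<Sum>q\<in>coords n \<xi>. l2_ip \<alpha> f (basis \<alpha> \<xi> q) * cnj (l2_ip \<alpha> g (basis \<alpha> \<xi> q)))"
  by (subst W_expand[OF \<alpha> \<xi> g], subst l2_ip_sum_right)
    (auto simp: f square_int_fscale square_int_disk_poly \<alpha> l2_ip_fscale_right mult.commute)

lemma W_rotate:
  assumes \<alpha>: "\<alpha> > -1" and \<xi>: "\<xi> \<in> freqs n" and g: "g \<in> vecs (W n \<alpha> \<xi>)" and \<tau>: "cmod \<tau> = 1"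
  shows "g (\<tau> * z) = \<tau> powi \<xi> * g z"
proof -
  have "basis \<alpha> \<xi> q (\<tau> * z) = \<tau> powi \<xi> * basis \<alpha> \<xi> q z" if "q \<in> coords n \<xi>" for q
    using that by (simp add: disk_poly_rotate[OF \<alpha> \<tau>] coords_def)
  then show ?thesis
    by (subst (1 2) W_expand[OF \<alpha> \<xi> g]) (simp add: sum_fun_apply fscale_def sum_distrib_left mult_ac)
qed

lemma W_outside:
  assumes \<alpha>: "\<alpha> > -1" and \<xi>: "\<xi> \<in> freqs n" and g: "g \<in> vecs (W n \<alpha> \<xi>)" and z: "z \<notin> ball 0 1"
  shows "g z = 0"
  by (subst W_expand[OF \<alpha> \<xi> g]) (use z in \<open>simp add: sum_fun_apply fscale_def disk_poly_def on_disk_def\<close>)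

lemma l2_norm_sq_sum_orthogonal:
  assumes "finite I" "\<And>i. i \<in> I \<Longrightarrow> square_int \<alpha> (h i)" "\<And>i j. i \<in> I \<Longrightarrow> j \<in> I \<Longrightarrow> i \<noteq> j \<Longrightarrow> l2_ip \<alpha> (h i) (h j) = 0"
  shows "l2_ip \<alpha> (\<Sum>i\<in>I. h i) (\<Sum>i\<in>I. h i) = (\<Sum>i\<in>I. l2_ip \<alpha> (h i) (h i))"
proof -
  have "l2_ip \<alpha> (\<Sum>i\<in>I. h i) (\<Sum>i\<in>I. h i) = (\<Sum>i\<in>I. \<Sum>j\<in>I. l2_ip \<alpha> (h i) (h j))"
    using assms(2) by (simp add: l2_ip_sum_left l2_ip_sum_right square_int_sum) (rule sum.swap)
  also have "\<dots> = (\<Sum>i\<in>I. \<Sum>j\<in>I. if i = j then l2_ip \<alpha> (h i) (h i) else 0)"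
    using assms(3) by (intro sum.cong) auto
  also have "\<dots> = (\<Sum>i\<in>I. l2_ip \<alpha> (h i) (h i))" using assms(1) by simp
  finally show ?thesis .
qed

lemma nn_integral_l2_ip:
  assumes "square_int \<alpha> f"
  shows "(\<integral>\<^sup>+z. ennreal ((cmod (f z))\<^sup>2) \<partial>mu \<alpha>) = ennreal (Re (l2_ip \<alpha> f f))"
  unfolding l2_ip_self using assms
  by (subst nn_integral_eq_integral) (auto simp: square_int_def)

section \<open>Expansions into blocks and their norms\<close>

text \<open>Numbers the frequencies from 0 so that series and sequential limits apply;
  \<open>poly_block\<close> uses the same numbering.\<close>

definition freq :: "nat \<Rightarrow> nat \<Rightarrow> int" where
  "freq n k = int k - int n + 1"

lemma freq_in_freqs [simp]: "freq n k \<in> freqs n"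
  by (simp add: freq_def freqs_def)

lemma bij_betw_freq: "bij_betw (freq n) UNIV (freqs n)"
  by (rule bij_betw_byWitness[where f'="\<lambda>\<xi>. nat (\<xi> + int n - 1)"]) (auto simp: freq_def freqs_def)

lemma coords_freq: "coords n (freq n k) = {q. q < n \<and> n \<le> q + k + 1}"
  by (auto simp: coords_def freq_def)

lemma nat_add_freq: "nat (int q + freq n k) = q + k + 1 - n"
  by (simp add: freq_def)

text \<open>Records exactly the convergence that power series provide. Square integrability of
  \<open>f\<close> is left out on purpose, so that \<open>expansion_norm\<close> can be applied to
  decide it.\<close>

definition expansion :: "nat \<Rightarrow> real \<Rightarrow> (complex \<Rightarrow> complex) \<Rightarrow> (nat \<Rightarrow> complex \<Rightarrow> complex) \<Rightarrow> bool" where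
  "expansion n \<alpha> f F \<longleftrightarrow> (\<forall>k. F k \<in> vecs (W n \<alpha> (freq n k))) \<and> (\<forall>z. z \<notin> ball 0 1 \<longrightarrow> f z = 0) \<and>
     (\<forall>R<1. uniform_limit (cball 0 R) (\<lambda>N z. \<Sum>k<N. F k z) f sequentially)"

lemma W_measurable: "\<alpha> > -1 \<Longrightarrow> \<xi> \<in> freqs n \<Longrightarrow> g \<in> vecs (W n \<alpha> \<xi>) \<Longrightarrow> g \<in> borel_measurable borel"
  using W_square_int by (auto simp: square_int_def)

lemma expansion_pointwise:
  assumes "expansion n \<alpha> f F" "\<alpha> > -1"
  shows "(\<lambda>k. F k z) sums f z"
proof (cases "z \<in> ball 0 1")
  case True
  then have "uniform_limit (cball 0 (cmod z)) (\<lambda>N z. \<Sum>k<N. F k z) f sequentially"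
    using assms(1) by (auto simp: expansion_def)
  then show ?thesis unfolding sums_def by (rule tendsto_uniform_limitI) simp
next
  case False
  have "F k z = 0" for k
    by (rule W_outside[OF assms(2) freq_in_freqs[of n k] _ False]) (use assms(1) in \<open>simp add: expansion_def\<close>)
  moreover have "f z = 0" using assms(1) False by (simp add: expansion_def)
  ultimately show ?thesis by simp
qed

lemma expansion_measurable:
  assumes "expansion n \<alpha> f F" "\<alpha> > -1"
  shows "f \<in> borel_measurable borel"
proof (rule borel_measurable_LIMSEQ_metric)
  show "(\<lambda>N. \<Sum>k<N. F k z) \<longlonglongrightarrow> f z" for z
    using expansion_pointwise[OF assms, of z] by (simp add: sums_def)
  show "(\<lambda>z. \<Sum>k<N. F k z) \<in> borel_measurable borel" for N
    using assms W_measurable[OF assms(2) freq_in_freqs] by (intro borel_measurable_sum) (auto simp: expansion_def)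
qed

lemma W_bounded:
  assumes \<alpha>: "\<alpha> > -1" and \<xi>: "\<xi> \<in> freqs n" and g: "g \<in> vecs (W n \<alpha> \<xi>)"
  shows "\<exists>C. \<forall>z. cmod (g z) \<le> C"
proof -
  obtain c where c: "g = (\<Sum>q\<in>coords n \<xi>. fscale (c q) (monomial (nat (int q + \<xi>)) q))"
    using span_image_finite[of "coords n \<xi>" g "\<lambda>q. monomial (nat (int q + \<xi>)) q"] g unfolding vecs_W_monomials[OF \<xi>] by auto
  have "cmod (g z) \<le> (\<Sum>q\<in>coords n \<xi>. cmod (c q))" for z
    unfolding c sum_fun_apply fscale_def
    by (rule order_trans[OF norm_sum], rule sum_mono) (simp add: norm_mult mult_left_le norm_monomial_le)
  then show ?thesis by blast
qed

text \<open>Pythagoras on the disk of radius \<open>R\<close>: there the series converges uniformly, and its terms stay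
  orthogonal because the restricted measure is still rotation invariant.\<close>

lemma expansion_norm_cball:
  assumes ex: "expansion n \<alpha> f F" and \<alpha>: "\<alpha> > -1" and R: "R < 1"
  shows "(\<integral>\<^sup>+z. ennreal ((cmod (indicator (cball 0 R) z * f z))\<^sup>2) \<partial>mu \<alpha>) =
    (\<Sum>k. \<integral>\<^sup>+z. ennreal ((cmod (indicator (cball 0 R) z * F k z))\<^sup>2) \<partial>mu \<alpha>)"
proof -
  let ?I = "\<lambda>g z. indicator (cball 0 R) z * g z :: complex"
  have F: "F k \<in> vecs (W n \<alpha> (freq n k))" for k using ex by (simp add: expansion_def)
  have [measurable]: "f \<in> borel_measurable borel" by (rule expansion_measurable[OF ex \<alpha>])
  have [measurable]: "F k \<in> borel_measurable borel" for k by (rule W_measurable[OF \<alpha> freq_in_freqs F])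
  have [measurable]: "(indicator (cball 0 R) :: complex \<Rightarrow> complex) \<in> borel_measurable borel"
    by (intro borel_measurable_indicator) simp
  have ul: "uniform_limit (cball 0 R) (\<lambda>N z. \<Sum>k<N. F k z) f sequentially"
    using ex R by (simp add: expansion_def)
  have sq: "square_int \<alpha> (?I (F k))" for k
  proof -
    obtain C where C: "\<And>z. cmod (F k z) \<le> C" using W_bounded[OF \<alpha> freq_in_freqs F] by blast
    then have "cmod (?I (F k) z) \<le> C" for z
      using order_trans[OF norm_ge_zero C] by (auto simp: indicator_def)
    then show ?thesis by (intro square_int_bounded[OF \<alpha>]) auto
  qed
  have orth: "l2_ip \<alpha> (?I (F k)) (?I (F l)) = 0" if "k \<noteq> l" for k l
  proof (rule l2_ip_homogeneous_zero[where k="freq n k" and l="freq n l"])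
    show "?I (F k) (\<tau> * z) = \<tau> powi freq n k * ?I (F k) z" "?I (F l) (\<tau> * z) = \<tau> powi freq n l * ?I (F l) z"
      if "cmod \<tau> = 1" for \<tau> z
      using W_rotate[OF \<alpha> freq_in_freqs F that] that by (auto simp: indicator_def norm_mult)
  qed (use that in \<open>auto simp: freq_def\<close>)
  have finite_sum: "(\<integral>\<^sup>+z. ennreal ((cmod (?I (\<lambda>z. \<Sum>k<N. F k z) z))\<^sup>2) \<partial>mu \<alpha>) =
      (\<Sum>k<N. \<integral>\<^sup>+z. ennreal ((cmod (?I (F k) z))\<^sup>2) \<partial>mu \<alpha>)" for N
  proof -
    have e: "(\<Sum>k<N. ?I (F k)) z = ?I (\<lambda>z. \<Sum>k<N. F k z) z" for z
      by (simp add: sum_fun_apply sum_distrib_left)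
    have "(\<integral>\<^sup>+z. ennreal ((cmod (?I (\<lambda>z. \<Sum>k<N. F k z) z))\<^sup>2) \<partial>mu \<alpha>) = ennreal (Re (l2_ip \<alpha> (\<Sum>k<N. ?I (F k)) (\<Sum>k<N. ?I (F k))))"
      using nn_integral_l2_ip[OF square_int_sum[of "{..<N}" \<alpha> "\<lambda>k. ?I (F k)", OF sq]] unfolding e .
    also have "\<dots> = ennreal (\<Sum>k<N. Re (l2_ip \<alpha> (?I (F k)) (?I (F k))))"
      using sq orth by (subst l2_norm_sq_sum_orthogonal) auto
    also have "\<dots> = (\<Sum>k<N. ennreal (Re (l2_ip \<alpha> (?I (F k)) (?I (F k)))))"
      by (rule sum_ennreal[symmetric]) (rule l2_ip_nonneg)
    finally show ?thesis by (simp add: nn_integral_l2_ip[OF sq])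
  qed
  \<comment> \<open>Prepares dominated convergence: from \<open>N0\<close> on, the partial sums stay
    within distance 2 of the one at \<open>N0\<close>, which is bounded by some
    \<open>C\<close>.\<close>
  obtain N0 where N0: "\<forall>N\<ge>N0. \<forall>z\<in>cball 0 R. dist (\<Sum>k<N. F k z) (f z) < 1"
    using uniform_limitD[OF ul zero_less_one] unfolding eventually_sequentially by blast
  have "\<exists>C. \<forall>z. cmod (\<Sum>k<N0. F k z) \<le> C"
  proof -
    obtain C where C: "\<And>k z. cmod (F k z) \<le> C k" using W_bounded[OF \<alpha> freq_in_freqs F] by metis
    then have "cmod (\<Sum>k<N0. F k z) \<le> (\<Sum>k<N0. C k)" for z by (intro sum_norm_le) auto
    then show ?thesis by blast
  qed
  then obtain C where C: "\<And>z. cmod (\<Sum>k<N0. F k z) \<le> C" by blast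
  have bound: "cmod (?I (\<lambda>z. \<Sum>k<N0 + N. F k z) z) \<le> C + 2" for N z
  proof (cases "z \<in> cball 0 R")
    case True
    have "dist (\<Sum>k<N0 + N. F k z) (f z) < 1" "dist (\<Sum>k<N0. F k z) (f z) < 1" using N0 True by auto
    then have "dist (\<Sum>k<N0 + N. F k z) (\<Sum>k<N0. F k z) < 2"
      by (metis dist_triangle_half_l mult_2 one_add_one divide_self_if zero_neq_numeral)
    then have "cmod ((\<Sum>k<N0 + N. F k z) - (\<Sum>k<N0. F k z)) < 2" by (simp add: dist_norm)
    then have "cmod (\<Sum>k<N0 + N. F k z) < C + 2"
      using C[of z] norm_triangle_ineq2[of "\<Sum>k<N0 + N. F k z" "\<Sum>k<N0. F k z"] by linarith
    then show ?thesis using True by simp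
  next
    case False
    then show ?thesis using order_trans[OF norm_ge_zero C[of z]] by simp
  qed
  have "(\<lambda>N. \<integral>\<^sup>+z. ennreal ((cmod (?I (\<lambda>z. \<Sum>k<N0 + N. F k z) z))\<^sup>2) \<partial>mu \<alpha>) \<longlonglongrightarrow>
      (\<integral>\<^sup>+z. ennreal ((cmod (?I f z))\<^sup>2) \<partial>mu \<alpha>)"
  proof (rule nn_integral_dominated_convergence[where w="\<lambda>_. ennreal ((C + 2)\<^sup>2)"])
    interpret finite_measure "mu \<alpha>" by (rule finite_measure_mu[OF \<alpha>])
    show "(\<integral>\<^sup>+z. ennreal ((C + 2)\<^sup>2) \<partial>mu \<alpha>) < \<infinity>"
    proof -
      have "emeasure (mu \<alpha>) UNIV < top" using emeasure_finite[of UNIV] unfolding less_top infinity_ennreal_def .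
      then show ?thesis by (simp add: ennreal_mult_less_top)
    qed
    show "AE z in mu \<alpha>. ennreal ((cmod (?I (\<lambda>z. \<Sum>k<N0 + N. F k z) z))\<^sup>2) \<le> ennreal ((C + 2)\<^sup>2)" for N
      by (intro AE_I2 ennreal_leI power_mono bound) simp
    have "(\<lambda>N. \<Sum>k<N0 + N. F k z) \<longlonglongrightarrow> f z" for z
      using LIMSEQ_ignore_initial_segment[OF expansion_pointwise[OF ex \<alpha>, of z, unfolded sums_def], where k=N0]
      by (simp add: add.commute)
    then show "AE z in mu \<alpha>. (\<lambda>N. ennreal ((cmod (?I (\<lambda>z. \<Sum>k<N0 + N. F k z) z))\<^sup>2)) \<longlonglongrightarrow> ennreal ((cmod (?I f z))\<^sup>2)"
      by (intro AE_I2 tendsto_ennrealI tendsto_power tendsto_norm tendsto_mult_left)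
  qed auto
  then have "(\<lambda>N. \<Sum>k<N + N0. \<integral>\<^sup>+z. ennreal ((cmod (?I (F k) z))\<^sup>2) \<partial>mu \<alpha>) \<longlonglongrightarrow>
      (\<integral>\<^sup>+z. ennreal ((cmod (?I f z))\<^sup>2) \<partial>mu \<alpha>)"
    unfolding finite_sum by (simp add: add.commute)
  then have "(\<lambda>N. \<Sum>k<N. \<integral>\<^sup>+z. ennreal ((cmod (?I (F k) z))\<^sup>2) \<partial>mu \<alpha>) \<longlonglongrightarrow>
      (\<integral>\<^sup>+z. ennreal ((cmod (?I f z))\<^sup>2) \<partial>mu \<alpha>)"
    by (rule LIMSEQ_offset)
  moreover have "(\<lambda>N. \<Sum>k<N. \<integral>\<^sup>+z. ennreal ((cmod (?I (F k) z))\<^sup>2) \<partial>mu \<alpha>) \<longlonglongrightarrow> (\<Sum>k. \<integral>\<^sup>+z. ennreal ((cmod (?I (F k) z))\<^sup>2) \<partial>mu \<alpha>)"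
    by (rule summable_LIMSEQ) simp
  ultimately show ?thesis by (rule LIMSEQ_unique)
qed

text \<open>Monotone convergence along radii that increase to 1.\<close>

lemma nn_integral_exhaust_ball:
  assumes [measurable]: "g \<in> borel_measurable borel" and g: "\<And>z. z \<notin> ball 0 1 \<Longrightarrow> g z = 0"
  shows "(\<integral>\<^sup>+z. ennreal ((cmod (g z))\<^sup>2) \<partial>mu \<alpha>) =
    (SUP j. \<integral>\<^sup>+z. ennreal ((cmod (indicator (cball 0 (1 - 1 / real (j + 1))) z * g z))\<^sup>2) \<partial>mu \<alpha>)"
proof -
  let ?R = "\<lambda>j::nat. 1 - 1 / real (j + 1)"
  let ?h = "\<lambda>j z. ennreal ((cmod (indicator (cball 0 (?R j)) z * g z))\<^sup>2)"
  have mono: "?R i \<le> ?R j" if "i \<le> j" for i j using that by (simp add: frac_le)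
  have inc: "incseq ?h"
  proof (intro incseq_SucI le_funI ennreal_leI power_mono)
    fix i z
    show "cmod (indicator (cball 0 (?R i)) z * g z) \<le> cmod (indicator (cball 0 (?R (Suc i))) z * g z)"
      using mono[of i "Suc i"] by (auto simp: indicator_def)
  qed simp
  have [measurable]: "(indicator (cball 0 r) :: complex \<Rightarrow> complex) \<in> borel_measurable borel" for r
    by (intro borel_measurable_indicator) simp
  have "ennreal ((cmod (g z))\<^sup>2) = (SUP j. ?h j z)" for z
  proof (cases "z \<in> ball 0 1")
    case True
    then have "0 < 1 - cmod z" by simp
    then obtain j where j: "inverse (real (Suc j)) < 1 - cmod z" using reals_Archimedean by blast
    then have "?h j z = ennreal ((cmod (g z))\<^sup>2)" by (simp add: indicator_def inverse_eq_divide)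
    moreover have "?h i z \<le> ennreal ((cmod (g z))\<^sup>2)" for i
      by (intro ennreal_leI power_mono) (auto simp: indicator_def)
    ultimately show ?thesis by (intro antisym SUP_upper2[of j] SUP_least) auto
  next
    case False
    then show ?thesis using g by simp
  qed
  then show ?thesis
    by (simp only:) (rule nn_integral_monotone_convergence_SUP[OF inc], simp)
qed

text \<open>Lets the radius tend to 1 in \<open>expansion_norm_cball\<close>. All quantities
  increase with the radius, so supremum and sum can be exchanged in \<open>ennreal\<close>, where
  both sides may be infinite.\<close>

lemma expansion_norm:
  assumes ex: "expansion n \<alpha> f F" and \<alpha>: "\<alpha> > -1"
  shows "(\<integral>\<^sup>+z. ennreal ((cmod (f z))\<^sup>2) \<partial>mu \<alpha>) = (\<Sum>k. \<integral>\<^sup>+z. ennreal ((cmod (F k z))\<^sup>2) \<partial>mu \<alpha>)"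
proof -
  let ?R = "\<lambda>j::nat. 1 - 1 / real (j + 1)"
  have F: "F k \<in> vecs (W n \<alpha> (freq n k))" for k using ex by (simp add: expansion_def)
  have "(\<integral>\<^sup>+z. ennreal ((cmod (f z))\<^sup>2) \<partial>mu \<alpha>) = (SUP j. \<integral>\<^sup>+z. ennreal ((cmod (indicator (cball 0 (?R j)) z * f z))\<^sup>2) \<partial>mu \<alpha>)"
    using ex by (intro nn_integral_exhaust_ball expansion_measurable[OF ex \<alpha>]) (auto simp: expansion_def)
  also have "\<dots> = (SUP j. \<Sum>k. \<integral>\<^sup>+z. ennreal ((cmod (indicator (cball 0 (?R j)) z * F k z))\<^sup>2) \<partial>mu \<alpha>)"
    by (intro SUP_cong refl expansion_norm_cball[OF ex \<alpha>]) simp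
  also have "\<dots> = (\<Sum>k. SUP j. \<integral>\<^sup>+z. ennreal ((cmod (indicator (cball 0 (?R j)) z * F k z))\<^sup>2) \<partial>mu \<alpha>)"
  proof (rule ennreal_suminf_SUP_eq[symmetric])
    fix k
    show "incseq (\<lambda>j. \<integral>\<^sup>+z. ennreal ((cmod (indicator (cball 0 (?R j)) z * F k z))\<^sup>2) \<partial>mu \<alpha>)"
    proof (rule incseq_SucI, intro nn_integral_mono ennreal_leI power_mono)
      fix i z
      have "?R i \<le> ?R (Suc i)" by (simp add: frac_le)
      then show "cmod (indicator (cball 0 (?R i)) z * F k z) \<le> cmod (indicator (cball 0 (?R (Suc i))) z * F k z)"
        by (auto simp: indicator_def)
    qed simp
  qed
  also have "\<dots> = (\<Sum>k. \<integral>\<^sup>+z. ennreal ((cmod (F k z))\<^sup>2) \<partial>mu \<alpha>)"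
    by (intro suminf_cong nn_integral_exhaust_ball[symmetric] W_measurable[OF \<alpha> freq_in_freqs F] W_outside[OF \<alpha> freq_in_freqs F])
  finally show ?thesis .
qed

lemma l2_ip_add_fscale_self:
  assumes "square_int \<alpha> f" "square_int \<alpha> g"
  shows "l2_ip \<alpha> (f + fscale c g) (f + fscale c g) =
    l2_ip \<alpha> f f + cnj c * l2_ip \<alpha> f g + c * cnj (l2_ip \<alpha> f g) + of_real ((cmod c)\<^sup>2) * l2_ip \<alpha> g g"
  using assms
  by (simp add: l2_ip_add_left l2_ip_add_right l2_ip_fscale_left l2_ip_fscale_right square_int_add square_int_fscale
      l2_ip_commute[of \<alpha> g f] complex_norm_square del: of_real_power) (simp add: algebra_simps)

lemma expansion_sums:
  assumes ex: "expansion n \<alpha> f F" and \<alpha>: "\<alpha> > -1" and f: "square_int \<alpha> f"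
  shows "(\<lambda>k. Re (l2_ip \<alpha> (F k) (F k))) sums Re (l2_ip \<alpha> f f)"
proof -
  have F: "square_int \<alpha> (F k)" for k
    using ex unfolding expansion_def by (intro W_square_int[OF \<alpha> freq_in_freqs[of n k]]) simp
  have *: "(\<Sum>k. ennreal (Re (l2_ip \<alpha> (F k) (F k)))) = ennreal (Re (l2_ip \<alpha> f f))"
    using expansion_norm[OF ex \<alpha>] by (simp add: nn_integral_l2_ip F f)
  then have "summable (\<lambda>k. Re (l2_ip \<alpha> (F k) (F k)))"
    by (intro summable_suminf_not_top l2_ip_nonneg) simp
  moreover have "(\<Sum>k. Re (l2_ip \<alpha> (F k) (F k))) = Re (l2_ip \<alpha> f f)"
    using suminf_ennreal[of "\<lambda>k. Re (l2_ip \<alpha> (F k) (F k))", OF l2_ip_nonneg] * calculation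
    by (simp add: l2_ip_nonneg suminf_nonneg)
  ultimately show ?thesis by (simp add: sums_iff)
qed

text \<open>Comparing the norm identities of \<open>f\<close> and \<open>f + c b\<close> for all scalars \<open>c\<close> determines the inner product.\<close>

lemma expansion_coeff:
  assumes ex: "expansion n \<alpha> f F" and \<alpha>: "\<alpha> > -1" and f: "square_int \<alpha> f"
    and b: "b \<in> vecs (W n \<alpha> (freq n k))"
  shows "l2_ip \<alpha> f b = l2_ip \<alpha> (F k) b"
proof -
  have F: "F j \<in> vecs (W n \<alpha> (freq n j))" for j using ex by (simp add: expansion_def)
  have sb: "square_int \<alpha> b" and sF: "square_int \<alpha> (F j)" for j
    using W_square_int[OF \<alpha> freq_in_freqs] b F by blast+
  have main: "Re (cnj c * l2_ip \<alpha> f b) = Re (cnj c * l2_ip \<alpha> (F k) b)" for c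
  proof -
    \<comment> \<open>The perturbation changes only the block \<open>k\<close> of the expansion, so
      the two norm identities differ in a single term. The integral of \<open>f\<close> against
      \<open>b\<close> is thus reached without termwise integration.\<close>
    let ?g = "f + fscale c b" and ?G = "F(k := F k + fscale c b)"
    have "expansion n \<alpha> ?g ?G" unfolding expansion_def
    proof (intro conjI allI impI)
      fix j show "?G j \<in> vecs (W n \<alpha> (freq n j))"
        using F b cfun.subspace_add[OF W_subspace] cfun.subspace_scale[OF W_subspace] by (cases "j = k") auto
    next
      fix z :: complex assume "z \<notin> ball 0 1"
      then show "?g z = 0" using ex W_outside[OF \<alpha> freq_in_freqs b] by (simp add: expansion_def fscale_def)
    next
      fix R :: real assume "R < 1"
      then have "uniform_limit (cball 0 R) (\<lambda>N z. (\<Sum>k<N. F k z) + fscale c b z) (\<lambda>z. f z + fscale c b z) sequentially"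
        using ex by (intro uniform_limit_add uniform_limit_const) (simp add: expansion_def)
      moreover have "(\<Sum>j<N. ?G j z) = (\<Sum>j<N. F j z) + fscale c b z" if "k < N" for N z
      proof -
        have "(\<Sum>j<N. ?G j z) = (\<Sum>j<N. F j z + (if j = k then fscale c b z else 0))"
          by (intro sum.cong) auto
        then show ?thesis using that by (simp add: sum.distrib)
      qed
      ultimately show "uniform_limit (cball 0 R) (\<lambda>N z. \<Sum>j<N. ?G j z) ?g sequentially"
        by (elim uniform_limit_cong[THEN iffD1, rotated 2])
          (auto intro: eventually_mono[OF eventually_gt_at_top[of k]])
    qed
    from expansion_sums[OF this \<alpha>] have 1: "(\<lambda>j. Re (l2_ip \<alpha> (?G j) (?G j))) sums Re (l2_ip \<alpha> ?g ?g)"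
      using f sb by (simp add: square_int_add square_int_fscale)
    let ?d = "Re (l2_ip \<alpha> (F k + fscale c b) (F k + fscale c b)) - Re (l2_ip \<alpha> (F k) (F k))"
    have "(\<lambda>j. Re (l2_ip \<alpha> (F j) (F j)) + (if j = k then ?d else 0)) sums (Re (l2_ip \<alpha> f f) + ?d)"
      by (intro sums_add expansion_sums[OF ex \<alpha> f] sums_single)
    moreover have "(\<lambda>j. Re (l2_ip \<alpha> (F j) (F j)) + (if j = k then ?d else 0)) = (\<lambda>j. Re (l2_ip \<alpha> (?G j) (?G j)))"
      by auto
    ultimately have "Re (l2_ip \<alpha> ?g ?g) = Re (l2_ip \<alpha> f f) + ?d" using 1 sums_unique2 by fastforce
    then show ?thesis
      by (simp add: l2_ip_add_fscale_self[OF f sb] l2_ip_add_fscale_self[OF sF sb])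
  qed
  \<comment> \<open>The scalars 1 and \<i> yield the real and the imaginary part.\<close>
  show ?thesis using main[of 1] main[of \<i>] by (simp add: complex_eq_iff)
qed

lemma poly_block_in_W: "on_disk (poly_block n a k) \<in> vecs (W n \<alpha> (freq n k))"
proof -
  have "on_disk (poly_block n a k) = (\<Sum>q\<in>coords n (freq n k). fscale (a q (q + k + 1 - n)) (monomial (nat (int q + freq n k)) q))"
    by (rule ext) (simp add: poly_block_def on_disk_def sum_fun_apply fscale_def monomial_def coords_freq nat_add_freq)
  then show ?thesis
    unfolding vecs_W_monomials[OF freq_in_freqs]
    by (simp only:) (intro cfun.span_sum cfun.span_scale cfun.span_base imageI)
qed

lemma expansion_poly_series:
  assumes "\<And>q. q < n \<Longrightarrow> conv_radius (a q) \<ge> 1"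
  shows "expansion n \<alpha> (on_disk (poly_series n a)) (\<lambda>k. on_disk (poly_block n a k))"
  unfolding expansion_def
proof (intro conjI allI impI poly_block_in_W)
  fix R :: real assume R: "R < 1"
  have "uniform_limit (cball 0 R) (\<lambda>N z. \<Sum>k<N. poly_block n a k z) (poly_series n a) sequentially"
    by (rule uniform_limit_poly_block[OF assms R])
  then show "uniform_limit (cball 0 R) (\<lambda>N z. \<Sum>k<N. on_disk (poly_block n a k) z) (on_disk (poly_series n a)) sequentially"
    by (rule uniform_limit_cong[THEN iffD1, rotated 2]) (use R in \<open>auto simp: on_disk_def\<close>)
qed (simp add: on_disk_def)

lemma expansion_exists:
  assumes f: "f \<in> vecs (polyanalytic_space n \<alpha>)"
  obtains F where "expansion n \<alpha> f F"
proof -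
  have "n_analytic_on n (ball 0 1) f" using f by (simp add: polyanalytic_space_def)
  then show ?thesis
  proof (rule n_analytic_on_obtain_series)
    fix a
    assume a: "\<And>q. q < n \<Longrightarrow> conv_radius (a q) \<ge> 1" "\<And>z. z \<in> ball 0 1 \<Longrightarrow> f z = poly_series n a z"
    have "f = on_disk (poly_series n a)"
      using f a(2) by (auto simp: on_disk_def polyanalytic_space_def)
    with expansion_poly_series[of n a \<alpha>, OF a(1)] that show ?thesis by metis
  qed
qed

lemma square_int_polyanalytic:
  assumes "f \<in> vecs (polyanalytic_space n \<alpha>)" "\<alpha> > -1"
  shows "square_int \<alpha> f"
proof -
  obtain F where "expansion n \<alpha> f F" by (rule expansion_exists[OF assms(1)])
  from expansion_measurable[OF this assms(2)] show ?thesis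
    using assms(1) by (simp add: square_int_def polyanalytic_space_def)
qed

section \<open>Functions with prescribed coefficients\<close>

text \<open>The monomial with \<open>cnj z ^ q\<close> occurs in the disk polynomials of index r
  \<ge> q of the same block, each time as the term j = r - q.\<close>

lemma basis_sum_eq_monomial_sum:
  assumes \<alpha>: "\<alpha> > -1"
  shows "(\<Sum>r\<in>coords n (freq n k). fscale (x r) (basis \<alpha> (freq n k) r)) =
    (\<Sum>q\<in>coords n (freq n k). fscale (\<Sum>r\<in>{q..<n}. x r * of_real (disk_poly_monomial_coeff \<alpha> (r + k + 1 - n) r (r - q))) (monomial (q + k + 1 - n) q))"
proof -
  let ?C = "coords n (freq n k)"
  let ?e = "\<lambda>r. disk_poly_monomial_coeff \<alpha> (r + k + 1 - n) r"
  have "basis \<alpha> (freq n k) r = (\<Sum>q\<in>{q\<in>?C. q \<le> r}. fscale (of_real (?e r (r - q))) (monomial (q + k + 1 - n) q))"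
    if r: "r \<in> ?C" for r
    unfolding nat_add_freq disk_poly_eq_sum_monomial[OF \<alpha>]
    by (rule sum.reindex_bij_witness[of _ "\<lambda>q. r - q" "\<lambda>j. r - j"]) (use r in \<open>auto simp: coords_freq add_ac\<close>)
  then have "(\<Sum>r\<in>?C. fscale (x r) (basis \<alpha> (freq n k) r)) =
    (\<Sum>r\<in>?C. \<Sum>q\<in>{q\<in>?C. q \<le> r}. fscale (x r * of_real (?e r (r - q))) (monomial (q + k + 1 - n) q))"
    by (intro sum.cong refl) (simp add: fscale_sum fscale_fscale)
  also have "\<dots> = (\<Sum>q\<in>?C. \<Sum>r\<in>{r\<in>?C. q \<le> r}. fscale (x r * of_real (?e r (r - q))) (monomial (q + k + 1 - n) q))"
    by (rule sum.swap_restrict) auto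
  also have "\<dots> = (\<Sum>q\<in>?C. \<Sum>r\<in>{q..<n}. fscale (x r * of_real (?e r (r - q))) (monomial (q + k + 1 - n) q))"
    by (intro sum.cong refl) (auto simp: coords_freq)
  finally show ?thesis by (simp only: cfun.scale_sum_left)
qed

text \<open>Bounded coordinates are enough: each power series coefficient combines at most n of them
  with factors of polynomial growth, so the radius of convergence is at least 1.\<close>

lemma expansion_of_coefficients:
  assumes \<alpha>: "\<alpha> > -1" and bound: "\<And>k q. q \<in> coords n (freq n k) \<Longrightarrow> cmod (x k q) \<le> M"
  obtains f where "expansion n \<alpha> f (\<lambda>k. \<Sum>q\<in>coords n (freq n k). fscale (x k q) (basis \<alpha> (freq n k) q))"
    and "n_analytic_on n (ball 0 1) f"
proof -
  \<comment> \<open>The monomial z^m \<open>cnj z ^ q\<close> lies in the block k = m + n - 1 - q,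
    and the disk polynomial with index r in that block has z-degree m + (r - q).\<close>
  define a where "a q m = (\<Sum>r\<in>{q..<n}. x (m + n - 1 - q) r * of_real (disk_poly_monomial_coeff \<alpha> (m + (r - q)) r (r - q)))" for q m
  have cr: "conv_radius (a q) \<ge> 1" if q: "q < n" for q
  proof (rule poly_bounded_imp_conv_radius)
    have "poly_bounded (\<lambda>m. \<bar>disk_poly_monomial_coeff \<alpha> (m + (r - q)) r (r - q)\<bar>)" for r
      by (rule poly_bounded_mono[OF poly_bounded_shift[OF poly_bounded_monomial_coeff[OF \<alpha>, of r "r - q"], of "r - q"]]) simp
    then show "poly_bounded (\<lambda>m. \<Sum>r\<in>{q..<n}. M * \<bar>disk_poly_monomial_coeff \<alpha> (m + (r - q)) r (r - q)\<bar>)"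
      by (intro poly_bounded_sum poly_bounded_mult poly_bounded_const)
    fix m
    show "cmod (a q m) \<le> (\<Sum>r\<in>{q..<n}. M * \<bar>disk_poly_monomial_coeff \<alpha> (m + (r - q)) r (r - q)\<bar>)"
      unfolding a_def
    proof (rule sum_norm_le)
      fix r assume "r \<in> {q..<n}"
      then have "r \<in> coords n (freq n (m + n - 1 - q))" using q by (auto simp: coords_freq)
      from bound[OF this]
      show "cmod (x (m + n - 1 - q) r * of_real (disk_poly_monomial_coeff \<alpha> (m + (r - q)) r (r - q)))
        \<le> M * \<bar>disk_poly_monomial_coeff \<alpha> (m + (r - q)) r (r - q)\<bar>"
        by (simp add: norm_mult mult_right_mono)
    qed
  qed
  have "on_disk (poly_block n a k) = (\<Sum>q\<in>coords n (freq n k). fscale (x k q) (basis \<alpha> (freq n k) q))" for k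
  proof -
    have "on_disk (poly_block n a k) = (\<Sum>q\<in>coords n (freq n k). fscale (a q (q + k + 1 - n)) (monomial (q + k + 1 - n) q))"
      by (rule ext) (simp add: poly_block_def on_disk_def sum_fun_apply fscale_def monomial_def coords_freq)
    also have "\<dots> = (\<Sum>q\<in>coords n (freq n k). fscale (\<Sum>r\<in>{q..<n}. x k r * of_real (disk_poly_monomial_coeff \<alpha> (r + k + 1 - n) r (r - q))) (monomial (q + k + 1 - n) q))"
    proof (intro sum.cong refl arg_cong2[where f=fscale])
      fix q assume q: "q \<in> coords n (freq n k)"
      then have "q + k + 1 - n + n - 1 - q = k" by (auto simp: coords_freq)
      moreover have "q + k + 1 - n + (r - q) = r + k + 1 - n" if "r \<in> {q..<n}" for r
        using q that by (auto simp: coords_freq)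
      ultimately show "a q (q + k + 1 - n) = (\<Sum>r\<in>{q..<n}. x k r * of_real (disk_poly_monomial_coeff \<alpha> (r + k + 1 - n) r (r - q)))"
        unfolding a_def by (intro sum.cong refl) simp
    qed
    finally show ?thesis by (simp only: basis_sum_eq_monomial_sum[OF \<alpha>])
  qed
  with expansion_poly_series[of n a \<alpha>, OF cr] have "expansion n \<alpha> (on_disk (poly_series n a)) (\<lambda>k. \<Sum>q\<in>coords n (freq n k). fscale (x k q) (basis \<alpha> (freq n k) q))"
    by simp
  moreover have "n_analytic_on n (ball 0 1) (on_disk (poly_series n a))"
    by (rule n_analytic_on_poly_series[OF cr]) (simp_all add: on_disk_def)
  ultimately show ?thesis by (rule that)
qed

section \<open>Vector space structure of the polyanalytic space\<close>

lemma polyanalytic_sum_add: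
  assumes "polyanalytic_sum n f" "polyanalytic_sum n g"
  shows "polyanalytic_sum n (f + g)"
proof -
  from assms obtain F G where "\<forall>q<n. F q holomorphic_on ball 0 1" "\<forall>z\<in>ball 0 1. f z = (\<Sum>q<n. cnj z ^ q * F q z)"
    "\<forall>q<n. G q holomorphic_on ball 0 1" "\<forall>z\<in>ball 0 1. g z = (\<Sum>q<n. cnj z ^ q * G q z)"
    unfolding polyanalytic_sum_def by blast
  then show ?thesis unfolding polyanalytic_sum_def
    by (intro exI[of _ "\<lambda>q z. F q z + G q z"]) (auto intro!: holomorphic_intros simp: distrib_left sum.distrib)
qed

lemma polyanalytic_sum_fscale:
  assumes "polyanalytic_sum n f"
  shows "polyanalytic_sum n (fscale c f)"
proof -
  from assms obtain F where "\<forall>q<n. F q holomorphic_on ball 0 1" "\<forall>z\<in>ball 0 1. f z = (\<Sum>q<n. cnj z ^ q * F q z)"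
    unfolding polyanalytic_sum_def by blast
  then show ?thesis unfolding polyanalytic_sum_def
    by (intro exI[of _ "\<lambda>q z. c * F q z"]) (auto intro!: holomorphic_intros simp: fscale_def sum_distrib_left mult_ac)
qed

lemma vecs_polyanalytic_iff:
  assumes "\<alpha> > -1"
  shows "f \<in> vecs (polyanalytic_space n \<alpha>) \<longleftrightarrow>
    polyanalytic_sum n f \<and> (\<forall>z. z \<notin> ball 0 1 \<longrightarrow> f z = 0) \<and> square_int \<alpha> f"
  using square_int_polyanalytic[OF _ assms, of f n] polyanalytic_sum_n_analytic_on n_analytic_on_polyanalytic_sum
  by (auto simp: polyanalytic_space_def square_int_def)

lemma polyanalytic_subspace:
  assumes "\<alpha> > -1"
  shows "cfun.subspace (vecs (polyanalytic_space n \<alpha>))"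
  unfolding cfun.subspace_def
proof (intro conjI ballI allI)
  have "polyanalytic_sum n 0"
    unfolding polyanalytic_sum_def by (intro exI[of _ "\<lambda>_ _. 0"]) auto
  then show "0 \<in> vecs (polyanalytic_space n \<alpha>)"
    by (simp add: vecs_polyanalytic_iff[OF assms] square_int_zero)
next
  fix f g assume "f \<in> vecs (polyanalytic_space n \<alpha>)" "g \<in> vecs (polyanalytic_space n \<alpha>)"
  then show "f + g \<in> vecs (polyanalytic_space n \<alpha>)"
    by (simp add: vecs_polyanalytic_iff[OF assms] polyanalytic_sum_add square_int_add)
next
  fix c f assume "f \<in> vecs (polyanalytic_space n \<alpha>)"
  moreover have "fscale c f z = c * f z" for z by (simp add: fscale_def)
  ultimately show "fscale c f \<in> vecs (polyanalytic_space n \<alpha>)"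
    by (simp add: vecs_polyanalytic_iff[OF assms] polyanalytic_sum_fscale square_int_fscale)
qed

lemma W_subset_polyanalytic:
  assumes \<alpha>: "\<alpha> > -1" and \<xi>: "\<xi> \<in> freqs n"
  shows "vecs (W n \<alpha> \<xi>) \<subseteq> vecs (polyanalytic_space n \<alpha>)"
proof -
  have "monomial p q \<in> vecs (polyanalytic_space n \<alpha>)" if "q < n" for p q
    unfolding vecs_polyanalytic_iff[OF \<alpha>]
  proof (intro conjI square_int_monomial[OF \<alpha>])
    have "(\<Sum>r<n. cnj z ^ r * (if r = q then z ^ p else 0)) = z ^ p * cnj z ^ q" for z
      using that by (simp add: if_distrib mult.commute cong: if_cong)
    moreover have "(\<lambda>z. if r = q then z ^ p else 0) holomorphic_on ball 0 1" for r
      by (cases "r = q") (auto intro!: holomorphic_intros)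
    ultimately show "polyanalytic_sum n (monomial p q)" unfolding polyanalytic_sum_def
      by (intro exI[of _ "\<lambda>r z. if r = q then z ^ p else 0"]) (auto simp: monomial_def on_disk_def)
  qed (simp add: monomial_def on_disk_def)
  then show ?thesis
    unfolding vecs_W_monomials[OF \<xi>]
    by (intro cfun.span_minimal polyanalytic_subspace[OF \<alpha>]) (auto simp: coords_def)
qed

section \<open>Radial operators\<close>

lemma ip_polyanalytic [simp]: "ip (polyanalytic_space n \<alpha>) = l2_ip \<alpha>"
  by (simp add: polyanalytic_space_def)

section \<open>The disk polynomials as an orthonormal basis\<close>

lemma W_norm:
  assumes "\<alpha> > -1" "\<xi> \<in> freqs n" "g \<in> vecs (W n \<alpha> \<xi>)"
  shows "Re (l2_ip \<alpha> g g) = (\<Sum>q\<in>coords n \<xi>. (cmod (l2_ip \<alpha> g (basis \<alpha> \<xi> q)))\<^sup>2)"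
  using W_ip_expand[OF assms(1,2) W_square_int[OF assms] assms(3)]
  unfolding complex_norm_square[symmetric] by simp

lemma polyanalytic_parseval:
  assumes \<alpha>: "\<alpha> > -1" and f: "f \<in> vecs (polyanalytic_space n \<alpha>)"
  shows "((\<lambda>\<xi>. \<Sum>q\<in>coords n \<xi>. (cmod (l2_ip \<alpha> f (basis \<alpha> \<xi> q)))\<^sup>2) has_sum Re (l2_ip \<alpha> f f)) (freqs n)"
proof -
  obtain F where F: "expansion n \<alpha> f F" by (rule expansion_exists[OF f])
  have sq: "square_int \<alpha> f" by (rule square_int_polyanalytic[OF f \<alpha>])
  have FW: "F k \<in> vecs (W n \<alpha> (freq n k))" for k using F by (simp add: expansion_def)
  have "Re (l2_ip \<alpha> (F k) (F k)) = (\<Sum>q\<in>coords n (freq n k). (cmod (l2_ip \<alpha> f (basis \<alpha> (freq n k) q)))\<^sup>2)" for k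
    unfolding W_norm[OF \<alpha> freq_in_freqs FW]
    by (intro sum.cong refl) (simp add: expansion_coeff[OF F \<alpha> sq basis_in_W[OF \<alpha> freq_in_freqs]])
  with expansion_sums[OF F \<alpha> sq]
  have "(\<lambda>k. \<Sum>q\<in>coords n (freq n k). (cmod (l2_ip \<alpha> f (basis \<alpha> (freq n k) q)))\<^sup>2) sums Re (l2_ip \<alpha> f f)" by simp
  then have "((\<lambda>k. \<Sum>q\<in>coords n (freq n k). (cmod (l2_ip \<alpha> f (basis \<alpha> (freq n k) q)))\<^sup>2) has_sum Re (l2_ip \<alpha> f f)) UNIV"
    by (rule sums_nonneg_imp_has_sum) (simp add: sum_nonneg)
  then show ?thesis by (subst (asm) has_sum_reindex_bij_betw[OF bij_betw_freq])
qed

lemma polyanalytic_inner_product: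
  assumes \<alpha>: "\<alpha> > -1"
  shows "inner_product_fspace (polyanalytic_space n \<alpha>)"
proof
  show "cfun.subspace (vecs (polyanalytic_space n \<alpha>))" by (rule polyanalytic_subspace[OF \<alpha>])
  note sq = square_int_polyanalytic[OF _ \<alpha>]
  fix f g h c
  show "f \<in> vecs (polyanalytic_space n \<alpha>) \<Longrightarrow> g \<in> vecs (polyanalytic_space n \<alpha>) \<Longrightarrow> h \<in> vecs (polyanalytic_space n \<alpha>) \<Longrightarrow>
     ip (polyanalytic_space n \<alpha>) (f + g) h = ip (polyanalytic_space n \<alpha>) f h + ip (polyanalytic_space n \<alpha>) g h"
    unfolding ip_polyanalytic by (intro l2_ip_add_left sq)
  show "ip (polyanalytic_space n \<alpha>) (fscale c f) h = c * ip (polyanalytic_space n \<alpha>) f h"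
    unfolding ip_polyanalytic by (rule l2_ip_fscale_left)
  show "ip (polyanalytic_space n \<alpha>) g f = cnj (ip (polyanalytic_space n \<alpha>) f g)"
    unfolding ip_polyanalytic by (rule l2_ip_commute)
  show "0 \<le> Re (ip (polyanalytic_space n \<alpha>) f f)"
    unfolding ip_polyanalytic by (rule l2_ip_nonneg)
  assume f: "f \<in> vecs (polyanalytic_space n \<alpha>)" and "Re (ip (polyanalytic_space n \<alpha>) f f) = 0"
  then have z: "Re (l2_ip \<alpha> f f) = 0" by simp
  \<comment> \<open>Definiteness asks for \<open>f = 0\<close> at every point, not just almost
    everywhere. Zero norm forces all blocks to vanish, and the expansion converges
    pointwise.\<close>
  obtain F where F: "expansion n \<alpha> f F" by (rule expansion_exists[OF f])
  have FW: "F k \<in> vecs (W n \<alpha> (freq n k))" for k using F by (simp add: expansion_def)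
  have s: "(\<lambda>k. Re (l2_ip \<alpha> (F k) (F k))) sums 0" using expansion_sums[OF F \<alpha> sq[OF f]] z by simp
  have "Re (l2_ip \<alpha> (F k) (F k)) = 0" for k
    using s suminf_eq_zero_iff[of "\<lambda>k. Re (l2_ip \<alpha> (F k) (F k))"] by (simp add: sums_iff l2_ip_nonneg)
  then have "\<forall>q\<in>coords n (freq n k). (cmod (l2_ip \<alpha> (F k) (basis \<alpha> (freq n k) q)))\<^sup>2 = 0" for k
    unfolding W_norm[OF \<alpha> freq_in_freqs FW] by (subst (asm) sum_nonneg_eq_0_iff) auto
  then have "F k = 0" for k
    by (subst W_expand[OF \<alpha> freq_in_freqs FW]) simp
  then have "(\<lambda>k. 0) sums f z" for z using expansion_pointwise[OF F \<alpha>, of z] by simp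
  then have "f z = 0" for z using sums_unique2[OF sums_zero] by metis
  then show "f = 0" by auto
qed

text \<open>Square summable coordinates are bounded by \<open>sqrt M\<close>, so they have an
  expansion with an n-analytic limit. \<open>expansion_norm\<close> shows that the limit is square
  integrable, after which \<open>expansion_coeff\<close> returns the prescribed coordinates.\<close>

lemma polyanalytic_synthesis:
  assumes \<alpha>: "\<alpha> > -1" and x: "(\<lambda>\<xi>. \<Sum>q\<in>coords n \<xi>. (cmod (x \<xi> q))\<^sup>2) summable_on freqs n"
  shows "\<exists>f\<in>vecs (polyanalytic_space n \<alpha>). \<forall>\<xi>\<in>freqs n. \<forall>q\<in>coords n \<xi>. l2_ip \<alpha> f (basis \<alpha> \<xi> q) = x \<xi> q"
proof -
  let ?N = "\<lambda>\<xi>. \<Sum>q\<in>coords n \<xi>. (cmod (x \<xi> q))\<^sup>2"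
  define M where "M = infsum ?N (freqs n)"
  have hs: "(?N has_sum M) (freqs n)" unfolding M_def using x by simp
  have bound: "cmod (x \<xi> q) \<le> sqrt M" if "\<xi> \<in> freqs n" "q \<in> coords n \<xi>" for \<xi> q
  proof (rule real_le_rsqrt)
    have "(cmod (x \<xi> q))\<^sup>2 \<le> ?N \<xi>" using that(2) by (intro member_le_sum) auto
    also have "?N \<xi> = sum ?N {\<xi>}" by simp
    also have "\<dots> \<le> M" using that(1) by (intro finite_sum_le_has_sum[OF hs]) (auto intro: sum_nonneg)
    finally show "(cmod (x \<xi> q))\<^sup>2 \<le> M" .
  qed
  let ?F = "\<lambda>k. \<Sum>q\<in>coords n (freq n k). fscale (x (freq n k) q) (basis \<alpha> (freq n k) q)"
  obtain f where F: "expansion n \<alpha> f ?F" and an: "n_analytic_on n (ball 0 1) f"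
    by (rule expansion_of_coefficients[OF \<alpha> bound[OF freq_in_freqs]])
  have FW: "?F k \<in> vecs (W n \<alpha> (freq n k))" for k by (rule W_basis_sum[OF \<alpha> freq_in_freqs])
  have "Re (l2_ip \<alpha> (?F k) (?F k)) = ?N (freq n k)" for k
    unfolding W_norm[OF \<alpha> freq_in_freqs FW] by (intro sum.cong refl) (simp add: l2_ip_basis_sum[OF \<alpha>])
  then have "(\<integral>\<^sup>+z. ennreal ((cmod (f z))\<^sup>2) \<partial>mu \<alpha>) = (\<Sum>k. ennreal (?N (freq n k)))"
    using expansion_norm[OF F \<alpha>] by (simp only: nn_integral_l2_ip[OF W_square_int[OF \<alpha> freq_in_freqs FW]])
  also have "\<dots> = ennreal M"
  proof -
    have "((\<lambda>k. ?N (freq n k)) has_sum M) UNIV"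
      using hs by (subst has_sum_reindex_bij_betw[OF bij_betw_freq])
    then have "(\<lambda>k. ?N (freq n k)) sums M" by (rule has_sum_imp_sums)
    then show ?thesis by (intro suminf_ennreal_eq) (simp_all add: sum_nonneg)
  qed
  finally have nn: "(\<integral>\<^sup>+z. ennreal ((cmod (f z))\<^sup>2) \<partial>mu \<alpha>) = ennreal M" .
  have fm [measurable]: "f \<in> borel_measurable borel" by (rule expansion_measurable[OF F \<alpha>])
  have "integrable (mu \<alpha>) (\<lambda>z. (cmod (f z))\<^sup>2)"
    using nn by (intro integrableI_nonneg) auto
  then have fH: "f \<in> vecs (polyanalytic_space n \<alpha>)" and sq: "square_int \<alpha> f"
    using an F fm by (auto simp: polyanalytic_space_def expansion_def square_int_def)
  have "l2_ip \<alpha> f (basis \<alpha> \<xi> q) = x \<xi> q" if \<xi>: "\<xi> \<in> freqs n" and q: "q \<in> coords n \<xi>" for \<xi> q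
  proof -
    obtain k where k: "\<xi> = freq n k" using \<xi> bij_betw_freq[of n] unfolding bij_betw_def by blast
    have "l2_ip \<alpha> f (basis \<alpha> \<xi> q) = l2_ip \<alpha> (?F k) (basis \<alpha> \<xi> q)"
      using q unfolding k by (intro expansion_coeff[OF F \<alpha> sq] basis_in_W[OF \<alpha> freq_in_freqs])
    also have "\<dots> = x \<xi> q" using l2_ip_basis_sum[OF \<alpha>] q unfolding k by blast
    finally show ?thesis .
  qed
  with fH show ?thesis by blast
qed

lemma polyanalytic_orthonormal_blocks:
  assumes \<alpha>: "\<alpha> > -1"
  shows "orthonormal_blocks (polyanalytic_space n \<alpha>) (freqs n) (coords n) (basis \<alpha>) (W n \<alpha>)"
proof (intro orthonormal_blocks.intro orthonormal_blocks_axioms.intro polyanalytic_inner_product[OF \<alpha>])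
  show "freqs n \<noteq> {}" using freq_in_freqs by blast
  show "\<And>f. f \<in> vecs (polyanalytic_space n \<alpha>) \<Longrightarrow>
    ((\<lambda>\<xi>. \<Sum>q\<in>coords n \<xi>. (cmod (ip (polyanalytic_space n \<alpha>) f (basis \<alpha> \<xi> q)))\<^sup>2) has_sum Re (ip (polyanalytic_space n \<alpha>) f f)) (freqs n)"
    unfolding ip_polyanalytic by (rule polyanalytic_parseval[OF \<alpha>])
  show "\<And>x. (\<lambda>\<xi>. \<Sum>q\<in>coords n \<xi>. (cmod (x \<xi> q))\<^sup>2) summable_on freqs n \<Longrightarrow>
    \<exists>f\<in>vecs (polyanalytic_space n \<alpha>). \<forall>\<xi>\<in>freqs n. \<forall>q\<in>coords n \<xi>. ip (polyanalytic_space n \<alpha>) f (basis \<alpha> \<xi> q) = x \<xi> q"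
    unfolding ip_polyanalytic by (rule polyanalytic_synthesis[OF \<alpha>])
  show "\<And>\<xi> q. \<xi> \<in> freqs n \<Longrightarrow> q \<in> coords n \<xi> \<Longrightarrow> basis \<alpha> \<xi> q \<in> vecs (polyanalytic_space n \<alpha>)"
    using W_subset_polyanalytic[OF \<alpha>] basis_in_W[OF \<alpha>] by blast
  show "\<And>\<xi> q \<eta> r. \<xi> \<in> freqs n \<Longrightarrow> q \<in> coords n \<xi> \<Longrightarrow> \<eta> \<in> freqs n \<Longrightarrow> r \<in> coords n \<eta> \<Longrightarrow>
    ip (polyanalytic_space n \<alpha>) (basis \<alpha> \<xi> q) (basis \<alpha> \<eta> r) = (if \<xi> = \<eta> \<and> q = r then 1 else 0)"
    unfolding ip_polyanalytic by (rule basis_orthonormal[OF \<alpha>])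
qed (simp_all add: vecs_W_basis[OF \<alpha>])

section \<open>Rotations\<close>

lemma rotation_apply:
  "f \<in> vecs (polyanalytic_space n \<alpha>) \<Longrightarrow> rotation n \<alpha> \<tau> f = (\<lambda>z. f (inverse \<tau> * z))"
  by (simp add: rotation_def)

lemma rotation_mem:
  assumes \<alpha>: "\<alpha> > -1" and \<tau>: "cmod \<tau> = 1" and f: "f \<in> vecs (polyanalytic_space n \<alpha>)"
  shows "rotation n \<alpha> \<tau> f \<in> vecs (polyanalytic_space n \<alpha>)"
proof -
  have t: "cmod (inverse \<tau>) = 1" using \<tau> by (simp add: norm_inverse)
  from f have f': "polyanalytic_sum n f" "\<And>z. z \<notin> ball 0 1 \<Longrightarrow> f z = 0" "square_int \<alpha> f"
    unfolding vecs_polyanalytic_iff[OF \<alpha>] by auto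
  from f'(1) obtain g where g: "\<And>q. q < n \<Longrightarrow> g q holomorphic_on ball 0 1"
    and fg: "\<And>z. z \<in> ball 0 1 \<Longrightarrow> f z = (\<Sum>q<n. cnj z ^ q * g q z)"
    unfolding polyanalytic_sum_def by blast
  have ball: "inverse \<tau> * z \<in> ball 0 1 \<longleftrightarrow> z \<in> ball 0 1" for z by (simp only: mem_ball_0 norm_mult t mult_1)
  have "polyanalytic_sum n (\<lambda>z. f (inverse \<tau> * z))" unfolding polyanalytic_sum_def
  proof (intro exI[of _ "\<lambda>q z. cnj (inverse \<tau>) ^ q * g q (inverse \<tau> * z)"] conjI allI impI ballI)
    fix q assume "q < n"
    then have "(g q \<circ> (\<lambda>z. inverse \<tau> * z)) holomorphic_on ball 0 1"
      using ball by (intro holomorphic_on_compose_gen[OF _ g]) (auto intro!: holomorphic_intros simp del: mem_ball_0)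
    then show "(\<lambda>z. cnj (inverse \<tau>) ^ q * g q (inverse \<tau> * z)) holomorphic_on ball 0 1"
      by (auto intro!: holomorphic_intros simp: o_def)
  next
    fix z :: complex assume "z \<in> ball 0 1"
    then have "f (inverse \<tau> * z) = (\<Sum>q<n. cnj (inverse \<tau> * z) ^ q * g q (inverse \<tau> * z))"
      by (intro fg ball[THEN iffD2])
    also have "\<dots> = (\<Sum>q<n. cnj z ^ q * (cnj (inverse \<tau>) ^ q * g q (inverse \<tau> * z)))"
      by (simp only: complex_cnj_mult power_mult_distrib mult_ac)
    finally show "f (inverse \<tau> * z) = (\<Sum>q<n. cnj z ^ q * (cnj (inverse \<tau>) ^ q * g q (inverse \<tau> * z)))" .
  qed
  moreover have "square_int \<alpha> (\<lambda>z. f (inverse \<tau> * z))"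
  proof -
    have [measurable]: "f \<in> borel_measurable borel" using f'(3) by (simp add: square_int_def)
    have "integrable (distr (mu \<alpha>) borel (\<lambda>z. inverse \<tau> * z)) (\<lambda>z. (cmod (f z))\<^sup>2)"
      using f'(3) by (simp add: distr_mu_rotate[OF t] square_int_def)
    then show ?thesis unfolding square_int_def by (subst (asm) integrable_distr_eq) auto
  qed
  ultimately show ?thesis
    unfolding rotation_apply[OF f] vecs_polyanalytic_iff[OF \<alpha>] using f'(2) ball by blast
qed

text \<open>Invariance of the measure shifts the rotation to \<open>b\<close>, on which it acts as a
  scalar; conjugating a scalar of modulus 1 inverts it.\<close>

lemma l2_ip_rotate:
  assumes \<alpha>: "\<alpha> > -1" and \<tau>: "cmod \<tau> = 1" and f: "square_int \<alpha> f"
    and \<xi>: "\<xi> \<in> freqs n" and b: "b \<in> vecs (W n \<alpha> \<xi>)"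
  shows "l2_ip \<alpha> (\<lambda>z. f (inverse \<tau> * z)) b = inverse (\<tau> powi \<xi>) * l2_ip \<alpha> f b"
proof -
  have t0: "\<tau> \<noteq> 0" using \<tau> by auto
  have [measurable]: "f \<in> borel_measurable borel" "b \<in> borel_measurable borel"
    using f W_measurable[OF \<alpha> \<xi> b] by (auto simp: square_int_def)
  have "cnj \<tau> = inverse \<tau>" using complex_norm_square[of \<tau>] \<tau> by (simp add: inverse_unique)
  then have c: "cnj (\<tau> powi \<xi>) = inverse (\<tau> powi \<xi>)" by (simp add: power_int_inverse)
  have "l2_ip \<alpha> (\<lambda>z. f (inverse \<tau> * z)) b = (LINT z|distr (mu \<alpha>) borel (\<lambda>z. \<tau> * z). f (inverse \<tau> * z) * cnj (b z))"
    by (simp add: l2_ip_def distr_mu_rotate[OF \<tau>])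
  also have "\<dots> = (LINT z|mu \<alpha>. f (inverse \<tau> * (\<tau> * z)) * cnj (b (\<tau> * z)))"
    by (subst integral_distr) auto
  also have "\<dots> = (LINT z|mu \<alpha>. inverse (\<tau> powi \<xi>) * (f z * cnj (b z)))"
  proof (intro Bochner_Integration.integral_cong refl)
    fix z
    have "inverse \<tau> * (\<tau> * z) = z" using t0 by (simp add: mult.assoc[symmetric])
    then show "f (inverse \<tau> * (\<tau> * z)) * cnj (b (\<tau> * z)) = inverse (\<tau> powi \<xi>) * (f z * cnj (b z))"
      by (simp only: W_rotate[OF \<alpha> \<xi> b \<tau>] complex_cnj_mult c mult.left_commute)
  qed
  finally show ?thesis by (simp add: l2_ip_def)
qed

section \<open>Radial operators are the operators preserving every block\<close>

context
  fixes n :: nat and \<alpha> :: real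
  assumes \<alpha>: "\<alpha> > -1"
begin

interpretation O: orthonormal_blocks "polyanalytic_space n \<alpha>" "freqs n" "coords n" "basis \<alpha>" "W n \<alpha>"
  by (rule polyanalytic_orthonormal_blocks[OF \<alpha>])

lemma proj_rotation:
  assumes \<tau>: "cmod \<tau> = 1" and f: "f \<in> vecs (polyanalytic_space n \<alpha>)" and \<xi>: "\<xi> \<in> freqs n"
  shows "O.proj \<xi> (rotation n \<alpha> \<tau> f) = fscale (inverse (\<tau> powi \<xi>)) (O.proj \<xi> f)"
  unfolding O.proj_def rotation_apply[OF f] ip_polyanalytic cfun.scale_sum_right cfun.scale_scale
  by (intro sum.cong refl arg_cong2[where f=fscale] l2_ip_rotate[OF \<alpha> \<tau> square_int_polyanalytic[OF f \<alpha>] \<xi>] basis_in_W[OF \<alpha> \<xi>])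

text \<open>On each block a rotation is a scalar and commutes with the linear operator
  \<open>S\<close>; comparing projections extends this to the whole space.\<close>

lemma diag_ops_radial:
  assumes S: "S \<in> O.diag_ops"
  shows "S \<in> radial_ops n \<alpha>"
proof -
  let ?H = "polyanalytic_space n \<alpha>"
  have "S (rotation n \<alpha> \<tau> f) = rotation n \<alpha> \<tau> (S f)" if \<tau>: "cmod \<tau> = 1" and f: "f \<in> vecs ?H" for \<tau> f
  proof (rule O.proj_ext)
    note Sf = O.diag_ops_mem[OF S f] and Rf = rotation_mem[OF \<alpha> \<tau> f]
    show "S (rotation n \<alpha> \<tau> f) \<in> vecs ?H" by (rule O.diag_ops_mem[OF S Rf])
    show "rotation n \<alpha> \<tau> (S f) \<in> vecs ?H" by (rule rotation_mem[OF \<alpha> \<tau> Sf])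
    fix \<xi> assume \<xi>: "\<xi> \<in> freqs n"
    have "O.proj \<xi> (S (rotation n \<alpha> \<tau> f)) = S (fscale (inverse (\<tau> powi \<xi>)) (O.proj \<xi> f))"
      unfolding O.proj_commute[OF S Rf \<xi>] proj_rotation[OF \<tau> f \<xi>] ..
    also have "\<dots> = fscale (inverse (\<tau> powi \<xi>)) (S (O.proj \<xi> f))"
      by (rule linear_mapD(3)[OF O.diag_ops_linear[OF S] O.proj_mem[OF \<xi>]])
    also have "\<dots> = O.proj \<xi> (rotation n \<alpha> \<tau> (S f))"
      unfolding proj_rotation[OF \<tau> Sf \<xi>] O.proj_commute[OF S f \<xi>] ..
    finally show "O.proj \<xi> (S (rotation n \<alpha> \<tau> f)) = O.proj \<xi> (rotation n \<alpha> \<tau> (S f))" .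
  qed
  then show ?thesis
    using O.diag_ops_bounded[OF S] by (auto simp: radial_ops_def compose_def restrict_def fun_eq_iff)
qed

text \<open>A vector of a block is a common eigenvector of the rotations, and \<open>S\<close> keeps
  the eigenvalues. Its image is thus homogeneous of degree \<xi>, hence orthogonal to the other
  blocks and equal to its own projection.\<close>

lemma radial_ops_diag:
  assumes S: "S \<in> radial_ops n \<alpha>"
  shows "S \<in> O.diag_ops"
proof -
  let ?H = "polyanalytic_space n \<alpha>"
  have Sb: "S \<in> bounded_ops ?H" using S by (simp add: radial_ops_def)
  then have lin: "linear_map ?H ?H S" by (simp add: bounded_ops_def)
  have comm: "S (rotation n \<alpha> \<tau> f) = rotation n \<alpha> \<tau> (S f)" if "cmod \<tau> = 1" "f \<in> vecs ?H" for \<tau> f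
  proof -
    have "compose (vecs ?H) S (rotation n \<alpha> \<tau>) f = compose (vecs ?H) (rotation n \<alpha> \<tau>) S f"
      using S that(1) by (simp add: radial_ops_def)
    then show ?thesis using that(2) by (simp add: compose_eq)
  qed
  have "S g \<in> vecs (W n \<alpha> \<xi>)" if \<xi>: "\<xi> \<in> freqs n" and g: "g \<in> vecs (W n \<alpha> \<xi>)" for \<xi> g
  proof -
    have gH: "g \<in> vecs ?H" by (rule O.W_mem[OF \<xi> g])
    have Sg: "S g \<in> vecs ?H" by (rule linear_mapD(1)[OF lin gH])
    have hom: "S g (\<tau> * z) = \<tau> powi \<xi> * S g z" if \<tau>: "cmod \<tau> = 1" for \<tau> z
    proof -
      have t: "cmod (inverse \<tau>) = 1" using \<tau> by (simp add: norm_inverse)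
      \<comment> \<open>\<open>rotation\<close> composes with the inverse of its argument, so the
        argument \<open>inverse \<tau>\<close> evaluates \<open>g\<close> at
        \<open>\<tau> * z\<close>.\<close>
      have "rotation n \<alpha> (inverse \<tau>) g = fscale (\<tau> powi \<xi>) g"
        unfolding rotation_apply[OF gH] by (rule ext) (simp add: W_rotate[OF \<alpha> \<xi> g \<tau>] fscale_def)
      then have "rotation n \<alpha> (inverse \<tau>) (S g) = fscale (\<tau> powi \<xi>) (S g)"
        using comm[OF t gH] linear_mapD(3)[OF lin gH] by simp
      from fun_cong[OF this, of z] show ?thesis
        unfolding rotation_apply[OF Sg] by (simp add: fscale_def)
    qed
    have "O.proj \<xi> (S g) = S g"
    proof (rule O.proj_ext[OF O.proj_mem[OF \<xi>] Sg])
      fix \<eta> assume \<eta>: "\<eta> \<in> freqs n"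
      show "O.proj \<eta> (O.proj \<xi> (S g)) = O.proj \<eta> (S g)"
      proof (cases "\<eta> = \<xi>")
        case True
        then show ?thesis using O.proj_W[OF \<xi> O.proj_in_W[OF \<xi>]] by simp
      next
        case False
        have "l2_ip \<alpha> (S g) (basis \<alpha> \<eta> q) = 0" if q: "q \<in> coords n \<eta>" for q
        proof (rule l2_ip_homogeneous_zero[where k=\<xi> and l=\<eta>])
          show "S g \<in> borel_measurable borel" by (rule square_int_measurable[OF square_int_polyanalytic[OF Sg \<alpha>]])
          show "basis \<alpha> \<eta> q \<in> borel_measurable borel" by (rule square_int_measurable[OF square_int_disk_poly[OF \<alpha>]])
          show "\<xi> \<noteq> \<eta>" using False by simp
        qed (simp_all add: hom W_rotate[OF \<alpha> \<eta> basis_in_W[OF \<alpha> \<eta> q]])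
        then have "O.proj \<eta> (S g) = 0" unfolding O.proj_def by simp
        then show ?thesis using O.proj_other[OF \<xi> \<eta> _ O.proj_in_W[OF \<xi>]] False by simp
      qed
    qed
    then show ?thesis using O.proj_in_W[OF \<xi>, of "S g"] by simp
  qed
  then show ?thesis unfolding O.diag_ops_def using Sb by blast
qed

lemma radial_ops_eq_diag_ops: "radial_ops n \<alpha> = O.diag_ops"
  using diag_ops_radial radial_ops_diag by blast

lemma U_op_eq_coeff_map: "U_op n \<alpha> = O.coeff_map"
  unfolding U_op_def O.coeff_map_def ip_polyanalytic ..

lemma radial_structure:
  "radial_ops n \<alpha> = {S \<in> bounded_ops (polyanalytic_space n \<alpha>). \<forall>\<xi>\<in>freqs n. S ` vecs (W n \<alpha> \<xi>) \<subseteq> vecs (W n \<alpha> \<xi>)}"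
  "wstar_isomorphic (radial_alg n \<alpha>) (alg_sum (freqs n) (\<lambda>\<xi>. op_alg (W n \<alpha> \<xi>)))"
  "unitary_map (polyanalytic_space n \<alpha>) (seq_space n) (U_op n \<alpha>)"
  "(\<lambda>S. \<lambda>x\<in>vecs (seq_space n). U_op n \<alpha> (S (adj (polyanalytic_space n \<alpha>) (seq_space n) (U_op n \<alpha>) x)))
     ` radial_ops n \<alpha> = matrix_seqs n"
  unfolding radial_alg_def seq_space_def matrix_seqs_def U_op_eq_coeff_map radial_ops_eq_diag_ops
  by (fact O.diag_ops_def O.wstar_isomorphic_diag_ops O.unitary_coeff_map O.image_diag_ops)+

end

theorem theorem7p9:
  fixes n :: nat and \<alpha> :: real
  assumes "n \<ge> 1" and "\<alpha> > -1"
  shows "radial_ops n \<alpha> =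
           {S \<in> bounded_ops (polyanalytic_space n \<alpha>). \<forall>\<xi>\<ge>- int n + 1.
              S ` vecs (W_space \<alpha> \<xi> (nat (min (int n) (int n + \<xi>))))
                \<subseteq> vecs (W_space \<alpha> \<xi> (nat (min (int n) (int n + \<xi>))))}
       \<and> wstar_isomorphic (radial_alg n \<alpha>)
           (alg_sum {- int n + 1..}
             (\<lambda>\<xi>. op_alg (W_space \<alpha> \<xi> (nat (min (int n) (int n + \<xi>))))))
       \<and> unitary_map (polyanalytic_space n \<alpha>) (seq_space n) (U_op n \<alpha>)
       \<and> (\<lambda>S. \<lambda>x\<in>vecs (seq_space n).
             U_op n \<alpha> (S (adj (polyanalytic_space n \<alpha>) (seq_space n) (U_op n \<alpha>) x)))
           ` radial_ops n \<alpha> = matrix_seqs n"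
  using radial_structure[OF assms(2), of n] unfolding freqs_def Ball_def atLeast_iff by blast

end
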